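(* Let $\Omega\subset\mathbb{R}^{d+1}$ be the closure of an open, connected, bounded $C^2$-domain. There exists a number $\varepsilon_0\in(0,1)$, depending only on $\Omega$ and $d$, with the following property: if $n\in\mathbb{N}$, $\varepsilon\in(0,\varepsilon_0)$ and $\Lambda$ is a maximal $\frac{\varepsilon}{n}$-separated subset of $\Omega$ with respect to the metric $\rho_\Omega$, then for any $1\le p\le\infty$ and any polynomial $f$ on $\mathbb{R}^{d+1}$ of total degree at most $n$, $$C_1\Bigl(\sum_{\xi\in\Lambda}\bigl|U(\xi,\tfrac\varepsilon n)\bigr|\max_{\eta\in U(\xi,\varepsilon/n)}|f(\eta)|^p\Bigr)^{1/p}\le\|f\|_{L^p(\Omega)}\le C_2\Bigl(\sum_{\xi\in\Lambda}\bigl|U(\xi,\tfrac\varepsilon n)\bigr|\min_{\eta\in U(\xi,\varepsilon/n)}|f(\eta)|^p\Bigr)^{1/p},$$ with the usual change to the $\ell^\infty$-norm when $p=\infty$, where the constants $C_1,C_2>0$ are independent of $f$, $\varepsilon$ and $n$.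
   Context: Here $d\ge1$, $\Gamma=\partial\Omega$, $\|\cdot\|$ is the Euclidean norm, $|E|$ is Lebesgue measure, $\rho_\Omega(\xi,\eta)=\|\xi-\eta\|+\bigl|\sqrt{\mathrm{dist}(\xi,\Gamma)}-\sqrt{\mathrm{dist}(\eta,\Gamma)}\bigr|$ for $\xi,\eta\in\Omega$, and $U(\xi,t)=\{\eta\in\Omega:\rho_\Omega(\xi,\eta)\le t\}$. A set $\Lambda$ in a metric space $(X,\rho)$ is $\varepsilon$-separated if $\rho(\omega,\omega')\ge\varepsilon$ for any two distinct $\omega,\omega'\in\Lambda$; an $\varepsilon$-separated $\Lambda$ is called maximal if $\inf_{\omega\in\Lambda}\rho(x,\omega)<\varepsilon$ for every $x\in X$. $C^2$-domain: a bounded domain for which there are $\delta>0$, $M>0$ and a finite cover of the boundary by connected open sets $U_1,\dots,U_J$ such that (i) every $x$ in the domain with distance $<\delta$ to the boundary lies in some $U_j$ with $\mathrm{dist}(x,\partial U_j)>\delta$; (ii) for each $j$ there is a Cartesian coordinate system $(\xi_{j,1},\dots,\xi_{j,d+1})$ in $U_j$ in which the part of the domain in $U_j$ is given by $\xi_{j,d+1}\le f_j(\xi_{j,1},\dots,\xi_{j,d})$ with $f_j\in C^2(\mathbb{R}^d)$ and $\max_{i,k}\|\partial_i\partial_kf_j\|_\infty\le M$. *)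

theory Defs
  imports "HOL-Probability.Probability"
begin

text \<open>
  The space of dimension \<open>d + 1\<close> with \<open>d \<ge> 1\<close> is rendered as \<open>(real ^ 'd) \<times> real\<close>, where
  \<open>d = CARD('d)\<close>.  The norm and inner product of the product type are the Euclidean ones.
\<close>

section \<open>Domains of class C2\<close>

text \<open>\<^const>\<open>deriv\<close> is an unspecified value where the derivative does not exist, so existence is
  always required separately, in \<open>C1_fun\<close>.\<close>

definition partial_deriv :: "'d \<Rightarrow> (real ^ 'd \<Rightarrow> real) \<Rightarrow> real ^ 'd \<Rightarrow> real" where
  "partial_deriv i f x = deriv (\<lambda>t. f (x + t *\<^sub>R axis i 1)) 0"

definition C1_fun :: "(real ^ 'd \<Rightarrow> real) \<Rightarrow> bool" where
  "C1_fun f \<longleftrightarrow>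
     (\<forall>i. (\<forall>x. (\<lambda>t. f (x + t *\<^sub>R axis i 1)) differentiable (at 0)) \<and>
          continuous_on UNIV (partial_deriv i f))"

definition C2_fun :: "(real ^ 'd \<Rightarrow> real) \<Rightarrow> bool" where
  "C2_fun f \<longleftrightarrow> C1_fun f \<and> (\<forall>i. C1_fun (partial_deriv i f))"

text \<open>
  A Cartesian coordinate system is given by its origin \<open>a\<close> and an orthogonal map \<open>A\<close>; the
  coordinates of \<open>x\<close> are those of \<open>A (x - a)\<close>, the last one being its second component.

  The part of the domain in \<open>U j\<close> is described by a non-strict inequality.  No nonempty bounded
  open set satisfies this, as the sets \<open>U j\<close> are open and cover the boundary.  Thus the predicate
  is meant for closed domains, i.e. for the closure of the underlying open set.

  As \<open>infdist\<close> to the empty set is 0, a set \<open>U j = UNIV\<close> never fulfils the distance condition.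
  This excludes nothing: for \<open>U j = UNIV\<close>, the bounded set \<open>D\<close> would be the whole region below a
  graph.
\<close>

definition C2_domain :: "((real ^ 'd) \<times> real) set \<Rightarrow> bool" where
  "C2_domain D \<longleftrightarrow> bounded D \<and>
     (\<exists>\<delta>>0. \<exists>M>0. \<exists>(J::nat) U.
        (\<forall>j<J. open (U j) \<and> connected (U j)) \<and>
        frontier D \<subseteq> (\<Union>j<J. U j) \<and>
        (\<forall>x\<in>D. infdist x (frontier D) < \<delta> \<longrightarrow>
           (\<exists>j<J. x \<in> U j \<and> infdist x (frontier (U j)) > \<delta>)) \<and>
        (\<forall>j<J. \<exists>a (A :: (real ^ 'd) \<times> real \<Rightarrow> (real ^ 'd) \<times> real) f.
           orthogonal_transformation A \<and> C2_fun f \<and>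
           (\<forall>i k x. \<bar>partial_deriv i (partial_deriv k f) x\<bar> \<le> M) \<and>
           D \<inter> U j = {x \<in> U j. snd (A (x - a)) \<le> f (fst (A (x - a)))}))"

section \<open>Metric and separated sets\<close>

definition rho :: "'a::euclidean_space set \<Rightarrow> 'a \<Rightarrow> 'a \<Rightarrow> real" where
  "rho \<Omega> \<xi> \<eta> = norm (\<xi> - \<eta>) +
     \<bar>sqrt (infdist \<xi> (frontier \<Omega>)) - sqrt (infdist \<eta> (frontier \<Omega>))\<bar>"

definition rho_ball :: "'a::euclidean_space set \<Rightarrow> 'a \<Rightarrow> real \<Rightarrow> 'a set" where
  "rho_ball \<Omega> \<xi> t = {\<eta> \<in> \<Omega>. rho \<Omega> \<xi> \<eta> \<le> t}"

definition eps_separated :: "('a \<Rightarrow> 'a \<Rightarrow> real) \<Rightarrow> real \<Rightarrow> 'a set \<Rightarrow> bool" where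
  "eps_separated dst \<epsilon> \<Lambda> \<longleftrightarrow> (\<forall>\<omega>\<in>\<Lambda>. \<forall>\<omega>'\<in>\<Lambda>. \<omega> \<noteq> \<omega>' \<longrightarrow> dst \<omega> \<omega>' \<ge> \<epsilon>)"

text \<open>The infimum is taken in \<^typ>\<open>ereal\<close>, so that it is \<open>\<infinity>\<close> over the empty set.\<close>

definition maximal_eps_separated ::
    "'a set \<Rightarrow> ('a \<Rightarrow> 'a \<Rightarrow> real) \<Rightarrow> real \<Rightarrow> 'a set \<Rightarrow> bool" where
  "maximal_eps_separated X dst \<epsilon> \<Lambda> \<longleftrightarrow> \<Lambda> \<subseteq> X \<and> eps_separated dst \<epsilon> \<Lambda> \<and>
     (\<forall>x\<in>X. (INF \<omega>\<in>\<Lambda>. ereal (dst x \<omega>)) < ereal \<epsilon>)"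

section \<open>Polynomials and norms\<close>

text \<open>Real polynomial functions of total degree at most \<open>n\<close>; the sum ranges over the finitely many
  multi-indices \<open>\<alpha>\<close> with \<open>\<bar>\<alpha>\<bar> \<le> n\<close>.\<close>

definition poly_degree_le :: "nat \<Rightarrow> ('a::euclidean_space \<Rightarrow> real) \<Rightarrow> bool" where
  "poly_degree_le n f \<longleftrightarrow>
     (\<exists>c :: ('a \<Rightarrow> nat) \<Rightarrow> real. \<forall>x.
        f x = (\<Sum>\<alpha> | \<alpha> \<in> Basis \<rightarrow>\<^sub>E UNIV \<and> (\<Sum>b\<in>Basis. \<alpha> b) \<le> n.
                 c \<alpha> * (\<Prod>b\<in>Basis. (x \<bullet> b) ^ \<alpha> b)))"

text \<open>Exponents \<open>p\<close> are in \<^typ>\<open>ereal\<close> to include \<open>p = \<infinity>\<close>.\<close>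

definition Lp_norm :: "'a::euclidean_space set \<Rightarrow> ereal \<Rightarrow> ('a \<Rightarrow> real) \<Rightarrow> real" where
  "Lp_norm \<Omega> p f =
     (if p = \<infinity> then real_of_ereal (esssup (lebesgue_on \<Omega>) (\<lambda>x. ereal \<bar>f x\<bar>))
      else (LINT x|lebesgue_on \<Omega>. \<bar>f x\<bar> powr real_of_ereal p) powr (1 / real_of_ereal p))"

text \<open>
  The maxima and minima over \<open>rho_ball \<Omega> \<xi> t\<close> are written as \<open>SUP\<close> and \<open>INF\<close>: for closed bounded
  \<open>\<Omega>\<close> this set is compact, and contains \<open>\<xi>\<close>, so they are attained by continuous \<open>f\<close>.  The sum
  over \<open>\<Lambda>\<close> is a finite one, because a separated subset of a compact \<open>\<Omega>\<close> is finite.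
\<close>

definition max_norm ::
    "'a::euclidean_space set \<Rightarrow> 'a set \<Rightarrow> real \<Rightarrow> ereal \<Rightarrow> ('a \<Rightarrow> real) \<Rightarrow> real" where
  "max_norm \<Omega> \<Lambda> t p f =
     (if p = \<infinity> then (SUP \<xi>\<in>\<Lambda>. SUP \<eta>\<in>rho_ball \<Omega> \<xi> t. \<bar>f \<eta>\<bar>)
      else (\<Sum>\<xi>\<in>\<Lambda>. measure lebesgue (rho_ball \<Omega> \<xi> t) *
              (SUP \<eta>\<in>rho_ball \<Omega> \<xi> t. \<bar>f \<eta>\<bar> powr real_of_ereal p))
           powr (1 / real_of_ereal p))"

definition min_norm ::
    "'a::euclidean_space set \<Rightarrow> 'a set \<Rightarrow> real \<Rightarrow> ereal \<Rightarrow> ('a \<Rightarrow> real) \<Rightarrow> real" where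
  "min_norm \<Omega> \<Lambda> t p f =
     (if p = \<infinity> then (SUP \<xi>\<in>\<Lambda>. INF \<eta>\<in>rho_ball \<Omega> \<xi> t. \<bar>f \<eta>\<bar>)
      else (\<Sum>\<xi>\<in>\<Lambda>. measure lebesgue (rho_ball \<Omega> \<xi> t) *
              (INF \<eta>\<in>rho_ball \<Omega> \<xi> t. \<bar>f \<eta>\<bar> powr real_of_ereal p))
           powr (1 / real_of_ereal p))"

end

theory Submission
  imports Defs
begin

text \<open>
  The theorem follows from an oscillation estimate: if \<open>\<rho>(x, \<eta>) \<le> 2\<epsilon>/n\<close>, then \<open>|f x - f \<eta>|\<close> is at most
  \<open>C \<epsilon>\<close> times a convex combination of values \<open>|f|\<close> at finitely many points \<open>\<Phi>\<^sub>k x\<close> of \<open>\<Omega>\<close>, where every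
  \<open>\<Phi>\<^sub>k\<close> preserves Lebesgue measure.  Convexity of \<open>t\<^sup>p\<close> turns this into an \<open>L\<^sup>p\<close> bound with a constant
  independent of \<open>p\<close>, and for small \<open>\<epsilon>\<close> the oscillation is absorbed.

  In one variable, such a formula comes from discretising the convolution of a trigonometric polynomial
  with a de la Vallee Poussin kernel.  Its tensor products apply to \<open>f\<close> composed with a parametrisation
  that is quadratic in each variable.  Near a boundary given by \<open>y = g u\<close>, a point \<open>(u, y)\<close> is lifted to
  \<open>(u, v)\<close> with \<open>v\<close> in the plane and \<open>|v|\<^sup>2 = g u - y\<close>; this makes \<open>\<rho>\<close> Euclidean, and Lebesgue measure is
  the image of Lebesgue measure up to the factor \<open>\<pi>\<close>.  The parametrisation
  \<open>(h, w) \<mapsto> (u + h, g u + \<nabla>g(u) h - M\<^sub>1 |h|\<^sup>2 + s - |v + w|\<^sup>2)\<close> stays inside \<open>\<Omega>\<close> at the nodes because they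
  keep a distance of order \<open>1/n\<close> from \<open>h = 0\<close>, and for fixed \<open>(h, w)\<close> it is a shear in \<open>(u, y)\<close>.
\<close>

section \<open>A kernel formula for polynomials in one variable\<close>

text \<open>The kernel is a product of two Dirichlet kernels because its coefficients must decay
  like the inverse square of the distance to the node: their sum then stays bounded as n grows, and
  they are dominated by a convex combination. A coefficient varies by a constant times n per unit of
  the variable, so a displacement of order \<epsilon>/n produces the factor \<epsilon>.

  The obstacle is the boundary. Translated points may leave the domain, and a graph that is merely
  C2 cannot be followed by a polynomial map. The linear part of g, frozen at u, keeps the map
  quadratic; the loss \<open>M\<^sub>1 |h|\<^sup>2\<close> covers the Taylor error and leaves room
  of order 1/n^2 at the nodes, part of which the shift s consumes. The auxiliary plane is
  two-dimensional because the area of a disc is linear in the square of its radius, so that the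
  image measure has constant density. Finally, \<rho> contains the distance to the boundary, but the
  lift sees only the vertical depth below the graph; that the square roots of depths are Lipschitz
  for \<rho> needs an argument of its own, based on second differences of g.\<close>

inductive trig_poly :: "nat \<Rightarrow> (real \<Rightarrow> complex) \<Rightarrow> bool" for N where
  cis: "\<bar>l\<bar> \<le> int N \<Longrightarrow> trig_poly N (\<lambda>\<theta>. cis (of_int l * \<theta>))"
| add: "trig_poly N f \<Longrightarrow> trig_poly N g \<Longrightarrow> trig_poly N (\<lambda>\<theta>. f \<theta> + g \<theta>)"
| scale: "trig_poly N f \<Longrightarrow> trig_poly N (\<lambda>\<theta>. c * f \<theta>)"

text \<open>Multiplication by the sine splits each frequency into its two neighbours. This is the
  induction step by which a polynomial in \<open>r * sin \<theta>\<close> becomes a trigonometric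
  polynomial of the same degree.\<close>

lemma trig_poly_mult_sin:
  assumes "trig_poly N f" shows "trig_poly (Suc N) (\<lambda>\<theta>. complex_of_real (sin \<theta>) * f \<theta>)"
  using assms
proof induction
  case (cis l)
  have "trig_poly (Suc N) (\<lambda>\<theta>. 1 / (2 * \<i>) * cis (of_int (l + 1) * \<theta>) + (- 1 / (2 * \<i>)) * cis (of_int (l - 1) * \<theta>))"
    using cis by (intro trig_poly.intros) auto
  moreover have "1 / (2 * \<i>) * cis (of_int (l + 1) * \<theta>) + (- 1 / (2 * \<i>)) * cis (of_int (l - 1) * \<theta>)
      = of_real (sin \<theta>) * cis (of_int l * \<theta>)" for \<theta>
  proof -
    have "cis (of_int (l + 1) * \<theta>) = cis (of_int l * \<theta>) * cis \<theta>"
      "cis (of_int (l - 1) * \<theta>) = cis (of_int l * \<theta>) * cis (- \<theta>)"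
      by (simp_all add: cis_mult algebra_simps)
    moreover have "cis \<theta> - cis (- \<theta>) = 2 * \<i> * of_real (sin \<theta>)"
      by (simp add: complex_eq_iff)
    ultimately have "1 / (2 * \<i>) * cis (of_int (l + 1) * \<theta>) + (- 1 / (2 * \<i>)) * cis (of_int (l - 1) * \<theta>)
      = 1 / (2 * \<i>) * cis (of_int l * \<theta>) * (2 * \<i> * of_real (sin \<theta>))"
      by (metis (no_types, opaque_lifting) diff_conv_add_uminus minus_divide_left mult.assoc mult_minus_left right_diff_distrib)
    also have "\<dots> = of_real (sin \<theta>) * cis (of_int l * \<theta>)"
      by (simp add: field_simps)
    finally show ?thesis .
  qed
  ultimately show ?case by simp
next
  case (add f g)
  then show ?case using trig_poly.add[OF add.IH] by (simp add: distrib_left)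
next
  case (scale f c)
  then show ?case using trig_poly.scale[OF scale.IH, of c] by (simp add: mult.left_commute)
qed

lemma trig_poly_const: "trig_poly N (\<lambda>\<theta>. c)"
  using trig_poly.scale[OF trig_poly.cis[of 0], of N c] by simp

lemma trig_poly_of_poly:
  assumes "degree p \<le> N" shows "trig_poly N (\<lambda>\<theta>. of_real (poly p (r * sin \<theta>)))"
  using assms
proof (induction p arbitrary: N)
  case 0
  then show ?case using trig_poly_const[of N 0] by simp
next
  case (pCons a p)
  show ?case
  proof (cases "p = 0")
    case True
    then show ?thesis using trig_poly_const[of N "of_real a"] by simp
  next
    case False
    then obtain N' where N': "N = Suc N'" "degree p \<le> N'"
      using pCons.prems by (cases N) auto
    have "trig_poly N (\<lambda>\<theta>. of_real a + of_real r * (of_real (sin \<theta>) * of_real (poly p (r * sin \<theta>))))"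
      unfolding N' by (intro trig_poly.add trig_poly_const trig_poly.scale trig_poly_mult_sin pCons.IH N')
    then show ?thesis by (simp add: mult.assoc)
  qed
qed

text \<open>The midpoints of the partition of [-\<pi>, \<pi>] into m equal intervals. For even m
  none of them is 0, and this gap is what later keeps the nodes away from the centre of the
  parametrisation.\<close>

definition kernel_node :: "nat \<Rightarrow> nat \<Rightarrow> real" where
  "kernel_node m k = (2 * real k + 1) * pi / real m - pi"

text \<open>Discrete orthogonality. For j \<noteq> 0 the terms form a geometric progression whose
  ratio z is an m-th root of unity, and z \<noteq> 1 because |j| < m prevents m from dividing
  j.\<close>

lemma sum_cis_kernel_node:
  assumes "even m" "\<bar>j\<bar> < int m"
  shows "(\<Sum>k<m. cis (of_int j * kernel_node m k)) = (if j = 0 then of_nat m else 0)"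
proof (cases "j = 0")
  case False
  define z where "z = cis (of_int j * (2 * pi / real m))"
  have m: "m > 0" using assms by auto
  have zm: "z ^ m = 1"
  proof -
    have "z ^ m = cis (2 * pi * of_int j)"
      unfolding z_def Complex.DeMoivre by (rule arg_cong[where f=cis]) (use m in simp)
    then show ?thesis by (simp add: cis_multiple_2pi)
  qed
  have "z \<noteq> 1"
  proof
    assume "z = 1"
    then have "cos (of_int j * (2 * pi / real m)) = 1"
      by (simp add: z_def complex_eq_iff)
    then obtain i :: int where "of_int j * (2 * pi / real m) = of_int i * 2 * pi"
      unfolding cos_one_2pi_int by blast
    then have "real_of_int j = of_int i * real m" using m by (simp add: field_simps)
    then have "j = i * int m" by (metis of_int_eq_iff of_int_mult of_int_of_nat_eq)
    then have "int m dvd j" by simp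
    then show False using assms(2) False
      by (meson dvd_imp_le_int not_le abs_of_nat abs_ge_self order.strict_trans2 zdvd_not_zless dvd_abs_iff zero_less_abs_iff)
  qed
  have "(\<Sum>k<m. cis (of_int j * kernel_node m k)) = (\<Sum>k<m. cis (of_int j * (pi / real m - pi)) * z ^ k)"
  proof (rule sum.cong)
    fix k
    have "of_int j * kernel_node m k = of_int j * (pi / real m - pi) + real k * (of_int j * (2 * pi / real m))"
      by (simp add: kernel_node_def field_simps add_divide_distrib)
    then show "cis (of_int j * kernel_node m k) = cis (of_int j * (pi / real m - pi)) * z ^ k"
      unfolding z_def Complex.DeMoivre cis_mult by simp
  qed simp
  also have "\<dots> = cis (of_int j * (pi / real m - pi)) * ((z ^ m - 1) / (z - 1))"
    using \<open>z \<noteq> 1\<close> by (simp add: geometric_sum sum_distrib_left[symmetric])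
  finally show ?thesis using False zm by simp
qed simp

definition dirichlet :: "nat \<Rightarrow> real \<Rightarrow> complex" where
  "dirichlet a x = (\<Sum>j\<in>{-int a..int a}. cis (of_int j * x))"

text \<open>A convolution, discretised without error. For |l| \<le> N the frequency l occurs 2N + 1
  times in the product of the two Dirichlet kernels, once for each j in -N..N, since then |l - j|
  \<le> 2N; hence the normalisation. As a function of the node, a summand has frequencies of modulus
  at most N + 2N + N = 4N < m, so the sum over the nodes acts like an integral. Both sides are
  linear in T, so single exponentials are enough.\<close>

lemma kernel_reproduce:
  assumes "trig_poly N T" and m: "m = 4 * N + 2"
  shows "T \<theta> = (\<Sum>k<m. T (kernel_node m k) *
     (dirichlet (2 * N) (\<theta> - kernel_node m k) * dirichlet N (\<theta> - kernel_node m k) / (of_nat (2 * N + 1) * of_nat m)))"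
  using assms(1)
proof induction
  case (cis l)
  let ?t = "kernel_node m"
  have 1: "(\<Sum>k<m. cis (of_int l * ?t k) * (cis (of_int i * (\<theta> - ?t k)) * cis (of_int j * (\<theta> - ?t k))))
     = (if i = l - j then of_nat m * cis (of_int l * \<theta>) else 0)"
    if ij: "i \<in> {-int (2 * N)..int (2 * N)}" "j \<in> {-int N..int N}" for i j
  proof -
    have "cis (of_int l * ?t k) * (cis (of_int i * (\<theta> - ?t k)) * cis (of_int j * (\<theta> - ?t k)))
       = cis (of_int (i + j) * \<theta>) * cis (of_int (l - i - j) * ?t k)" for k
      by (simp add: cis_mult algebra_simps)
    then have "(\<Sum>k<m. cis (of_int l * ?t k) * (cis (of_int i * (\<theta> - ?t k)) * cis (of_int j * (\<theta> - ?t k))))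
       = cis (of_int (i + j) * \<theta>) * (\<Sum>k<m. cis (of_int (l - i - j) * ?t k))"
      by (simp only: sum_distrib_left)
    moreover have "\<bar>l - i - j\<bar> < int m" using ij cis m by auto
    ultimately show ?thesis
      using m sum_cis_kernel_node[of m "l - i - j"]
      by (cases "i = l - j") (simp_all del: of_int_add of_int_diff)
  qed
  have "(\<Sum>k<m. cis (of_int l * ?t k) * (dirichlet (2 * N) (\<theta> - ?t k) * dirichlet N (\<theta> - ?t k)))
     = (\<Sum>k<m. \<Sum>i\<in>{-int (2 * N)..int (2 * N)}. \<Sum>j\<in>{-int N..int N}. cis (of_int l * ?t k) * (cis (of_int i * (\<theta> - ?t k)) * cis (of_int j * (\<theta> - ?t k))))"
    unfolding dirichlet_def sum_product by (simp add: sum_distrib_left)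
  also have "\<dots> = (\<Sum>i\<in>{-int (2 * N)..int (2 * N)}. \<Sum>k<m. \<Sum>j\<in>{-int N..int N}. cis (of_int l * ?t k) * (cis (of_int i * (\<theta> - ?t k)) * cis (of_int j * (\<theta> - ?t k))))"
    by (rule sum.swap)
  also have "\<dots> = (\<Sum>i\<in>{-int (2 * N)..int (2 * N)}. \<Sum>j\<in>{-int N..int N}. \<Sum>k<m. cis (of_int l * ?t k) * (cis (of_int i * (\<theta> - ?t k)) * cis (of_int j * (\<theta> - ?t k))))"
    by (intro sum.cong sum.swap refl)
  also have "\<dots> = (\<Sum>i\<in>{-int (2 * N)..int (2 * N)}. \<Sum>j\<in>{-int N..int N}. if i = l - j then of_nat m * cis (of_int l * \<theta>) else 0)"
    by (intro sum.cong refl 1)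
  also have "\<dots> = (\<Sum>j\<in>{-int N..int N}. \<Sum>i\<in>{-int (2 * N)..int (2 * N)}. if i = l - j then of_nat m * cis (of_int l * \<theta>) else 0)"
    by (rule sum.swap)
  also have "\<dots> = (\<Sum>j\<in>{-int N..int N}. of_nat m * cis (of_int l * \<theta>))"
    using cis by (intro sum.cong refl) (auto simp: sum.delta)
  also have "\<dots> = of_nat (2 * N + 1) * of_nat m * cis (of_int l * \<theta>)"
    by simp
  finally have 2: "(\<Sum>k<m. cis (of_int l * ?t k) * (dirichlet (2 * N) (\<theta> - ?t k) * dirichlet N (\<theta> - ?t k)))
    = of_nat (2 * N + 1) * of_nat m * cis (of_int l * \<theta>)" .
  have nz: "(of_nat (2 * N + 1) * of_nat m :: complex) \<noteq> 0"
    using m by (simp only: mult_eq_0_iff of_nat_eq_0_iff) simp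
  show ?case
    using nz unfolding times_divide_eq_right sum_divide_distrib[symmetric] 2 by simp
next
  case (add f g)
  show ?case
    by (subst add.IH(1), subst add.IH(2)) (simp only: distrib_right sum.distrib)
next
  case (scale f c)
  then show ?case by (simp add: mult.assoc sum_distrib_left)
qed

section \<open>Size and variation of the kernel coefficients\<close>

lemma sin_mult_dirichlet: "of_real (sin (x / 2)) * dirichlet a x = of_real (sin ((2 * real a + 1) * (x / 2)))"
proof (induction a)
  case 0
  then show ?case by (simp add: dirichlet_def)
next
  case (Suc a)
  have "{-int (Suc a)..int (Suc a)} = insert (- int (Suc a)) (insert (int (Suc a)) {-int a..int a})"
    by auto
  then have "dirichlet (Suc a) x = cis (- real (Suc a) * x) + cis (real (Suc a) * x) + dirichlet a x"
    unfolding dirichlet_def by (simp add: algebra_simps)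
  also have "cis (- real (Suc a) * x) + cis (real (Suc a) * x) = of_real (2 * cos (real (Suc a) * x))"
    by (simp only: complex_eq_iff mult_minus_left cis_cnj[symmetric] complex_cnj plus_complex.sel cis.sel Re_complex_of_real Im_complex_of_real cnj.sel)
      (simp only: mult_2 add.left_inverse simp_thms)
  finally have "of_real (sin (x / 2)) * dirichlet (Suc a) x =
     of_real (2 * cos (real (Suc a) * x) * sin (x / 2) + sin ((2 * real a + 1) * (x / 2)))"
    using Suc by (simp add: algebra_simps)
  moreover have "2 * cos (real (Suc a) * x) * sin (x / 2) + sin ((2 * real a + 1) * (x / 2)) = sin ((2 * real (Suc a) + 1) * (x / 2))"
  proof -
    have "(2 * real (Suc a) + 1) * (x / 2) = real (Suc a) * x + x / 2" "(2 * real a + 1) * (x / 2) = real (Suc a) * x - x / 2"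
      by (simp_all add: algebra_simps)
    then show ?thesis by (simp only: sin_add sin_diff)
  qed
  ultimately show ?case by (simp only:)
qed

text \<open>The cubic remainder of the sine is at most half of |y| as soon as |y|^2 \<le> 3, which
  holds because \<pi>/2 \<le> 1.7.\<close>

lemma abs_sin_ge_half:
  fixes y :: real
  assumes "\<bar>y\<bar> \<le> pi / 2"
  shows "\<bar>y\<bar> / 2 \<le> \<bar>sin y\<bar>"
proof -
  have "\<bar>sin y - (\<Sum>k<3. sin_coeff k * y ^ k)\<bar> \<le> inverse (fact 3) * \<bar>y\<bar> ^ 3"
    by (rule Maclaurin_sin_bound)
  then have 1: "\<bar>sin y - y\<bar> \<le> \<bar>y\<bar> ^ 3 / 6"
    by (simp add: numeral_3_eq_3 sin_coeff_def fact_numeral)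
  have "pi \<le> 34 / 10" by (rule order.trans[OF pi_approx(2)]) simp
  then have "\<bar>y\<bar> \<le> 17 / 10" using assms by linarith
  then have "\<bar>y\<bar> ^ 2 \<le> (17 / 10) ^ 2" by (intro power_mono) auto
  then have "\<bar>y\<bar> * \<bar>y\<bar> ^ 2 \<le> \<bar>y\<bar> * 3" by (intro mult_left_mono) (auto simp: power2_eq_square)
  then have "\<bar>y\<bar> ^ 3 / 6 \<le> \<bar>y\<bar> / 2" by (simp add: power3_eq_cube power2_eq_square mult_ac)
  with 1 show ?thesis by linarith
qed

text \<open>The distance of a node from 0 in units of \<pi>/m; for even m it is an odd
  number.\<close>

definition kernel_index :: "nat \<Rightarrow> nat \<Rightarrow> real" where
  "kernel_index m k = \<bar>2 * real k + 1 - real m\<bar>"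

lemma abs_kernel_node: "m > 0 \<Longrightarrow> \<bar>kernel_node m k\<bar> = kernel_index m k * (pi / real m)"
proof -
  assume "m > 0"
  then have "kernel_node m k = (2 * real k + 1 - real m) * (pi / real m)"
    by (simp add: kernel_node_def field_simps)
  then show ?thesis by (simp add: kernel_index_def abs_mult)
qed

lemma kernel_index_bounds:
  assumes "even m" "k < m"
  shows "1 \<le> kernel_index m k" "kernel_index m k \<le> real m - 1"
proof -
  have eq: "kernel_index m k = real_of_int \<bar>2 * int k + 1 - int m\<bar>"
    by (simp add: kernel_index_def)
  have "2 * int k + 1 - int m \<noteq> 0" using assms(1) by presburger
  then have "1 \<le> \<bar>2 * int k + 1 - int m\<bar>" by linarith
  moreover have "\<bar>2 * int k + 1 - int m\<bar> \<le> int m - 1" using assms(2) by linarith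
  ultimately show "1 \<le> kernel_index m k" "kernel_index m k \<le> real m - 1"
    unfolding eq by linarith+
qed

text \<open>From n = 1 on, the next term is at most 1/((n + 1)(n + 2)), which telescopes.\<close>

lemma sum_inverse_odd_squares: "(\<Sum>i<n. 1 / (2 * real i + 1)\<^sup>2) \<le> 2 - 1 / (real n + 1)"
proof (induction n)
  case (Suc n)
  show ?case
  proof (cases "n = 0")
    case False
    then have "1 \<le> real n" "0 \<le> real n * (real n * 3)" by simp_all
    then have "1 \<le> real n + real n * (real n * 3)" by linarith
    then have "(real n + 1) * (real n + 2) \<le> (2 * real n + 1)\<^sup>2"
      by (simp add: power2_eq_square algebra_simps)
    then have "1 / (2 * real n + 1)\<^sup>2 \<le> 1 / ((real n + 1) * (real n + 2))"
      by (intro divide_left_mono) (auto intro!: mult_pos_pos)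
    also have "1 / ((real n + 1) * (real n + 2)) = 1 / (real n + 1) - 1 / (real (Suc n) + 1)"
      by (simp add: field_simps)
    finally show ?thesis using Suc by simp
  qed simp
qed simp

text \<open>Each odd number below m is the index of exactly two nodes, placed symmetrically about
  0.\<close>

lemma sum_inverse_kernel_index:
  assumes "even m" shows "(\<Sum>k<m. 1 / (kernel_index m k)\<^sup>2) \<le> 4"
proof -
  obtain M where M: "m = 2 * M" using assms by auto
  have "(\<Sum>k<m. 1 / (kernel_index m k)\<^sup>2) = (\<Sum>k<M. 1 / (kernel_index m k)\<^sup>2) + (\<Sum>k=M..<m. 1 / (kernel_index m k)\<^sup>2)"
    using M sum.atLeastLessThan_concat[of 0 M m "\<lambda>k. 1 / (kernel_index m k)\<^sup>2"] by (simp add: atLeast0LessThan)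
  also have "(\<Sum>k=M..<m. 1 / (kernel_index m k)\<^sup>2) = (\<Sum>i<M. 1 / (2 * real i + 1)\<^sup>2)"
    by (rule sum.reindex_bij_witness[of _ "\<lambda>i. i + M" "\<lambda>k. k - M"]) (auto simp: M kernel_index_def of_nat_diff)
  also have "(\<Sum>k<M. 1 / (kernel_index m k)\<^sup>2) = (\<Sum>i<M. 1 / (2 * real i + 1)\<^sup>2)"
    by (rule sum.reindex_bij_witness[of _ "\<lambda>i. M - 1 - i" "\<lambda>k. M - 1 - k"])
      (auto simp: M kernel_index_def of_nat_diff algebra_simps power2_commute)
  finally show ?thesis using sum_inverse_odd_squares[of M] by (smt (verit) divide_nonneg_nonneg of_nat_0_le_iff)
qed

text \<open>The angle moves at most half way from 0 to the nearest node, so the distance to any node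
  shrinks at most by half. As the index is at most m - 1, half of the difference stays within
  \<pi>/2 in modulus, where the sine is comparable to its argument.\<close>

lemma abs_sin_half_node_ge:
  assumes m: "even m" "k < m" and th: "\<bar>\<theta>\<bar> \<le> pi / (2 * real m)"
  shows "kernel_index m k / (3 * real m) \<le> \<bar>sin ((\<theta> - kernel_node m k) / 2)\<bar>"
proof -
  have m0: "m > 0" using m by auto
  note ki = kernel_index_bounds[OF m]
  define P where "P = pi / (2 * real m)"
  have P: "pi / real m = 2 * P" by (simp add: P_def)
  have "P \<le> kernel_index m k * P"
    using mult_right_mono[OF ki(1), of P] by (simp add: P_def)
  moreover have "\<bar>kernel_node m k\<bar> = 2 * (kernel_index m k * P)"
    using abs_kernel_node[OF m0, of k] unfolding P by simp
  ultimately have "kernel_index m k * P \<le> \<bar>\<theta> - kernel_node m k\<bar>"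
    using th abs_triangle_ineq2_sym[of "kernel_node m k" \<theta>] unfolding P_def[symmetric] by linarith
  then have lo: "kernel_index m k * (pi / (2 * real m)) \<le> \<bar>\<theta> - kernel_node m k\<bar>"
    by (simp add: P_def)
  have "kernel_index m k * (pi / real m) \<le> (real m - 1) * (pi / real m)"
    using ki(2) by (intro mult_right_mono) auto
  also have "\<dots> = pi - 2 * (pi / (2 * real m))" using m0 by (simp add: field_simps)
  finally have "\<bar>\<theta> - kernel_node m k\<bar> \<le> pi"
    using abs_kernel_node[OF m0, of k] th by (smt (verit) divide_nonneg_nonneg of_nat_0_le_iff pi_ge_zero)
  then have "\<bar>(\<theta> - kernel_node m k) / 2\<bar> / 2 \<le> \<bar>sin ((\<theta> - kernel_node m k) / 2)\<bar>"
    by (intro abs_sin_ge_half) auto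
  moreover have "kernel_index m k / (3 * real m) \<le> kernel_index m k * (pi / (2 * real m)) / 4"
  proof -
    have "8 / 3 \<le> pi" using pi_gt3 by linarith
    then have "kernel_index m k * (8 / 3) \<le> kernel_index m k * pi" using ki by (intro mult_left_mono) auto
    then show ?thesis using m0 by (simp add: field_simps)
  qed
  moreover have "\<bar>(\<theta> - kernel_node m k) / 2\<bar> / 2 = \<bar>\<theta> - kernel_node m k\<bar> / 4" by simp
  moreover have "kernel_index m k * (pi / (2 * real m)) / 4 \<le> \<bar>\<theta> - kernel_node m k\<bar> / 4"
    using lo by (rule divide_right_mono) simp
  ultimately show ?thesis by (metis order.trans)
qed

text \<open>The Dirichlet kernel at 2y, away from its removable singularities.\<close>

definition sin_ratio :: "nat \<Rightarrow> real \<Rightarrow> real" where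
  "sin_ratio a y = sin ((2 * real a + 1) * y) / sin y"

definition kernel_coeff :: "nat \<Rightarrow> nat \<Rightarrow> real \<Rightarrow> real" where
  "kernel_coeff N k \<theta> = sin_ratio (2 * N) ((\<theta> - kernel_node (4 * N + 2) k) / 2) *
     sin_ratio N ((\<theta> - kernel_node (4 * N + 2) k) / 2) / (real (2 * N + 1) * real (4 * N + 2))"

lemma dirichlet_sin_ratio: "sin (x / 2) \<noteq> 0 \<Longrightarrow> dirichlet a x = of_real (sin_ratio a (x / 2))"
  using sin_mult_dirichlet[of x a] by (simp add: sin_ratio_def field_simps)

text \<open>The bound on \<theta> keeps it away from every node, so that both Dirichlet kernels may
  be written as quotients of sines and estimated as such.\<close>

lemma poly_sin_kernel:
  assumes "degree q \<le> N" "\<bar>\<theta>\<bar> \<le> pi / (2 * real (4 * N + 2))"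
  shows "poly q (r * sin \<theta>) = (\<Sum>k<4*N+2. kernel_coeff N k \<theta> * poly q (r * sin (kernel_node (4 * N + 2) k)))"
proof -
  define m where "m = 4 * N + 2"
  have "complex_of_real (poly q (r * sin \<theta>)) = (\<Sum>k<m. of_real (poly q (r * sin (kernel_node m k))) *
     (dirichlet (2 * N) (\<theta> - kernel_node m k) * dirichlet N (\<theta> - kernel_node m k) / (of_nat (2 * N + 1) * of_nat m)))"
    by (rule kernel_reproduce[OF trig_poly_of_poly[OF assms(1)] m_def])
  also have "\<dots> = (\<Sum>k<m. of_real (kernel_coeff N k \<theta> * poly q (r * sin (kernel_node m k))))"
  proof (rule sum.cong)
    fix k assume "k \<in> {..<m}"
    then have "kernel_index m k / (3 * real m) \<le> \<bar>sin ((\<theta> - kernel_node m k) / 2)\<bar>" "1 \<le> kernel_index m k"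
      using assms(2) by (intro abs_sin_half_node_ge kernel_index_bounds; simp add: m_def)+
    then have nz: "sin ((\<theta> - kernel_node m k) / 2) \<noteq> 0"
      using m_def by (smt (verit) divide_pos_pos of_nat_0_less_iff add_gr_0 zero_less_numeral)
    show "of_real (poly q (r * sin (kernel_node m k))) *
     (dirichlet (2 * N) (\<theta> - kernel_node m k) * dirichlet N (\<theta> - kernel_node m k) / (of_nat (2 * N + 1) * of_nat m))
       = complex_of_real (kernel_coeff N k \<theta> * poly q (r * sin (kernel_node m k)))"
      unfolding dirichlet_sin_ratio[OF nz] by (simp add: kernel_coeff_def m_def)
  qed simp
  also have "\<dots> = complex_of_real (\<Sum>k<m. kernel_coeff N k \<theta> * poly q (r * sin (kernel_node m k)))"
    by simp
  finally show ?thesis unfolding of_real_eq_iff m_def .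
qed

lemma sin_ratio_bounds:
  assumes b: "b > 0" "b \<le> 1" "b \<le> \<bar>sin y\<bar>" "b \<le> \<bar>sin y'\<bar>"
  shows "\<bar>sin_ratio a y\<bar> \<le> 1 / b"
    and "\<bar>sin_ratio a y - sin_ratio a y'\<bar> \<le> ((2 * real a + 1) + 1 / b) * (1 / b) * \<bar>y - y'\<bar>"
proof -
  have inv: "\<bar>1 / sin y\<bar> \<le> 1 / b" "\<bar>1 / sin y'\<bar> \<le> 1 / b" and nz: "sin y \<noteq> 0" "sin y' \<noteq> 0"
    using b by (auto simp: frac_le)
  show "\<bar>sin_ratio a y\<bar> \<le> 1 / b"
  proof -
    have "\<bar>sin_ratio a y\<bar> = \<bar>sin ((2 * real a + 1) * y)\<bar> * \<bar>1 / sin y\<bar>" by (simp add: sin_ratio_def)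
    also have "\<dots> \<le> 1 * (1 / b)" using inv by (intro mult_mono) auto
    finally show ?thesis by simp
  qed
  have lip: "\<bar>sin u - sin w\<bar> \<le> \<bar>u - w\<bar>" for u w :: real
  proof -
    have "\<bar>sin u - sin w\<bar> = 2 * \<bar>sin ((u - w) / 2)\<bar> * \<bar>cos ((u + w) / 2)\<bar>"
      by (simp add: sin_diff_sin abs_mult)
    also have "\<dots> \<le> 2 * \<bar>(u - w) / 2\<bar> * 1"
      using abs_sin_x_le_abs_x[of "(u - w) / 2"] by (intro mult_mono) auto
    finally show ?thesis by simp
  qed
  have "sin_ratio a y - sin_ratio a y' = (sin ((2 * real a + 1) * y) - sin ((2 * real a + 1) * y')) * (1 / sin y)
     + sin ((2 * real a + 1) * y') * ((sin y' - sin y) * (1 / sin y) * (1 / sin y'))"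
    using nz by (simp add: sin_ratio_def field_simps)
  also have "\<bar>\<dots>\<bar> \<le> \<bar>sin ((2 * real a + 1) * y) - sin ((2 * real a + 1) * y')\<bar> * \<bar>1 / sin y\<bar>
     + \<bar>sin ((2 * real a + 1) * y')\<bar> * (\<bar>sin y' - sin y\<bar> * \<bar>1 / sin y\<bar> * \<bar>1 / sin y'\<bar>)"
    unfolding abs_mult[symmetric] by (rule abs_triangle_ineq)
  also have "\<dots> \<le> ((2 * real a + 1) * \<bar>y - y'\<bar>) * (1 / b) + 1 * (\<bar>y - y'\<bar> * (1 / b) * (1 / b))"
  proof (intro add_mono mult_mono inv)
    have "\<bar>sin ((2 * real a + 1) * y) - sin ((2 * real a + 1) * y')\<bar> \<le> \<bar>(2 * real a + 1) * y - (2 * real a + 1) * y'\<bar>"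
      by (rule lip)
    also have "\<dots> = (2 * real a + 1) * \<bar>y - y'\<bar>" by (simp add: right_diff_distrib[symmetric] abs_mult)
    finally show "\<bar>sin ((2 * real a + 1) * y) - sin ((2 * real a + 1) * y')\<bar> \<le> (2 * real a + 1) * \<bar>y - y'\<bar>" .
    show "\<bar>sin y' - sin y\<bar> \<le> \<bar>y - y'\<bar>" using lip[of y' y] by simp
  qed (use b in auto)
  also have "\<dots> = ((2 * real a + 1) + 1 / b) * (1 / b) * \<bar>y - y'\<bar>" by (simp add: algebra_simps)
  finally show "\<bar>sin_ratio a y - sin_ratio a y'\<bar> \<le> ((2 * real a + 1) + 1 / b) * (1 / b) * \<bar>y - y'\<bar>" .
qed


text \<open>Each sine quotient is at most 1/b, which is 3m divided by the index, and the
  normalisation is m^2/2; this gives 9 * 2 = 18 and the quadratic decay. A single Dirichlet kernel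
  would decay only linearly in the index, and the sum over the nodes would grow like log m.\<close>

lemma kernel_coeff_bounds:
  assumes m: "m = 4 * N + 2" "k < m" and th: "\<bar>\<theta>\<bar> \<le> pi / (2 * real m)" "\<bar>\<theta>'\<bar> \<le> pi / (2 * real m)"
  shows "\<bar>kernel_coeff N k \<theta>\<bar> \<le> 18 * (1 / (kernel_index m k)\<^sup>2)"
    and "\<bar>kernel_coeff N k \<theta> - kernel_coeff N k \<theta>'\<bar> \<le> 72 * real m * \<bar>\<theta> - \<theta>'\<bar> * (1 / (kernel_index m k)\<^sup>2)"
proof -
  define y where "y = (\<theta> - kernel_node m k) / 2"
  define y' where "y' = (\<theta>' - kernel_node m k) / 2"
  define K where "K = kernel_index m k"
  define b where "b = K / (3 * real m)"
  have ev: "even m" and m0: "m > 0" using m by auto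
  have K: "1 \<le> K" "K \<le> real m - 1" using kernel_index_bounds[OF ev m(2)] by (auto simp: K_def)
  have b: "b > 0" "b \<le> 1" "b \<le> \<bar>sin y\<bar>" "b \<le> \<bar>sin y'\<bar>"
    using abs_sin_half_node_ge[OF ev m(2)] th K m0
    by (auto simp: b_def K_def y_def y'_def field_simps)
  define D where "D = real (2 * N + 1) * real (4 * N + 2)"
  have D: "D = (real m)\<^sup>2 / 2" using m by (auto simp: D_def power2_eq_square algebra_simps)
  have D0: "D > 0" unfolding D using m0 by simp
  have kc: "kernel_coeff N k \<theta> = sin_ratio (2 * N) y * sin_ratio N y / D"
    "kernel_coeff N k \<theta>' = sin_ratio (2 * N) y' * sin_ratio N y' / D"
    by (simp_all add: kernel_coeff_def y_def y'_def D_def m(1))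
  note r1 = sin_ratio_bounds(1)[OF b(1,2,3,4)] and r1' = sin_ratio_bounds(1)[OF b(1,2,4,3)]
  have ib: "1 / b = 3 * real m / K" by (simp add: b_def)
  \<comment> \<open>Both a = N and a = 2N satisfy 2a + 1 \<le> m, and 1/b \<le> 3m because the index
    is at least 1; hence 4m times 3m divided by the index.\<close>
  have r2: "\<bar>sin_ratio a y - sin_ratio a y'\<bar> \<le> 12 * (real m)\<^sup>2 / K * \<bar>y - y'\<bar>" if a: "a \<le> 2 * N" for a
  proof -
    have "2 * real a + 1 \<le> real m" using a m by linarith
    moreover have "1 / b \<le> 3 * real m" unfolding ib using K m0 by (simp add: field_simps)
    ultimately have "((2 * real a + 1) + 1 / b) * (1 / b) * \<bar>y - y'\<bar> \<le> (real m + 3 * real m) * (1 / b) * \<bar>y - y'\<bar>"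
      using b by (intro mult_right_mono add_mono) auto
    also have "\<dots> = 12 * (real m)\<^sup>2 / K * \<bar>y - y'\<bar>" unfolding ib by (simp add: power2_eq_square)
    finally show ?thesis using sin_ratio_bounds(2)[OF b, of a] by linarith
  qed
  show "\<bar>kernel_coeff N k \<theta>\<bar> \<le> 18 * (1 / (kernel_index m k)\<^sup>2)"
  proof -
    have "\<bar>sin_ratio (2 * N) y\<bar> * \<bar>sin_ratio N y\<bar> \<le> (3 * real m / K) * (3 * real m / K)"
      using r1 b unfolding ib by (intro mult_mono) (use K in auto)
    then have "\<bar>sin_ratio (2 * N) y\<bar> * \<bar>sin_ratio N y\<bar> / D \<le> (3 * real m / K) * (3 * real m / K) / D"
      using D0 by (intro divide_right_mono) auto
    then have "\<bar>kernel_coeff N k \<theta>\<bar> \<le> (3 * real m / K) * (3 * real m / K) / D"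
      unfolding kc abs_mult abs_divide using D0 by simp
    also have "\<dots> = 18 * (1 / K\<^sup>2)" using m0 K unfolding D by (simp add: field_simps power2_eq_square)
    finally show ?thesis unfolding K_def .
  qed
  have "\<bar>sin_ratio (2 * N) y * sin_ratio N y - sin_ratio (2 * N) y' * sin_ratio N y'\<bar>
     = \<bar>(sin_ratio (2 * N) y - sin_ratio (2 * N) y') * sin_ratio N y + sin_ratio (2 * N) y' * (sin_ratio N y - sin_ratio N y')\<bar>"
    by (simp add: algebra_simps)
  also have "\<dots> \<le> \<bar>sin_ratio (2 * N) y - sin_ratio (2 * N) y'\<bar> * \<bar>sin_ratio N y\<bar> + \<bar>sin_ratio (2 * N) y'\<bar> * \<bar>sin_ratio N y - sin_ratio N y'\<bar>"
    unfolding abs_mult[symmetric] by (rule abs_triangle_ineq)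
  also have "\<dots> \<le> (12 * (real m)\<^sup>2 / K * \<bar>y - y'\<bar>) * (3 * real m / K) + (3 * real m / K) * (12 * (real m)\<^sup>2 / K * \<bar>y - y'\<bar>)"
    using r1 r1' K unfolding ib by (intro add_mono mult_mono r2) auto
  finally have "\<bar>sin_ratio (2 * N) y * sin_ratio N y - sin_ratio (2 * N) y' * sin_ratio N y'\<bar>
     \<le> 36 * (real m)\<^sup>2 * real m / K\<^sup>2 * (2 * \<bar>y - y'\<bar>)" by (simp add: power2_eq_square)
  then have "\<bar>sin_ratio (2 * N) y * sin_ratio N y - sin_ratio (2 * N) y' * sin_ratio N y'\<bar> / D
     \<le> 36 * (real m)\<^sup>2 * real m / K\<^sup>2 * (2 * \<bar>y - y'\<bar>) / D"
    using D0 by (intro divide_right_mono) auto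
  then have "\<bar>kernel_coeff N k \<theta> - kernel_coeff N k \<theta>'\<bar> \<le> 36 * (real m)\<^sup>2 * real m / K\<^sup>2 * (2 * \<bar>y - y'\<bar>) / D"
    unfolding kc diff_divide_distrib[symmetric] abs_divide using D0 by simp
  also have "2 * \<bar>y - y'\<bar> = \<bar>\<theta> - \<theta>'\<bar>"
    unfolding y_def y'_def diff_divide_distrib[symmetric] by (simp add: abs_divide)
  also have "36 * (real m)\<^sup>2 * real m / K\<^sup>2 * \<bar>\<theta> - \<theta>'\<bar> / D = 72 * real m * \<bar>\<theta> - \<theta>'\<bar> * (1 / K\<^sup>2)"
    using m0 unfolding D by (simp add: field_simps)
  finally show "\<bar>kernel_coeff N k \<theta> - kernel_coeff N k \<theta>'\<bar> \<le> 72 * real m * \<bar>\<theta> - \<theta>'\<bar> * (1 / (kernel_index m k)\<^sup>2)"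
    unfolding K_def .
qed

section \<open>From angles back to a variable on an interval\<close>

lemma arcsin_bounds:
  fixes x x' :: real
  assumes "\<bar>x\<bar> \<le> 1 / 2" "\<bar>x'\<bar> \<le> 1 / 2"
  shows "\<bar>arcsin x - arcsin x'\<bar> \<le> 2 * \<bar>x - x'\<bar>"
proof -
  have "norm (arcsin x - arcsin x') \<le> 2 * norm (x - x')"
  proof (rule field_differentiable_bound[where S = "{-1/2..1/2}" and f' = "\<lambda>x. inverse (sqrt (1 - x\<^sup>2))"])
    fix z :: real assume z: "z \<in> {-1/2..1/2}"
    then show "(arcsin has_field_derivative inverse (sqrt (1 - z\<^sup>2))) (at z within {-1/2..1/2})"
      by (intro DERIV_subset[OF DERIV_arcsin]) auto
    have "z\<^sup>2 \<le> (1 / 2)\<^sup>2" using z by (intro abs_le_square_iff[THEN iffD1]) auto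
    then have "1 / 4 \<le> 1 - z\<^sup>2" by (simp add: power2_eq_square)
    then have "sqrt (1 / 4) \<le> sqrt (1 - z\<^sup>2)" by (rule real_sqrt_le_mono)
    then have "1 / 2 \<le> sqrt (1 - z\<^sup>2)" by (simp add: real_sqrt_divide)
    then show "norm (inverse (sqrt (1 - z\<^sup>2))) \<le> 2"
      using le_imp_inverse_le[of "1/2" "sqrt (1 - z\<^sup>2)"] by simp
  qed (use assms in auto)
  then show ?thesis by simp
qed

text \<open>The nodes are at distance at least \<pi>/m from 0, \<pi> and -\<pi>, the zeros of the
  sine on the relevant interval.\<close>

lemma abs_sin_kernel_node_ge:
  assumes m: "even m" "k < m" shows "1 / real m \<le> \<bar>sin (kernel_node m k)\<bar>"
proof -
  have m0: "m > 0" using m by auto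
  define t where "t = \<bar>kernel_node m k\<bar>"
  have t: "t = kernel_index m k * (pi / real m)" unfolding t_def by (rule abs_kernel_node[OF m0])
  have t1: "pi / real m \<le> t" unfolding t using kernel_index_bounds(1)[OF m] mult_right_mono[of 1 _ "pi / real m"] by simp
  have "t \<le> (real m - 1) * (pi / real m)" unfolding t using kernel_index_bounds(2)[OF m] by (intro mult_right_mono) auto
  also have "\<dots> = pi - pi / real m" using m0 by (simp add: field_simps)
  finally have t2: "t \<le> pi - pi / real m" .
  have "2 / real m \<le> pi / real m" using pi_ge_two by (intro divide_right_mono) auto
  have "\<bar>sin (kernel_node m k)\<bar> = \<bar>sin t\<bar>" by (simp add: t_def abs_if)
  moreover have "1 / real m \<le> \<bar>sin t\<bar>"
  proof (cases "t \<le> pi / 2")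
    case True
    have "0 \<le> t" by (simp add: t_def)
    then have "t / 2 \<le> \<bar>sin t\<bar>" using abs_sin_ge_half[of t] True by simp
    then show ?thesis using t1 \<open>2 / real m \<le> pi / real m\<close> by simp
  next
    case False
    have p: "0 \<le> pi / real m" by simp
    then have "\<bar>pi - t\<bar> / 2 \<le> \<bar>sin (pi - t)\<bar>" using False t2 by (intro abs_sin_ge_half) linarith
    then show ?thesis using t2 \<open>2 / real m \<le> pi / real m\<close> p by simp
  qed
  ultimately show ?thesis by simp
qed

text \<open>The substitution h = r sin \<theta> puts all nodes into [-r, r]. The weights are the
  inverse squares of the indices divided by their sum S. As S \<le> 4, passing from an inverse
  square to a weight costs a factor 4, and arcsin costs a factor 2 in the Lipschitz bound; the
  constants 18 * 4 and 72 * 2 * 4 = 576 are both rounded up to 600.\<close>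

lemma poly_kernel_1d:
  fixes r :: real
  assumes r: "r > 0" and m: "m = 4 * N + 2" and N: "N \<ge> 1"
  obtains \<tau> a :: "nat \<Rightarrow> real" and cf :: "nat \<Rightarrow> real \<Rightarrow> real"
  where "\<And>k. k < m \<Longrightarrow> r / real m \<le> \<bar>\<tau> k\<bar> \<and> \<bar>\<tau> k\<bar> \<le> r"
    and "\<And>k. k < m \<Longrightarrow> 0 \<le> a k" and "(\<Sum>k<m. a k) = 1"
    and "\<And>q h. degree q \<le> N \<Longrightarrow> \<bar>h\<bar> \<le> r / (2 * real m) \<Longrightarrow> poly q h = (\<Sum>k<m. cf k h * poly q (\<tau> k))"
    and "\<And>k h. k < m \<Longrightarrow> \<bar>h\<bar> \<le> r / (2 * real m) \<Longrightarrow> \<bar>cf k h\<bar> \<le> 600 * a k"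
    and "\<And>k h h'. k < m \<Longrightarrow> \<bar>h\<bar> \<le> r / (2 * real m) \<Longrightarrow> \<bar>h'\<bar> \<le> r / (2 * real m) \<Longrightarrow>
           \<bar>cf k h - cf k h'\<bar> \<le> 600 * a k * (real m / r * \<bar>h - h'\<bar>)"
proof -
  have ev: "even m" and m0: "real m \<ge> 6" using m N by auto
  define S where "S = (\<Sum>k<m. 1 / (kernel_index m k)\<^sup>2)"
  define a where "a k = (1 / (kernel_index m k)\<^sup>2) / S" for k
  define \<tau> where "\<tau> k = r * sin (kernel_node m k)" for k
  define cf where "cf k h = kernel_coeff N k (arcsin (h / r))" for k h
  have S4: "S \<le> 4" unfolding S_def by (rule sum_inverse_kernel_index[OF ev])
  have S0: "S > 0" unfolding S_def
  proof (rule sum_pos)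
    show "0 < 1 / (kernel_index m k)\<^sup>2" if "k \<in> {..<m}" for k
      using kernel_index_bounds(1)[OF ev, of k] that by auto
  qed (use m in \<open>auto simp: lessThan_empty_iff\<close>)
  have ka: "1 / (kernel_index m k)\<^sup>2 \<le> 4 * a k" for k
  proof -
    have "1 / (kernel_index m k)\<^sup>2 = S * a k" using S0 by (simp add: a_def)
    also have "\<dots> \<le> 4 * a k" using S4 S0 by (intro mult_right_mono) (auto simp: a_def)
    finally show ?thesis .
  qed
  have hb: "\<bar>h / r\<bar> \<le> 1 / 2" "\<bar>h / r\<bar> \<le> 1 / (2 * real m)" "\<bar>arcsin (h / r)\<bar> \<le> pi / (2 * real m)" "r * sin (arcsin (h / r)) = h"
    if "\<bar>h\<bar> \<le> r / (2 * real m)" for h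
  proof -
    show 1: "\<bar>h / r\<bar> \<le> 1 / (2 * real m)" using that r by (simp add: abs_divide field_simps)
    also have "1 / (2 * real m) \<le> 1 / 2" using m0 by (simp add: field_simps)
    finally show 2: "\<bar>h / r\<bar> \<le> 1 / 2" .
    have "\<bar>arcsin (h / r)\<bar> \<le> 2 * \<bar>h / r\<bar>" using arcsin_bounds[OF 2, of 0] by simp
    also have "\<dots> \<le> 2 * (1 / (2 * real m))" using 1 by linarith
    also have "\<dots> \<le> pi / (2 * real m)" using pi_ge_two m0 by (simp add: field_simps)
    finally show "\<bar>arcsin (h / r)\<bar> \<le> pi / (2 * real m)" .
    show "r * sin (arcsin (h / r)) = h"
      using 2 r by (subst sin_arcsin; (linarith | simp))
  qed
  show thesis
  proof (rule that[of \<tau> a cf])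
    show "r / real m \<le> \<bar>\<tau> k\<bar> \<and> \<bar>\<tau> k\<bar> \<le> r" if "k < m" for k
    proof
      show "r / real m \<le> \<bar>\<tau> k\<bar>"
        using mult_left_mono[OF abs_sin_kernel_node_ge[OF ev that], of r] r by (simp add: \<tau>_def abs_mult)
      show "\<bar>\<tau> k\<bar> \<le> r" using r mult_left_mono[OF abs_sin_le_one, of r] by (simp add: \<tau>_def abs_mult)
    qed
    show "0 \<le> a k" for k using S0 by (simp add: a_def)
    show "(\<Sum>k<m. a k) = 1" using S0 unfolding a_def sum_divide_distrib[symmetric] S_def[symmetric] by simp
    show "poly q h = (\<Sum>k<m. cf k h * poly q (\<tau> k))" if "degree q \<le> N" "\<bar>h\<bar> \<le> r / (2 * real m)" for q h
      using poly_sin_kernel[OF that(1) hb(3)[OF that(2), unfolded m], of r]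
      unfolding m cf_def \<tau>_def hb(4)[OF that(2)] .
    show "\<bar>cf k h\<bar> \<le> 600 * a k" if "k < m" "\<bar>h\<bar> \<le> r / (2 * real m)" for k h
      using kernel_coeff_bounds(1)[OF m that(1) hb(3)[OF that(2)] hb(3)[OF that(2)]] ka[of k] \<open>0 \<le> a k\<close>
      unfolding cf_def by linarith
    show "\<bar>cf k h - cf k h'\<bar> \<le> 600 * a k * (real m / r * \<bar>h - h'\<bar>)"
      if "k < m" "\<bar>h\<bar> \<le> r / (2 * real m)" "\<bar>h'\<bar> \<le> r / (2 * real m)" for k h h'
    proof -
      have "\<bar>cf k h - cf k h'\<bar> \<le> 72 * real m * \<bar>arcsin (h / r) - arcsin (h' / r)\<bar> * (1 / (kernel_index m k)\<^sup>2)"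
        unfolding cf_def by (rule kernel_coeff_bounds(2)[OF m that(1) hb(3)[OF that(2)] hb(3)[OF that(3)]])
      also have "\<dots> \<le> 72 * real m * (2 * \<bar>h / r - h' / r\<bar>) * (4 * a k)"
        by (intro mult_mono mult_left_mono arcsin_bounds hb ka that) auto
      also have "\<dots> = 576 * (a k * (real m / r * \<bar>h - h'\<bar>))"
        using r by (simp add: diff_divide_distrib[symmetric] abs_divide)
      also have "\<dots> \<le> 600 * (a k * (real m / r * \<bar>h - h'\<bar>))"
        using r \<open>0 \<le> a k\<close> by (intro mult_right_mono) auto
      finally show ?thesis by (simp add: mult_ac)
    qed
  qed
qed

section \<open>Tensor products of the kernel\<close>

lemma sum_PiE_insert:
  assumes "finite I" "i \<notin> I"
  shows "(\<Sum>k\<in>PiE (insert i I) (\<lambda>_. A). F k) = (\<Sum>j\<in>A. \<Sum>k\<in>PiE I (\<lambda>_. A). F (k(i := j)))"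
proof -
  have "(\<Sum>k\<in>PiE (insert i I) (\<lambda>_. A). F k) = (\<Sum>x\<in>A \<times> PiE I (\<lambda>_. A). F ((\<lambda>(y, g). g(i := y)) x))"
    unfolding PiE_insert_eq by (rule sum.reindex[unfolded o_def, OF inj_combinator[OF assms(2)]])
  then show ?thesis by (simp add: sum.cartesian_product case_prod_unfold)
qed

text \<open>Only the degree in each single variable counts, with the others frozen. Tensor products
  see nothing else, and this is what remains of a polynomial after composition with a map that is
  quadratic in each variable.\<close>

definition slice_poly :: "nat \<Rightarrow> 'i set \<Rightarrow> (('i \<Rightarrow> real) \<Rightarrow> real) \<Rightarrow> bool" where
  "slice_poly N I P \<longleftrightarrow> (\<forall>c. \<forall>i\<in>I. \<exists>q. degree q \<le> N \<and> (\<forall>t. P (c(i := t)) = poly q t))"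

text \<open>The factors are exchanged one at a time. The numbers \<open>e i\<close> measure the
  difference relative to the common bound \<open>b i\<close>, so that the whole product of bounds
  can be taken out.\<close>

lemma abs_prod_diff_le:
  fixes x y b e :: "'i \<Rightarrow> real"
  assumes "finite I" and "\<And>i. i \<in> I \<Longrightarrow> \<bar>x i\<bar> \<le> b i" "\<And>i. i \<in> I \<Longrightarrow> \<bar>y i\<bar> \<le> b i"
    "\<And>i. i \<in> I \<Longrightarrow> \<bar>x i - y i\<bar> \<le> b i * e i"
  shows "\<bar>(\<Prod>i\<in>I. x i) - (\<Prod>i\<in>I. y i)\<bar> \<le> (\<Prod>i\<in>I. b i) * (\<Sum>i\<in>I. e i)"
  using assms
proof (induction I rule: finite_induct)
  case (insert i I)
  have b: "0 \<le> b j" if "j \<in> insert i I" for j using insert.prems(1)[OF that] by linarith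
  have px: "\<bar>\<Prod>j\<in>I. y j\<bar> \<le> (\<Prod>j\<in>I. b j)"
    unfolding abs_prod using insert.prems by (intro prod_mono) auto
  have "x i * (\<Prod>j\<in>I. x j) - y i * (\<Prod>j\<in>I. y j) = x i * ((\<Prod>j\<in>I. x j) - (\<Prod>j\<in>I. y j)) + (x i - y i) * (\<Prod>j\<in>I. y j)"
    by (simp add: algebra_simps)
  also have "\<bar>\<dots>\<bar> \<le> \<bar>x i\<bar> * \<bar>(\<Prod>j\<in>I. x j) - (\<Prod>j\<in>I. y j)\<bar> + \<bar>x i - y i\<bar> * \<bar>\<Prod>j\<in>I. y j\<bar>"
    unfolding abs_mult[symmetric] by (rule abs_triangle_ineq)
  also have "\<dots> \<le> b i * ((\<Prod>j\<in>I. b j) * (\<Sum>j\<in>I. e j)) + (b i * e i) * (\<Prod>j\<in>I. b j)"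
  proof (rule add_mono)
    show "\<bar>x i\<bar> * \<bar>(\<Prod>j\<in>I. x j) - (\<Prod>j\<in>I. y j)\<bar> \<le> b i * ((\<Prod>j\<in>I. b j) * (\<Sum>j\<in>I. e j))"
      using insert.prems b by (intro mult_mono insert.IH) auto
    have "0 \<le> b i * e i" using insert.prems(3)[of i] by (meson abs_ge_zero insertI1 order.trans)
    then show "\<bar>x i - y i\<bar> * \<bar>\<Prod>j\<in>I. y j\<bar> \<le> (b i * e i) * (\<Prod>j\<in>I. b j)"
      using insert.prems px by (intro mult_mono) auto
  qed
  finally show ?case using insert.hyps by (simp add: algebra_simps)
qed simp

text \<open>The one-variable formula is applied to one variable after another. The induction needs
  the variables outside I to keep their values, hence the case distinction in the argument of
  P.\<close>

lemma tensor_kernel_formula: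
  fixes cf :: "nat \<Rightarrow> real \<Rightarrow> real"
  assumes "finite I"
    and cf: "\<And>q h. degree q \<le> N \<Longrightarrow> \<bar>h\<bar> \<le> \<rho> \<Longrightarrow> poly q h = (\<Sum>k<m. cf k h * poly q (\<tau> k))"
    and "slice_poly N I P" and "\<And>i. i \<in> I \<Longrightarrow> \<bar>c i\<bar> \<le> \<rho>"
  shows "P c = (\<Sum>k\<in>PiE I (\<lambda>_. {..<m}). (\<Prod>i\<in>I. cf (k i) (c i)) * P (\<lambda>i. if i \<in> I then \<tau> (k i) else c i))"
  using assms(1,3,4)
proof (induction I arbitrary: P c rule: finite_induct)
  case (insert i I)
  from insert.prems(1) obtain q where q: "degree q \<le> N" "\<And>t. P (c(i := t)) = poly q t"
    unfolding slice_poly_def by (metis insertI1)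
  have "P c = poly q (c i)" using q(2)[of "c i"] by simp
  also have "\<dots> = (\<Sum>j<m. cf j (c i) * P (c(i := \<tau> j)))"
    using insert.prems(2) by (simp add: cf[OF q(1)] q(2))
  also have "\<dots> = (\<Sum>j<m. \<Sum>k\<in>PiE I (\<lambda>_. {..<m}).
      (\<Prod>l\<in>insert i I. cf ((k(i := j)) l) (c l)) * P (\<lambda>l. if l \<in> insert i I then \<tau> ((k(i := j)) l) else c l))"
  proof (rule sum.cong[OF refl])
    fix j
    define c' where "c' = c(i := \<tau> j)"
    have sl: "slice_poly N I P" using insert.prems(1) by (simp add: slice_poly_def)
    have ci: "c' l = c l" if "l \<in> I" for l using that insert.hyps by (auto simp: c'_def)
    have "P c' = (\<Sum>k\<in>PiE I (\<lambda>_. {..<m}). (\<Prod>l\<in>I. cf (k l) (c' l)) * P (\<lambda>l. if l \<in> I then \<tau> (k l) else c' l))"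
      using insert.prems(2) ci by (intro insert.IH sl) auto
    also have "\<dots> = (\<Sum>k\<in>PiE I (\<lambda>_. {..<m}). (\<Prod>l\<in>I. cf ((k(i := j)) l) (c l)) * P (\<lambda>l. if l \<in> insert i I then \<tau> ((k(i := j)) l) else c l))"
    proof (rule sum.cong[OF refl])
      fix k
      have "(\<Prod>l\<in>I. cf (k l) (c' l)) = (\<Prod>l\<in>I. cf ((k(i := j)) l) (c l))"
        using ci insert.hyps by (intro prod.cong) auto
      moreover have "(\<lambda>l. if l \<in> I then \<tau> (k l) else c' l) = (\<lambda>l. if l \<in> insert i I then \<tau> ((k(i := j)) l) else c l)"
        using insert.hyps by (auto simp: c'_def)
      ultimately show "(\<Prod>l\<in>I. cf (k l) (c' l)) * P (\<lambda>l. if l \<in> I then \<tau> (k l) else c' l)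
        = (\<Prod>l\<in>I. cf ((k(i := j)) l) (c l)) * P (\<lambda>l. if l \<in> insert i I then \<tau> ((k(i := j)) l) else c l)" by simp
    qed
    finally show "cf j (c i) * P (c(i := \<tau> j)) = (\<Sum>k\<in>PiE I (\<lambda>_. {..<m}).
      (\<Prod>l\<in>insert i I. cf ((k(i := j)) l) (c l)) * P (\<lambda>l. if l \<in> insert i I then \<tau> ((k(i := j)) l) else c l))"
      unfolding c'_def[symmetric] by (simp only: sum_distrib_left prod.insert[OF insert.hyps] fun_upd_same mult.assoc)
  qed
  also have "\<dots> = (\<Sum>k\<in>PiE (insert i I) (\<lambda>_. {..<m}).
      (\<Prod>l\<in>insert i I. cf (k l) (c l)) * P (\<lambda>l. if l \<in> insert i I then \<tau> (k l) else c l))"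
    by (rule sum_PiE_insert[OF insert.hyps, symmetric])
  finally show ?case .
qed simp

text \<open>P c and P c' are expanded in the same nodes, so their difference comes from the
  coefficients alone; the sum of the increments, in units of r/m, is what the telescoped product
  leaves. The weights are products of one-variable weights, so their sum is a power of 1.\<close>

lemma tensor_kernel:
  fixes r :: real and I :: "'i set"
  assumes r: "r > 0" and m: "m = 4 * N + 2" and N: "N \<ge> 1" and I: "finite I"
  obtains K :: "('i \<Rightarrow> nat) set" and \<alpha> :: "('i \<Rightarrow> nat) \<Rightarrow> real" and \<nu> :: "('i \<Rightarrow> nat) \<Rightarrow> 'i \<Rightarrow> real"
  where "finite K" and "\<And>k. k \<in> K \<Longrightarrow> 0 \<le> \<alpha> k" and "(\<Sum>k\<in>K. \<alpha> k) = 1"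
    and "\<And>k i. k \<in> K \<Longrightarrow> i \<in> I \<Longrightarrow> r / real m \<le> \<bar>\<nu> k i\<bar> \<and> \<bar>\<nu> k i\<bar> \<le> r"
    and "\<And>P c c'. slice_poly N I P \<Longrightarrow> (\<And>i. i \<in> I \<Longrightarrow> \<bar>c i\<bar> \<le> r / (2 * real m)) \<Longrightarrow> (\<And>i. i \<in> I \<Longrightarrow> \<bar>c' i\<bar> \<le> r / (2 * real m))
       \<Longrightarrow> (\<And>i. i \<notin> I \<Longrightarrow> c i = 0) \<Longrightarrow> (\<And>i. i \<notin> I \<Longrightarrow> c' i = 0)
       \<Longrightarrow> \<bar>P c - P c'\<bar> \<le> 600 ^ card I * (real m / r) * (\<Sum>i\<in>I. \<bar>c i - c' i\<bar>) * (\<Sum>k\<in>K. \<alpha> k * \<bar>P (\<nu> k)\<bar>)"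
proof -
  obtain \<tau> a :: "nat \<Rightarrow> real" and cf :: "nat \<Rightarrow> real \<Rightarrow> real" where
    \<tau>: "\<And>k. k < m \<Longrightarrow> r / real m \<le> \<bar>\<tau> k\<bar> \<and> \<bar>\<tau> k\<bar> \<le> r"
    and a: "\<And>k. k < m \<Longrightarrow> 0 \<le> a k" "(\<Sum>k<m. a k) = 1"
    and cf: "\<And>q h. degree q \<le> N \<Longrightarrow> \<bar>h\<bar> \<le> r / (2 * real m) \<Longrightarrow> poly q h = (\<Sum>k<m. cf k h * poly q (\<tau> k))"
    and cf1: "\<And>k h. k < m \<Longrightarrow> \<bar>h\<bar> \<le> r / (2 * real m) \<Longrightarrow> \<bar>cf k h\<bar> \<le> 600 * a k"
    and cf2: "\<And>k h h'. k < m \<Longrightarrow> \<bar>h\<bar> \<le> r / (2 * real m) \<Longrightarrow> \<bar>h'\<bar> \<le> r / (2 * real m) \<Longrightarrow>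
           \<bar>cf k h - cf k h'\<bar> \<le> 600 * a k * (real m / r * \<bar>h - h'\<bar>)"
    by (rule poly_kernel_1d[OF r m N]) (rule that, assumption+)
  define K where "K = PiE I (\<lambda>_. {..<m})"
  define \<alpha> where "\<alpha> k = (\<Prod>i\<in>I. a (k i))" for k
  define \<nu> where "\<nu> k i = (if i \<in> I then \<tau> (k i) else 0)" for k i
  have K: "k i < m" if "k \<in> K" "i \<in> I" for k i using that by (auto simp: K_def PiE_def)
  show thesis
  proof (rule that[of K \<alpha> \<nu>])
    show "finite K" unfolding K_def using I by (intro finite_PiE) auto
    show "0 \<le> \<alpha> k" if "k \<in> K" for k unfolding \<alpha>_def using K[OF that] a by (intro prod_nonneg) auto
    show "(\<Sum>k\<in>K. \<alpha> k) = 1"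
      using prod_sum_PiE[of I "\<lambda>_. {..<m}" "\<lambda>_. a"] I a(2) unfolding \<alpha>_def K_def by simp
    show "r / real m \<le> \<bar>\<nu> k i\<bar> \<and> \<bar>\<nu> k i\<bar> \<le> r" if "k \<in> K" "i \<in> I" for k i
      using \<tau>[OF K[OF that]] that by (simp add: \<nu>_def)
  next
    fix P :: "('i \<Rightarrow> real) \<Rightarrow> real" and c c'
    assume P: "slice_poly N I P" and c: "\<And>i. i \<in> I \<Longrightarrow> \<bar>c i\<bar> \<le> r / (2 * real m)" and c': "\<And>i. i \<in> I \<Longrightarrow> \<bar>c' i\<bar> \<le> r / (2 * real m)"
      and z: "\<And>i. i \<notin> I \<Longrightarrow> c i = 0" and z': "\<And>i. i \<notin> I \<Longrightarrow> c' i = 0"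
    have e: "P c = (\<Sum>k\<in>K. (\<Prod>i\<in>I. cf (k i) (c i)) * P (\<nu> k))"
    proof -
      have "(\<lambda>i. if i \<in> I then \<tau> (k i) else c i) = \<nu> k" for k by (auto simp: \<nu>_def z)
      then show ?thesis using tensor_kernel_formula[OF I cf P c] unfolding K_def by simp
    qed
    have e': "P c' = (\<Sum>k\<in>K. (\<Prod>i\<in>I. cf (k i) (c' i)) * P (\<nu> k))"
    proof -
      have "(\<lambda>i. if i \<in> I then \<tau> (k i) else c' i) = \<nu> k" for k by (auto simp: \<nu>_def z')
      then show ?thesis using tensor_kernel_formula[OF I cf P c'] unfolding K_def by simp
    qed
    define E where "E = real m / r * (\<Sum>i\<in>I. \<bar>c i - c' i\<bar>)"
    have "\<bar>P c - P c'\<bar> = \<bar>\<Sum>k\<in>K. ((\<Prod>i\<in>I. cf (k i) (c i)) - (\<Prod>i\<in>I. cf (k i) (c' i))) * P (\<nu> k)\<bar>"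
      unfolding e e' by (simp add: sum_subtractf left_diff_distrib)
    also have "\<dots> \<le> (\<Sum>k\<in>K. \<bar>(\<Prod>i\<in>I. cf (k i) (c i)) - (\<Prod>i\<in>I. cf (k i) (c' i))\<bar> * \<bar>P (\<nu> k)\<bar>)"
      unfolding abs_mult[symmetric] by (rule sum_abs)
    also have "\<dots> \<le> (\<Sum>k\<in>K. (600 ^ card I * \<alpha> k * E) * \<bar>P (\<nu> k)\<bar>)"
    proof (intro sum_mono mult_right_mono)
      fix k assume k: "k \<in> K"
      have "\<bar>(\<Prod>i\<in>I. cf (k i) (c i)) - (\<Prod>i\<in>I. cf (k i) (c' i))\<bar> \<le> (\<Prod>i\<in>I. 600 * a (k i)) * (\<Sum>i\<in>I. real m / r * \<bar>c i - c' i\<bar>)"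
        using K[OF k] by (intro abs_prod_diff_le I cf1 cf2 c c') auto
      then show "\<bar>(\<Prod>i\<in>I. cf (k i) (c i)) - (\<Prod>i\<in>I. cf (k i) (c' i))\<bar> \<le> 600 ^ card I * \<alpha> k * E"
        by (simp add: prod.distrib \<alpha>_def E_def sum_distrib_left)
    qed simp
    also have "\<dots> = 600 ^ card I * (real m / r) * (\<Sum>i\<in>I. \<bar>c i - c' i\<bar>) * (\<Sum>k\<in>K. \<alpha> k * \<bar>P (\<nu> k)\<bar>)"
      unfolding E_def sum_distrib_left[where A=K] by (intro sum.cong) simp_all
    finally show "\<bar>P c - P c'\<bar> \<le> 600 ^ card I * (real m / r) * (\<Sum>i\<in>I. \<bar>c i - c' i\<bar>) * (\<Sum>k\<in>K. \<alpha> k * \<bar>P (\<nu> k)\<bar>)" .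
  qed
qed

text \<open>The only property of polynomials, besides measurability, on which the oscillation
  estimates rest. In contrast to a representation by multi-indices it is plainly preserved by affine
  changes of coordinates.\<close>

definition quad_slice_poly :: "nat \<Rightarrow> ('a::real_vector \<Rightarrow> real) \<Rightarrow> bool" where
  "quad_slice_poly n f \<longleftrightarrow> (\<forall>x y z. \<exists>q. degree q \<le> 2 * n \<and> (\<forall>t. f (x + t *\<^sub>R y + t\<^sup>2 *\<^sub>R z) = poly q t))"

text \<open>Along a parabola each coordinate is a polynomial \<open>g b\<close> of degree at most 2
  in t, so a monomial of total degree j becomes a polynomial of degree at most 2j.\<close>

lemma poly_degree_le_quad_slice:
  fixes f :: "'a::euclidean_space \<Rightarrow> real"
  assumes "poly_degree_le n f" shows "quad_slice_poly n f"
  unfolding quad_slice_poly_def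
proof (intro allI)
  fix x y z :: 'a
  let ?S = "{\<alpha>. \<alpha> \<in> Basis \<rightarrow>\<^sub>E UNIV \<and> (\<Sum>b\<in>Basis. \<alpha> b) \<le> n} :: ('a \<Rightarrow> nat) set"
  from assms obtain c where c: "\<And>x. f x = (\<Sum>\<alpha>\<in>?S. c \<alpha> * (\<Prod>b\<in>Basis. (x \<bullet> b) ^ \<alpha> b))"
    unfolding poly_degree_le_def by blast
  define g where "g b = [:x \<bullet> b, y \<bullet> b, z \<bullet> b:]" for b
  define q where "q = (\<Sum>\<alpha>\<in>?S. smult (c \<alpha>) (\<Prod>b\<in>Basis. g b ^ \<alpha> b))"
  have "degree q \<le> 2 * n" unfolding q_def
  proof (rule degree_sum_le)
    have "?S \<subseteq> Basis \<rightarrow>\<^sub>E {..n}"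
    proof
      fix \<alpha> assume "\<alpha> \<in> ?S"
      then have a: "\<alpha> \<in> Basis \<rightarrow>\<^sub>E UNIV" "(\<Sum>b\<in>Basis. \<alpha> b) \<le> n" by auto
      have "\<alpha> b \<le> n" if "b \<in> Basis" for b
        using member_le_sum[OF that, of \<alpha>] a(2) by (meson finite_Basis le0 order.trans)
      with a(1) show "\<alpha> \<in> Basis \<rightarrow>\<^sub>E {..n}" by (auto simp: PiE_iff)
    qed
    then show "finite ?S" by (rule finite_subset) (auto intro: finite_PiE)
    fix \<alpha> assume "\<alpha> \<in> ?S"
    then have s: "(\<Sum>b\<in>Basis. \<alpha> b) \<le> n" by simp
    have "degree (\<Prod>b\<in>Basis. g b ^ \<alpha> b) \<le> (\<Sum>b\<in>Basis. degree (g b ^ \<alpha> b))"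
      by (rule order.trans[OF degree_prod_sum_le]) auto
    also have "\<dots> \<le> (\<Sum>b\<in>Basis. 2 * \<alpha> b)"
    proof (rule sum_mono)
      fix b :: 'a
      have "degree (g b) \<le> 2" by (simp add: g_def)
      then have "degree (g b) * \<alpha> b \<le> 2 * \<alpha> b" by (rule mult_right_mono) simp
      then show "degree (g b ^ \<alpha> b) \<le> 2 * \<alpha> b" using degree_power_le[of "g b" "\<alpha> b"] by linarith
    qed
    also have "\<dots> \<le> 2 * n" using s by (simp add: sum_distrib_left[symmetric])
    finally show "degree (smult (c \<alpha>) (\<Prod>b\<in>Basis. g b ^ \<alpha> b)) \<le> 2 * n"
      by (meson degree_smult_le order.trans)
  qed
  moreover have "f (x + t *\<^sub>R y + t\<^sup>2 *\<^sub>R z) = poly q t" for t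
  proof -
    have "(x + t *\<^sub>R y + t\<^sup>2 *\<^sub>R z) \<bullet> b = poly (g b) t" for b
      by (simp add: g_def inner_add_left algebra_simps power2_eq_square)
    then show ?thesis by (simp add: c q_def poly_sum poly_prod)
  qed
  ultimately show "\<exists>q. degree q \<le> 2 * n \<and> (\<forall>t. f (x + t *\<^sub>R y + t\<^sup>2 *\<^sub>R z) = poly q t)" by blast
qed

section \<open>Lebesgue measure under isometries and under the lift\<close>

lemma nn_integral_lborel_translate:
  fixes c :: "'a::euclidean_space"
  assumes [measurable]: "f \<in> borel_measurable borel"
  shows "(\<integral>\<^sup>+x. f (x + c) \<partial>lborel) = (\<integral>\<^sup>+x. f x \<partial>lborel)"
proof -
  have "(\<integral>\<^sup>+x. f x \<partial>lborel) = (\<integral>\<^sup>+x. f x \<partial>distr lborel borel ((+) c))"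
    by (simp add: lborel_distr_plus)
  also have "\<dots> = (\<integral>\<^sup>+x. f (x + c) \<partial>lborel)"
    by (subst nn_integral_distr) (auto simp: add.commute)
  finally show ?thesis by simp
qed

text \<open>The argument that shows uniqueness of invariant measures: the integral is multiplied by
  the volume of the unit ball, written as an integral of its indicator, and Fubini moves the
  dependence on A into a translation. It works because A preserves the unit ball; no determinant is
  computed.\<close>

lemma nn_integral_lborel_orthogonal:
  fixes A :: "'a::euclidean_space \<Rightarrow> 'a"
  assumes A: "orthogonal_transformation A" and [measurable]: "g \<in> borel_measurable borel"
  shows "(\<integral>\<^sup>+x. g (A x) \<partial>lborel) = (\<integral>\<^sup>+x. g x \<partial>lborel)"
proof -
  have lin: "linear A" using A by (rule orthogonal_transformation_linear)
  have [measurable]: "A \<in> borel_measurable borel"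
    using lin by (intro borel_measurable_continuous_onI linear_continuous_on) (simp add: linear_linear)
  define f :: "'a \<Rightarrow> ennreal" where "f = indicator (ball 0 1)"
  have [measurable]: "f \<in> borel_measurable borel" unfolding f_def by (intro borel_measurable_indicator) auto
  define V where "V = emeasure lborel (ball (0::'a) 1)"
  have V: "V \<noteq> 0" "V \<noteq> top"
    using emeasure_lborel_ball_finite[of "0::'a" 1] emeasure_ball[of 1 "0::'a"]
    by (auto simp: V_def unit_ball_vol_pos ennreal_eq_0_iff not_le)
  have fV: "(\<integral>\<^sup>+y. f (z - y) \<partial>lborel) = V" for z :: 'a
  proof -
    have "(\<integral>\<^sup>+y. f (z - y) \<partial>lborel) = (\<integral>\<^sup>+y. indicator (ball z 1) y \<partial>lborel)"
      unfolding f_def by (intro nn_integral_cong) (auto simp: indicator_def dist_norm norm_minus_commute)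
    also have "\<dots> = emeasure lborel (ball z 1)" by simp
    also have "\<dots> = V" unfolding V_def by (simp add: emeasure_ball)
    finally show ?thesis .
  qed
  have "V * (\<integral>\<^sup>+x. g (A x) \<partial>lborel) = (\<integral>\<^sup>+x. \<integral>\<^sup>+y. g (A x) * f (A x - y) \<partial>lborel \<partial>lborel)"
    by (simp add: nn_integral_cmult fV mult.commute[of V] nn_integral_multc)
  also have "\<dots> = (\<integral>\<^sup>+y. \<integral>\<^sup>+x. g (A x) * f (A x - y) \<partial>lborel \<partial>lborel)"
    by (rule lborel_pair.Fubini') measurable
  also have "\<dots> = (\<integral>\<^sup>+y. \<integral>\<^sup>+x. g (A x + y) * f x \<partial>lborel \<partial>lborel)"
  proof (rule nn_integral_cong)
    fix y :: 'a
    \<comment> \<open>Translating x by z removes y from the argument of f and adds it to that of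
      g.\<close>
    obtain z where z: "A z = y" using orthogonal_transformation_surj[OF A] by (metis surjD)
    have "(\<integral>\<^sup>+x. g (A x) * f (A x - y) \<partial>lborel) = (\<integral>\<^sup>+x. g (A (x + z)) * f (A (x + z) - y) \<partial>lborel)"
      by (rule nn_integral_lborel_translate[symmetric]) measurable
    also have "\<dots> = (\<integral>\<^sup>+x. g (A x + y) * f x \<partial>lborel)"
      using lin A by (intro nn_integral_cong) (auto simp: z linear_add f_def indicator_def dist_norm orthogonal_transformation_norm)
    finally show "(\<integral>\<^sup>+x. g (A x) * f (A x - y) \<partial>lborel) = (\<integral>\<^sup>+x. g (A x + y) * f x \<partial>lborel)" .
  qed
  also have "\<dots> = (\<integral>\<^sup>+x. \<integral>\<^sup>+y. g (A x + y) * f x \<partial>lborel \<partial>lborel)"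
    by (rule lborel_pair.Fubini'[symmetric]) measurable
  also have "\<dots> = (\<integral>\<^sup>+x. (\<integral>\<^sup>+y. g y \<partial>lborel) * f x \<partial>lborel)"
  proof (rule nn_integral_cong)
    fix x :: 'a
    have "(\<integral>\<^sup>+y. g (A x + y) * f x \<partial>lborel) = (\<integral>\<^sup>+y. g (y + A x) \<partial>lborel) * f x"
      by (subst nn_integral_multc[symmetric]) (auto simp: add.commute)
    then show "(\<integral>\<^sup>+y. g (A x + y) * f x \<partial>lborel) = (\<integral>\<^sup>+y. g y \<partial>lborel) * f x"
      by (simp add: nn_integral_lborel_translate)
  qed
  also have "\<dots> = V * (\<integral>\<^sup>+y. g y \<partial>lborel)"
    unfolding f_def V_def by (subst nn_integral_cmult_indicator) (auto simp: mult.commute)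
  finally show ?thesis using V by (simp add: ennreal_mult_cancel_left)
qed

text \<open>The disc of radius r has area \<pi> r^2, which is linear in r^2. With the minus sign the
  rays \<open>{x<..}\<close> have finite mass, as required for the comparison of two measures on
  such rays.\<close>

lemma distr_minus_norm_sq:
  "distr (lborel :: (real \<times> real) measure) borel (\<lambda>v. - (norm v)\<^sup>2) = density lborel (\<lambda>s. ennreal pi * indicator {..0} s)"
proof (rule measure_eqI_lessThan)
  fix x :: real
  have *: "(\<lambda>v::real \<times> real. - (norm v)\<^sup>2) -` {x<..} = (if x < 0 then ball 0 (sqrt (- x)) else {})"
  proof -
    have "x < - (norm v)\<^sup>2 \<longleftrightarrow> x < 0 \<and> norm v < sqrt (- x)" for v :: "real \<times> real"
    proof (cases "x < 0")
      case True
      then have "norm v < sqrt (- x) \<longleftrightarrow> sqrt ((norm v)\<^sup>2) < sqrt (- x)" by simp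
      also have "\<dots> \<longleftrightarrow> (norm v)\<^sup>2 < - x" by (rule real_sqrt_less_iff)
      finally show ?thesis using True by auto
    next
      case False
      then show ?thesis by (smt (verit) zero_le_power2)
    qed
    then show ?thesis by (auto simp only: mem_ball_0 vimage_eq greaterThan_iff split: if_splits)
  qed
  have 1: "emeasure (distr (lborel :: (real \<times> real) measure) borel (\<lambda>v. - (norm v)\<^sup>2)) {x<..} = (if x < 0 then ennreal (pi * (- x)) else 0)"
    by (subst emeasure_distr) (auto simp: * emeasure_ball unit_ball_vol_2)
  have "{..0} \<inter> {x<..} = (if x < 0 then {x<..0} else {})" by auto
  then have 3: "emeasure lborel ({..0} \<inter> {x<..}) = ennreal (- min x 0)" by (auto simp: min_def)
  have "emeasure (density lborel (\<lambda>s. ennreal pi * indicator {..0} s)) {x<..}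
     = (\<integral>\<^sup>+s. ennreal pi * indicator ({..0} \<inter> {x<..}) s \<partial>lborel)"
    by (subst emeasure_density) (auto intro!: nn_integral_cong simp: indicator_def)
  also have "\<dots> = ennreal pi * emeasure lborel ({..0} \<inter> {x<..})"
    by (rule nn_integral_cmult_indicator) simp
  also have "\<dots> = (if x < 0 then ennreal (pi * (- x)) else 0)"
    unfolding 3 by (auto simp: min_def ennreal_mult[symmetric] simp del: mult_minus_right)
  finally have 2: "emeasure (density lborel (\<lambda>s. ennreal pi * indicator {..0} s)) {x<..} = (if x < 0 then ennreal (pi * (- x)) else 0)" .
  show "emeasure (distr (lborel :: (real \<times> real) measure) borel (\<lambda>v. - (norm v)\<^sup>2)) {x<..} = emeasure (density lborel (\<lambda>s. ennreal pi * indicator {..0} s)) {x<..}"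
    unfolding 1 2 ..
  show "emeasure (distr (lborel :: (real \<times> real) measure) borel (\<lambda>v. - (norm v)\<^sup>2)) {x<..} < \<infinity>"
    unfolding 1 by simp
qed simp_all

lemma nn_integral_minus_norm_sq:
  fixes F :: "real \<Rightarrow> ennreal" and w :: "real \<times> real"
  assumes [measurable]: "F \<in> borel_measurable borel"
  shows "(\<integral>\<^sup>+v. F (c - (norm (v + w))\<^sup>2) \<partial>lborel) = pi * (\<integral>\<^sup>+y. F y * indicator {..c} y \<partial>lborel)"
proof -
  have "(\<integral>\<^sup>+v. F (c - (norm (v + w))\<^sup>2) \<partial>lborel) = (\<integral>\<^sup>+v. F (- (norm v)\<^sup>2 + c) \<partial>(lborel :: (real \<times> real) measure))"
    by (subst nn_integral_lborel_translate) auto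
  also have "\<dots> = (\<integral>\<^sup>+s. F (s + c) \<partial>distr (lborel :: (real \<times> real) measure) borel (\<lambda>v. - (norm v)\<^sup>2))"
    by (subst nn_integral_distr) auto
  also have "\<dots> = (\<integral>\<^sup>+s. ennreal pi * indicator {..0} s * F (s + c) \<partial>lborel)"
    unfolding distr_minus_norm_sq by (subst nn_integral_density) auto
  also have "\<dots> = (\<integral>\<^sup>+s. pi * (F (s + c) * indicator {..c} (s + c)) \<partial>lborel)"
    by (intro nn_integral_cong) (auto simp: indicator_def)
  also have "\<dots> = pi * (\<integral>\<^sup>+s. F (s + c) * indicator {..c} (s + c) \<partial>lborel)"
    by (rule nn_integral_cmult) measurable
  also have "(\<integral>\<^sup>+s. F (s + c) * indicator {..c} (s + c) \<partial>lborel) = (\<integral>\<^sup>+s. F s * indicator {..c} s \<partial>lborel)"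
    by (rule nn_integral_lborel_translate) measurable
  finally show ?thesis .
qed

text \<open>Fubini over u: for fixed u the translation by w is invisible, and the plane is mapped
  onto the half-line below b u with density \<pi>.\<close>

lemma nn_integral_subgraph_lift:
  fixes F :: "('a::euclidean_space \<times> real) \<Rightarrow> ennreal" and b :: "'a \<Rightarrow> real" and w :: "real \<times> real"
  assumes [measurable]: "F \<in> borel_measurable borel" "b \<in> borel_measurable borel"
  shows "(\<integral>\<^sup>+z. F (fst z + h, b (fst z) - (norm (snd z + w))\<^sup>2) \<partial>lborel)
    = pi * (\<integral>\<^sup>+z. F (fst z + h, snd z) * indicator {z. snd z \<le> b (fst z)} z \<partial>lborel)"
proof -
  have [measurable]: "F \<in> borel_measurable (borel \<Otimes>\<^sub>M borel)" by (simp add: borel_prod)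
  have "(\<integral>\<^sup>+z. F (fst z + h, b (fst z) - (norm (snd z + w))\<^sup>2) \<partial>lborel)
    = (\<integral>\<^sup>+z. F (fst z + h, b (fst z) - (norm (snd z + w))\<^sup>2) \<partial>((lborel :: 'a measure) \<Otimes>\<^sub>M (lborel :: (real \<times> real) measure)))"
    by (simp only: lborel_prod)
  also have "\<dots> = (\<integral>\<^sup>+u. \<integral>\<^sup>+v. F (u + h, b u - (norm (v + w))\<^sup>2) \<partial>lborel \<partial>lborel)"
    by (subst lborel.nn_integral_fst[symmetric]) auto
  also have "\<dots> = (\<integral>\<^sup>+u. pi * (\<integral>\<^sup>+y. F (u + h, y) * indicator {..b u} y \<partial>lborel) \<partial>lborel)"
    by (intro nn_integral_cong nn_integral_minus_norm_sq) measurable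
  also have "\<dots> = pi * (\<integral>\<^sup>+u. (\<integral>\<^sup>+y. F (u + h, y) * indicator {z. snd z \<le> b (fst z)} (u, y) \<partial>lborel) \<partial>lborel)"
    by (subst nn_integral_cmult) (auto simp: indicator_def)
  also have "(\<integral>\<^sup>+u. (\<integral>\<^sup>+y. F (u + h, y) * indicator {z. snd z \<le> b (fst z)} (u, y) \<partial>lborel) \<partial>lborel)
    = (\<integral>\<^sup>+z. F (fst z + h, snd z) * indicator {z. snd z \<le> b (fst z)} z \<partial>lborel)"
    unfolding lborel_prod[symmetric] by (subst lborel.nn_integral_fst[symmetric]) auto
  finally show ?thesis .
qed

text \<open>The form in which node maps are used: once the restriction to the subgraph is dropped, a
  translation by (h, 0) removes h, and neither b nor w is left in the bound.\<close>

lemma nn_integral_subgraph_lift_le: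
  fixes F :: "('a::euclidean_space \<times> real) \<Rightarrow> ennreal" and b :: "'a \<Rightarrow> real" and w :: "real \<times> real"
  assumes [measurable]: "F \<in> borel_measurable borel" "b \<in> borel_measurable borel"
  shows "(\<integral>\<^sup>+z. F (fst z + h, b (fst z) - (norm (snd z + w))\<^sup>2) \<partial>lborel) \<le> pi * (\<integral>\<^sup>+z. F z \<partial>lborel)"
proof -
  have "(\<integral>\<^sup>+z. F (fst z + h, snd z) * indicator {z. snd z \<le> b (fst z)} z \<partial>lborel) \<le> (\<integral>\<^sup>+z. F (z + (h, 0)) \<partial>lborel)"
    by (intro nn_integral_mono) (auto simp: indicator_def plus_prod_def)
  also have "\<dots> = (\<integral>\<^sup>+z. F z \<partial>lborel)" by (rule nn_integral_lborel_translate) measurable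
  finally show ?thesis by (subst nn_integral_subgraph_lift) (auto intro: mult_left_mono)
qed

section \<open>Functions with bounded second derivatives\<close>

text \<open>One coordinate is changed at a time, along a path that stays in the product of the sets
  \<open>T k\<close>. Thus derivatives along the axes are enough and no total derivative of F
  enters; S holds the coordinates that may still differ.\<close>

lemma partial_mean_value:
  fixes F :: "real ^ 'd \<Rightarrow> real" and F' :: "'d \<Rightarrow> real ^ 'd \<Rightarrow> real" and T :: "'d \<Rightarrow> real set"
  assumes "finite S" and T: "\<And>k. convex (T k)"
    and der: "\<And>i z. (\<And>k. z $ k \<in> T k) \<Longrightarrow> ((\<lambda>t. F (z + t *\<^sub>R axis i 1)) has_real_derivative F' i z) (at 0)"
    and bnd: "\<And>i z. (\<And>k. z $ k \<in> T k) \<Longrightarrow> \<bar>F' i z\<bar> \<le> K i"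
    and "\<And>k. x $ k \<in> T k" "\<And>k. y $ k \<in> T k" "\<And>k. k \<notin> S \<Longrightarrow> x $ k = y $ k"
  shows "\<bar>F x - F y\<bar> \<le> (\<Sum>i\<in>S. K i * \<bar>x $ i - y $ i\<bar>)"
  using assms(1) assms(5-)
proof (induction S arbitrary: x rule: finite_induct)
  case empty
  then have "x = y" by (simp add: vec_eq_iff)
  then show ?case by simp
next
  case (insert i S)
  define w where "w = (\<chi> k. if k = i then y $ i else x $ k)"
  define \<tau> where "\<tau> = y $ i - x $ i"
  have w: "w = x + \<tau> *\<^sub>R axis i 1" by (simp add: w_def vec_eq_iff \<tau>_def axis_def)
  have "norm (F (x + \<tau> *\<^sub>R axis i 1) - F (x + 0 *\<^sub>R axis i 1)) \<le> K i * norm (\<tau> - 0)"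
  proof (rule field_differentiable_bound[where S = "closed_segment 0 \<tau>" and f = "\<lambda>t. F (x + t *\<^sub>R axis i 1)" and f' = "\<lambda>t. F' i (x + t *\<^sub>R axis i 1)"])
    fix t assume "t \<in> closed_segment 0 \<tau>"
    then obtain u where u: "0 \<le> u" "u \<le> 1" "t = u * \<tau>" by (auto simp: closed_segment_def)
    have in_T: "(x + t *\<^sub>R axis i 1) $ k \<in> T k" for k
    proof (cases "k = i")
      case True
      have "(1 - u) *\<^sub>R (x $ i) + u *\<^sub>R (y $ i) \<in> T i"
        using T insert.prems u unfolding convex_alt by blast
      moreover have "(1 - u) *\<^sub>R (x $ i) + u *\<^sub>R (y $ i) = (x + t *\<^sub>R axis i 1) $ i"
        by (simp add: u \<tau>_def axis_def algebra_simps)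
      ultimately show ?thesis using True by simp
    qed (use insert.prems in \<open>auto simp: axis_def\<close>)
    have "((\<lambda>s. F ((x + t *\<^sub>R axis i 1) + s *\<^sub>R axis i 1)) has_real_derivative F' i (x + t *\<^sub>R axis i 1)) (at 0)"
      by (rule der[OF in_T])
    then have "((\<lambda>s. F (x + (s + t) *\<^sub>R axis i 1)) has_real_derivative F' i (x + t *\<^sub>R axis i 1)) (at 0)"
      by (simp add: scaleR_left_distrib ac_simps)
    then have "((\<lambda>s. F (x + s *\<^sub>R axis i 1)) has_real_derivative F' i (x + t *\<^sub>R axis i 1)) (at t)"
      using DERIV_shift[of "\<lambda>s. F (x + s *\<^sub>R axis i 1)" "F' i (x + t *\<^sub>R axis i 1)" 0 t] by simp
    then show "((\<lambda>t. F (x + t *\<^sub>R axis i 1)) has_field_derivative F' i (x + t *\<^sub>R axis i 1)) (at t within closed_segment 0 \<tau>)"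
      by (rule DERIV_subset) simp
    show "norm (F' i (x + t *\<^sub>R axis i 1)) \<le> K i" using bnd[OF in_T] by simp
  qed auto
  then have 1: "\<bar>F w - F x\<bar> \<le> K i * \<bar>x $ i - y $ i\<bar>" by (simp add: w \<tau>_def abs_minus_commute)
  have "\<bar>F w - F y\<bar> \<le> (\<Sum>j\<in>S. K j * \<bar>w $ j - y $ j\<bar>)"
    using insert.prems by (intro insert.IH) (auto simp: w_def)
  also have "\<dots> = (\<Sum>j\<in>S. K j * \<bar>x $ j - y $ j\<bar>)"
    using insert.hyps by (intro sum.cong) (auto simp: w_def)
  finally show ?case using 1 insert.hyps by simp
qed

lemma C1_fun_has_partial_deriv:
  "C1_fun f \<Longrightarrow> ((\<lambda>t. f (x + t *\<^sub>R axis i 1)) has_real_derivative partial_deriv i f x) (at 0)"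
  unfolding C1_fun_def partial_deriv_def by (simp add: DERIV_deriv_iff_real_differentiable)

text \<open>The norm in which the coordinatewise mean value estimate comes out directly.\<close>

definition l1norm :: "real ^ 'd \<Rightarrow> real" where
  "l1norm h = (\<Sum>i\<in>UNIV. \<bar>h $ i\<bar>)"

lemma l1norm_nonneg: "0 \<le> l1norm h"
  by (simp add: l1norm_def sum_nonneg)

lemma l1norm_le: "l1norm (h :: real ^ 'd) \<le> real CARD('d) * norm h"
  unfolding l1norm_def using sum_mono[of UNIV "\<lambda>i. \<bar>h $ i\<bar>" "\<lambda>_. norm h"] by (simp add: component_le_norm_cart)

lemma norm_le_l1norm: "norm h \<le> l1norm h"
  unfolding l1norm_def by (rule norm_le_l1_cart)

locale C2_bounded =
  fixes g :: "real ^ 'd \<Rightarrow> real" and M :: real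
  assumes C2: "C2_fun g" and M: "\<And>i k x. \<bar>partial_deriv i (partial_deriv k g) x\<bar> \<le> M"
begin

lemma M_nonneg: "0 \<le> M"
  using M[of undefined undefined 0] by linarith

abbreviation grad :: "real ^ 'd \<Rightarrow> real ^ 'd \<Rightarrow> real" where
  "grad u h \<equiv> (\<Sum>i\<in>UNIV. h $ i * partial_deriv i g u)"

lemma has_partial: "((\<lambda>t. g (x + t *\<^sub>R axis i 1)) has_real_derivative partial_deriv i g x) (at 0)"
  using C2 by (intro C1_fun_has_partial_deriv) (simp add: C2_fun_def)

lemma partial_lipschitz: "\<bar>partial_deriv k g x - partial_deriv k g y\<bar> \<le> M * l1norm (x - y)"
proof -
  have "\<bar>partial_deriv k g x - partial_deriv k g y\<bar> \<le> (\<Sum>i\<in>UNIV. M * \<bar>x $ i - y $ i\<bar>)"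
    using C2 M by (intro partial_mean_value[where T = "\<lambda>_. UNIV" and F' = "\<lambda>i. partial_deriv i (partial_deriv k g)"] C1_fun_has_partial_deriv)
      (auto simp: C2_fun_def)
  then show ?thesis by (simp add: l1norm_def sum_distrib_left)
qed

text \<open>The mean value estimate for g minus its linear part at u, on the box spanned by u and u
  + h; there each partial derivative deviates from its value at u by at most M times the l1-norm of
  h. The usual factor 1/2 is given up.\<close>

lemma taylor: "\<bar>g (u + h) - g u - grad u h\<bar> \<le> M * (l1norm h)\<^sup>2"
proof -
  define F where "F x = g x - grad u (x - u)" for x
  have "\<bar>F (u + h) - F u\<bar> \<le> (\<Sum>i\<in>UNIV. M * l1norm h * \<bar>(u + h) $ i - u $ i\<bar>)"
  proof (rule partial_mean_value[where T = "\<lambda>k. closed_segment (u $ k) ((u + h) $ k)" and F' = "\<lambda>i z. partial_deriv i g z - partial_deriv i g u"])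
    fix i and z :: "real ^ 'd"
    have "grad u (z + t *\<^sub>R axis i 1 - u) = grad u (z - u) + t * partial_deriv i g u" for t
    proof -
      have "grad u (z + t *\<^sub>R axis i 1 - u) = grad u (z - u) + (\<Sum>j\<in>UNIV. t * axis i 1 $ j * partial_deriv j g u)"
        by (simp add: sum.distrib[symmetric] algebra_simps)
      also have "(\<Sum>j\<in>UNIV. t * axis i 1 $ j * partial_deriv j g u) = (\<Sum>j\<in>UNIV. if j = i then t * partial_deriv i g u else 0)"
        by (intro sum.cong) (auto simp: axis_def)
      finally show ?thesis by simp
    qed
    then show "((\<lambda>t. F (z + t *\<^sub>R axis i 1)) has_real_derivative partial_deriv i g z - partial_deriv i g u) (at 0)"
      unfolding F_def by (auto intro!: derivative_eq_intros has_partial)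
    assume z: "\<And>k. z $ k \<in> closed_segment (u $ k) ((u + h) $ k)"
    have "l1norm (z - u) \<le> l1norm h"
      unfolding l1norm_def
    proof (rule sum_mono)
      fix k
      show "\<bar>(z - u) $ k\<bar> \<le> \<bar>h $ k\<bar>" using z[of k] by (auto simp: closed_segment_eq_real_ivl split: if_splits)
    qed
    then have "M * l1norm (z - u) \<le> M * l1norm h" by (intro mult_left_mono M_nonneg)
    then show "\<bar>partial_deriv i g z - partial_deriv i g u\<bar> \<le> M * l1norm h" using partial_lipschitz[of i z u] by linarith
  qed auto
  also have "\<dots> = M * l1norm h * (\<Sum>i\<in>UNIV. \<bar>h $ i\<bar>)" by (simp add: sum_distrib_left)
  also have "\<dots> = M * (l1norm h)\<^sup>2" by (simp add: l1norm_def[symmetric] power2_eq_square)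
  finally show ?thesis by (simp add: F_def algebra_simps)
qed

text \<open>A bound for second differences, small in both increments at once: it tells how much the
  shape of the graph changes when it is moved by h. It is the mean value estimate for z \<mapsto> g
  (z + h) - g z.\<close>

lemma increment_lipschitz: "\<bar>(g (p + h) - g p) - (g (q + h) - g q)\<bar> \<le> M * l1norm h * l1norm (p - q)"
proof -
  have "\<bar>(g (p + h) - g p) - (g (q + h) - g q)\<bar> \<le> (\<Sum>i\<in>UNIV. M * l1norm h * \<bar>p $ i - q $ i\<bar>)"
  proof (rule partial_mean_value[where T = "\<lambda>_. UNIV" and F' = "\<lambda>i z. partial_deriv i g (z + h) - partial_deriv i g z" and F = "\<lambda>z. g (z + h) - g z"])
    fix i and z :: "real ^ 'd"
    have "((\<lambda>t. g ((z + h) + t *\<^sub>R axis i 1)) has_real_derivative partial_deriv i g (z + h)) (at 0)" by (rule has_partial)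
    then have "((\<lambda>t. g (z + t *\<^sub>R axis i 1 + h)) has_real_derivative partial_deriv i g (z + h)) (at 0)" by (simp add: ac_simps)
    then show "((\<lambda>t. g (z + t *\<^sub>R axis i 1 + h) - g (z + t *\<^sub>R axis i 1)) has_real_derivative partial_deriv i g (z + h) - partial_deriv i g z) (at 0)"
      by (intro DERIV_diff has_partial)
    show "\<bar>partial_deriv i g (z + h) - partial_deriv i g z\<bar> \<le> M * l1norm h" using partial_lipschitz[of i "z + h" z] by simp
  qed auto
  then show ?thesis by (simp add: l1norm_def sum_distrib_left sum_distrib_right)
qed

text \<open>Only the second derivatives are bounded globally; on a ball the gradient is controlled
  through its value at 0.\<close>

definition lip_const :: "real \<Rightarrow> real" where
  "lip_const R = (\<Sum>i\<in>UNIV. \<bar>partial_deriv i g 0\<bar> + M * (real CARD('d) * R))"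

lemma lip_const_nonneg: "0 \<le> R \<Longrightarrow> 0 \<le> lip_const R"
  unfolding lip_const_def using M_nonneg by (intro sum_nonneg) auto

lemma partial_bound:
  assumes "\<And>k. \<bar>z $ k\<bar> \<le> R" shows "\<bar>partial_deriv i g z\<bar> \<le> \<bar>partial_deriv i g 0\<bar> + M * (real CARD('d) * R)"
proof -
  have "l1norm z \<le> real CARD('d) * R" unfolding l1norm_def using sum_bounded_above[of UNIV "\<lambda>i. \<bar>z $ i\<bar>" R] assms by simp
  then have "M * l1norm z \<le> M * (real CARD('d) * R)" by (intro mult_left_mono M_nonneg)
  then show ?thesis using partial_lipschitz[of i z 0] by simp
qed

lemma lipschitz_ball:
  assumes "norm x \<le> R" "norm y \<le> R"
  shows "\<bar>g x - g y\<bar> \<le> lip_const R * norm (x - y)"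
proof -
  let ?K = "\<lambda>i. \<bar>partial_deriv i g 0\<bar> + M * (real CARD('d) * R)"
  have R: "0 \<le> R" using assms(1) norm_ge_zero order.trans by blast
  have "\<bar>g x - g y\<bar> \<le> (\<Sum>i\<in>UNIV. ?K i * \<bar>x $ i - y $ i\<bar>)"
  proof (rule partial_mean_value[where T = "\<lambda>_. {-R..R}" and F' = "\<lambda>i. partial_deriv i g"])
    show "x $ k \<in> {-R..R}" "y $ k \<in> {-R..R}" for k
      using assms component_le_norm_cart[of x k] component_le_norm_cart[of y k] by auto
    show "\<bar>partial_deriv i g z\<bar> \<le> ?K i" if "\<And>k. z $ k \<in> {-R..R}" for i z
      using that by (intro partial_bound) (auto simp: abs_le_iff minus_le_iff)
  qed (auto intro: has_partial)
  also have "\<dots> \<le> (\<Sum>i\<in>UNIV. ?K i * norm (x - y))"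
    using M_nonneg R component_le_norm_cart[of "x - y"] by (intro sum_mono mult_left_mono) auto
  finally show ?thesis by (simp add: lip_const_def sum_distrib_right)
qed

lemma grad_bound:
  assumes "norm u \<le> R" shows "\<bar>grad u h\<bar> \<le> lip_const R * norm h"
proof -
  have "\<bar>grad u h\<bar> \<le> (\<Sum>i\<in>UNIV. \<bar>h $ i\<bar> * \<bar>partial_deriv i g u\<bar>)"
    unfolding abs_mult[symmetric] by (rule sum_abs)
  also have "\<dots> \<le> (\<Sum>i\<in>UNIV. norm h * (\<bar>partial_deriv i g 0\<bar> + M * (real CARD('d) * R)))"
    using assms component_le_norm_cart[of u] by (intro sum_mono mult_mono partial_bound component_le_norm_cart) (auto intro: order.trans)
  finally show ?thesis by (simp add: lip_const_def sum_distrib_left mult.commute)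
qed

lemma continuous_g: "continuous_on UNIV g"
proof -
  have "isCont g x" for x
  proof -
    have "(lip_const (norm x + 1))-lipschitz_on (ball 0 (norm x + 1)) g"
      using lipschitz_ball[of _ "norm x + 1"] lip_const_nonneg[of "norm x + 1"]
      by (intro lipschitz_onI) (auto simp: dist_norm)
    then have "continuous_on (ball 0 (norm x + 1)) g" by (rule lipschitz_on_continuous_on)
    then show ?thesis by (simp add: continuous_on_eq_continuous_at)
  qed
  then show ?thesis by (simp add: continuous_at_imp_continuous_on)
qed

lemma continuous_partial: "continuous_on UNIV (partial_deriv i g)"
  using C2 by (simp add: C2_fun_def C1_fun_def)

end

section \<open>Oscillation estimates\<close>

text \<open>If one of the two points is 0, convexity reduces to s^p \<le> s for 0 < s < 1.\<close>

lemma convex_on_powr_nonneg: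
  assumes p: "1 \<le> p" shows "convex_on {0..} (\<lambda>x::real. x powr p)"
proof (rule convex_onI)
  fix t x y :: real
  assume t: "0 < t" "t < 1" and x: "x \<in> {0..}" and y: "y \<in> {0..}"
  have le: "s powr p \<le> s" if "0 < s" "s < 1" for s :: real
    using that p powr_mono'[of 1 p s] by simp
  consider "x = 0" | "y = 0" | "0 < x" "0 < y" using x y by force
  then show "((1 - t) *\<^sub>R x + t *\<^sub>R y) powr p \<le> (1 - t) * x powr p + t * y powr p"
  proof cases
    case 1
    have "(t * y) powr p = t powr p * y powr p" using t y by (simp add: powr_mult)
    also have "\<dots> \<le> t * y powr p" using le[OF t] by (intro mult_right_mono) auto
    finally show ?thesis using 1 by simp
  next
    case 2
    have "((1 - t) * x) powr p = (1 - t) powr p * x powr p" using t x by (simp add: powr_mult)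
    also have "\<dots> \<le> (1 - t) * x powr p" using le[of "1 - t"] t by (intro mult_right_mono) auto
    finally show ?thesis using 2 by simp
  next
    case 3
    then show ?thesis using convex_onD[OF powr_convex[OF p], of t x y] t by simp
  qed
qed simp

lemma sum_powr_le:
  fixes a \<alpha> :: "'k \<Rightarrow> real"
  assumes "finite K" "\<And>k. k \<in> K \<Longrightarrow> 0 \<le> \<alpha> k" "(\<Sum>k\<in>K. \<alpha> k) = 1" "\<And>k. k \<in> K \<Longrightarrow> 0 \<le> a k" "1 \<le> p"
  shows "(\<Sum>k\<in>K. \<alpha> k * a k) powr p \<le> (\<Sum>k\<in>K. \<alpha> k * a k powr p)"
proof -
  have "K \<noteq> {}" using assms(3) by auto
  then show ?thesis
    using convex_on_sum[OF assms(1) _ convex_on_powr_nonneg[OF assms(5)] assms(3,2), of a] assms(4) by simp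
qed

abbreviation power_mass :: "'a::euclidean_space set \<Rightarrow> real \<Rightarrow> ('a \<Rightarrow> real) \<Rightarrow> ennreal" where
  "power_mass \<Omega> p f \<equiv> \<integral>\<^sup>+x. ennreal (\<bar>f x\<bar> powr p) * indicator \<Omega> x \<partial>lborel"

text \<open>The radius is 2\<epsilon>/n because two points of one cell U(\<xi>, \<epsilon>/n) are at
  most that far apart.\<close>

abbreviation osc_ge :: "nat \<Rightarrow> 'a::euclidean_space set \<Rightarrow> real \<Rightarrow> ('a \<Rightarrow> real) \<Rightarrow> 'a \<Rightarrow> real \<Rightarrow> bool" where
  "osc_ge n \<Omega> \<epsilon> f x y \<equiv> \<exists>\<eta>\<in>\<Omega>. \<exists>\<eta>'\<in>\<Omega>.
     rho \<Omega> x \<eta> \<le> 2 * \<epsilon> / real n \<and> rho \<Omega> x \<eta>' \<le> 2 * \<epsilon> / real n \<and> y \<le> \<bar>f \<eta> - f \<eta>'\<bar>"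

text \<open>The uniform part serves p = \<infinity>, the integral part finite p, with one C for all
  p. The integral part speaks of measurable functions w supported in X and dominated by the
  oscillation, so that measurability of the oscillation itself never has to be discussed.\<close>

definition osc_bound :: "nat \<Rightarrow> 'a::euclidean_space set \<Rightarrow> 'a set \<Rightarrow> real \<Rightarrow> real \<Rightarrow> bool" where
  "osc_bound n \<Omega> X C e0 \<longleftrightarrow> (\<forall>\<epsilon> f. 0 < \<epsilon> \<longrightarrow> \<epsilon> < e0 \<longrightarrow> quad_slice_poly n f \<longrightarrow> f \<in> borel_measurable borel \<longrightarrow>
     (\<forall>S. (\<forall>x\<in>\<Omega>. \<bar>f x\<bar> \<le> S) \<longrightarrow> (\<forall>x\<in>X. \<forall>\<eta>\<in>\<Omega>. rho \<Omega> x \<eta> \<le> 2 * \<epsilon> / real n \<longrightarrow> \<bar>f x - f \<eta>\<bar> \<le> C * \<epsilon> * S)) \<and>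
     (\<forall>p\<ge>1. \<forall>w\<in>borel_measurable borel. (\<forall>x. 0 \<le> w x) \<longrightarrow> (\<forall>x. x \<notin> X \<longrightarrow> w x = 0) \<longrightarrow>
        (\<forall>x\<in>X. osc_ge n \<Omega> \<epsilon> f x (w x)) \<longrightarrow>
        (\<integral>\<^sup>+x. ennreal (w x powr p) \<partial>lborel)
          \<le> ennreal ((C * \<epsilon>) powr p) * power_mass \<Omega> p f))"

lemma osc_bound_sup:
  assumes "osc_bound n \<Omega> X C e0" "0 < \<epsilon>" "\<epsilon> < e0" "quad_slice_poly n f" "f \<in> borel_measurable borel"
    and "\<And>x. x \<in> \<Omega> \<Longrightarrow> \<bar>f x\<bar> \<le> S" "x \<in> X" "\<eta> \<in> \<Omega>" "rho \<Omega> x \<eta> \<le> 2 * \<epsilon> / real n"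
  shows "\<bar>f x - f \<eta>\<bar> \<le> C * \<epsilon> * S"
proof -
  note * = assms(1)[unfolded osc_bound_def, rule_format, OF assms(2-5), THEN conjunct1]
  show ?thesis by (rule *[rule_format]) (use assms in auto)
qed

lemma osc_bound_powr:
  assumes "osc_bound n \<Omega> X C e0" "0 < \<epsilon>" "\<epsilon> < e0" "quad_slice_poly n f" "f \<in> borel_measurable borel"
    and "1 \<le> p" "w \<in> borel_measurable borel" "\<And>x. 0 \<le> w x" "\<And>x. x \<notin> X \<Longrightarrow> w x = 0"
    and "\<And>x. x \<in> X \<Longrightarrow> osc_ge n \<Omega> \<epsilon> f x (w x)"
  shows "(\<integral>\<^sup>+x. ennreal (w x powr p) \<partial>lborel)
    \<le> ennreal ((C * \<epsilon>) powr p) * power_mass \<Omega> p f"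
proof -
  note * = assms(1)[unfolded osc_bound_def, rule_format, OF assms(2-5), THEN conjunct2]
  show ?thesis by (rule *[rule_format]) (use assms(6-) in \<open>assumption | blast\<close>)+
qed

text \<open>The passage from a pointwise estimate to an integral one, with the geometry left
  abstract: \<pi> covers X from a lifted space, and the maps \<open>\<Phi> k\<close> lead to the
  nodes. The convexity inequality is applied at each lifted point before integration, and then the
  factor c cancels. The constant doubles because w compares two points \<eta> and \<eta>' by way of
  the value at \<pi> z.\<close>

lemma osc_bound_lift:
  fixes M :: "'z measure" and \<pi> :: "'z \<Rightarrow> 'a::euclidean_space" and \<Phi> :: "'k \<Rightarrow> 'z \<Rightarrow> 'a" and c :: ennreal
  assumes K: "finite K" "\<And>k. k \<in> K \<Longrightarrow> 0 \<le> \<alpha> k" "(\<Sum>k\<in>K. \<alpha> k) = 1"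
    and [measurable]: "\<pi> \<in> M \<rightarrow>\<^sub>M borel" "\<And>k. k \<in> K \<Longrightarrow> \<Phi> k \<in> M \<rightarrow>\<^sub>M borel" and "\<Omega> \<in> sets borel" "X \<in> sets borel"
    and c: "c \<noteq> 0" "c \<noteq> top"
    and lift: "\<And>G. G \<in> borel_measurable borel \<Longrightarrow> (\<And>x. x \<notin> X \<Longrightarrow> G x = 0) \<Longrightarrow> (\<integral>\<^sup>+z. G (\<pi> z) \<partial>M) = c * (\<integral>\<^sup>+x. G x \<partial>lborel)"
    and nodes: "\<And>k G. k \<in> K \<Longrightarrow> G \<in> borel_measurable borel \<Longrightarrow> (\<integral>\<^sup>+z. G (\<Phi> k z) \<partial>M) \<le> c * (\<integral>\<^sup>+x. G x \<partial>lborel)"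
    and sub: "\<And>k z. k \<in> K \<Longrightarrow> z \<in> space M \<Longrightarrow> \<pi> z \<in> X \<Longrightarrow> \<Phi> k z \<in> \<Omega>"
    and surj: "\<And>x. x \<in> X \<Longrightarrow> \<exists>z\<in>space M. \<pi> z = x"
    and C0: "0 \<le> C0"
    and est: "\<And>\<epsilon> f z \<eta>. 0 < \<epsilon> \<Longrightarrow> \<epsilon> < e0 \<Longrightarrow> quad_slice_poly n f \<Longrightarrow> z \<in> space M \<Longrightarrow> \<pi> z \<in> X \<Longrightarrow> \<eta> \<in> \<Omega> \<Longrightarrow>
        rho \<Omega> (\<pi> z) \<eta> \<le> 2 * \<epsilon> / real n \<Longrightarrow> \<bar>f (\<pi> z) - f \<eta>\<bar> \<le> C0 * \<epsilon> * (\<Sum>k\<in>K. \<alpha> k * \<bar>f (\<Phi> k z)\<bar>)"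
  shows "osc_bound n \<Omega> X (2 * C0) e0"
  unfolding osc_bound_def
proof (intro allI impI conjI ballI)
  fix \<epsilon> :: real and f :: "'a \<Rightarrow> real" and S x \<eta>
  assume e: "0 < \<epsilon>" "\<epsilon> < e0" and f: "quad_slice_poly n f" and S: "\<forall>x\<in>\<Omega>. \<bar>f x\<bar> \<le> S" and x: "x \<in> X" and \<eta>: "\<eta> \<in> \<Omega>" "rho \<Omega> x \<eta> \<le> 2 * \<epsilon> / real n"
  obtain z where z: "z \<in> space M" "\<pi> z = x" using surj[OF x] by blast
  have S0: "0 \<le> S" using S \<eta> abs_ge_zero order.trans by blast
  have "\<bar>f x - f \<eta>\<bar> \<le> C0 * \<epsilon> * (\<Sum>k\<in>K. \<alpha> k * \<bar>f (\<Phi> k z)\<bar>)" using est[OF e f z(1), of \<eta>] z x \<eta> by simp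
  also have "\<dots> \<le> C0 * \<epsilon> * (\<Sum>k\<in>K. \<alpha> k * S)"
    using C0 e K S sub z x by (intro mult_left_mono sum_mono) auto
  also have "\<dots> = C0 * \<epsilon> * S" using K by (simp add: sum_distrib_right[symmetric])
  also have "\<dots> \<le> 2 * C0 * \<epsilon> * S" using C0 e S0 by (intro mult_right_mono) auto
  finally show "\<bar>f x - f \<eta>\<bar> \<le> 2 * C0 * \<epsilon> * S" .
next
  fix \<epsilon> p :: real and f w :: "'a \<Rightarrow> real"
  assume e: "0 < \<epsilon>" "\<epsilon> < e0" and f: "quad_slice_poly n f" and [measurable]: "f \<in> borel_measurable borel" "w \<in> borel_measurable borel"
    and p: "1 \<le> p" and w0: "\<forall>x. 0 \<le> w x" "\<forall>x. x \<notin> X \<longrightarrow> w x = 0"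
    and w: "\<forall>x\<in>X. osc_ge n \<Omega> \<epsilon> f x (w x)"
  have [measurable]: "\<Omega> \<in> sets borel" by fact
  let ?I = "power_mass \<Omega> p f"
  define B where "B = (2 * C0 * \<epsilon>) powr p"
  have B: "0 \<le> B" by (simp add: B_def)
  have pt: "ennreal (w (\<pi> z) powr p) \<le> ennreal B * (\<Sum>k\<in>K. ennreal (\<alpha> k) * (ennreal (\<bar>f (\<Phi> k z)\<bar> powr p) * indicator \<Omega> (\<Phi> k z)))"
    if z: "z \<in> space M" for z
  proof (cases "\<pi> z \<in> X")
    case True
    then obtain \<eta> \<eta>' where \<eta>: "\<eta> \<in> \<Omega>" "\<eta>' \<in> \<Omega>" "rho \<Omega> (\<pi> z) \<eta> \<le> 2 * \<epsilon> / real n" "rho \<Omega> (\<pi> z) \<eta>' \<le> 2 * \<epsilon> / real n"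
      "w (\<pi> z) \<le> \<bar>f \<eta> - f \<eta>'\<bar>" using w by blast
    have "w (\<pi> z) \<le> \<bar>f (\<pi> z) - f \<eta>\<bar> + \<bar>f (\<pi> z) - f \<eta>'\<bar>" using \<eta>(5) by linarith
    also have "\<dots> \<le> 2 * C0 * \<epsilon> * (\<Sum>k\<in>K. \<alpha> k * \<bar>f (\<Phi> k z)\<bar>)"
      using est[OF e f z True \<eta>(1,3)] est[OF e f z True \<eta>(2,4)] by simp
    finally have "w (\<pi> z) powr p \<le> (2 * C0 * \<epsilon> * (\<Sum>k\<in>K. \<alpha> k * \<bar>f (\<Phi> k z)\<bar>)) powr p"
      using w0 p by (intro powr_mono2) auto
    also have "\<dots> = B * (\<Sum>k\<in>K. \<alpha> k * \<bar>f (\<Phi> k z)\<bar>) powr p"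
      unfolding B_def by (rule powr_mult)
    also have "\<dots> \<le> B * (\<Sum>k\<in>K. \<alpha> k * \<bar>f (\<Phi> k z)\<bar> powr p)"
      using K p B by (intro mult_left_mono sum_powr_le) auto
    finally have "ennreal (w (\<pi> z) powr p) \<le> ennreal (B * (\<Sum>k\<in>K. \<alpha> k * \<bar>f (\<Phi> k z)\<bar> powr p))"
      by (rule ennreal_leI)
    also have "\<dots> = ennreal B * (\<Sum>k\<in>K. ennreal (\<alpha> k) * (ennreal (\<bar>f (\<Phi> k z)\<bar> powr p) * indicator \<Omega> (\<Phi> k z)))"
      using K B sub[OF _ z True] by (simp add: ennreal_mult sum_nonneg sum_ennreal[symmetric] del: sum_ennreal)
    finally show ?thesis .
  qed (use w0 p in simp)
  have "c * (\<integral>\<^sup>+x. ennreal (w x powr p) \<partial>lborel) = (\<integral>\<^sup>+z. ennreal (w (\<pi> z) powr p) \<partial>M)"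
    using w0 p by (intro lift[symmetric]) auto
  also have "\<dots> \<le> (\<integral>\<^sup>+z. ennreal B * (\<Sum>k\<in>K. ennreal (\<alpha> k) * (ennreal (\<bar>f (\<Phi> k z)\<bar> powr p) * indicator \<Omega> (\<Phi> k z))) \<partial>M)"
    by (intro nn_integral_mono pt)
  also have "\<dots> = ennreal B * (\<Sum>k\<in>K. ennreal (\<alpha> k) * (\<integral>\<^sup>+z. ennreal (\<bar>f (\<Phi> k z)\<bar> powr p) * indicator \<Omega> (\<Phi> k z) \<partial>M))"
    by (simp add: nn_integral_cmult nn_integral_sum)
  also have "\<dots> \<le> ennreal B * (\<Sum>k\<in>K. ennreal (\<alpha> k) * (c * ?I))"
    by (intro mult_left_mono sum_mono nodes) auto
  also have "\<dots> = ennreal B * ((\<Sum>k\<in>K. ennreal (\<alpha> k)) * (c * ?I))"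
    by (simp add: sum_distrib_right)
  also have "(\<Sum>k\<in>K. ennreal (\<alpha> k)) = 1" using K by (simp add: sum_ennreal)
  finally have "c * (\<integral>\<^sup>+x. ennreal (w x powr p) \<partial>lborel) \<le> c * (ennreal B * ?I)" by (simp add: mult.left_commute)
  then show "(\<integral>\<^sup>+x. ennreal (w x powr p) \<partial>lborel) \<le> ennreal ((2 * C0 * \<epsilon>) powr p) * ?I"
    unfolding B_def using c by (simp add: ennreal_mult_le_mult_iff)
qed

section \<open>Points away from the boundary\<close>

lemma quad_slice_poly_linear: 
  assumes "quad_slice_poly n f" shows "\<exists>q. degree q \<le> 2 * n \<and> (\<forall>t. f (x + t *\<^sub>R y) = poly q t)"
  using assms[unfolded quad_slice_poly_def, rule_format, of x y 0] by simp

text \<open>A segment that leaves S has to meet the frontier.\<close>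

lemma ball_infdist_frontier:
  fixes x :: "'a::euclidean_space"
  assumes "x \<in> S" shows "ball x (infdist x (frontier S)) \<subseteq> S"
proof
  fix y assume y: "y \<in> ball x (infdist x (frontier S))"
  show "y \<in> S"
  proof (rule ccontr)
    assume "y \<notin> S"
    then have "closed_segment x y \<inter> frontier S \<noteq> {}"
      using assms by (intro connected_Int_frontier) auto
    then obtain u where u: "u \<in> closed_segment x y" "u \<in> frontier S" by blast
    have "infdist x (frontier S) \<le> dist x u" using u by (intro infdist_le)
    also have "\<dots> \<le> dist x y" using u(1) by (metis dist_commute dist_in_closed_segment(1))
    finally show False using y by simp
  qed
qed

text \<open>Away from the boundary the node maps are plain translations, and r is chosen so that a
  translation vector has norm at most d r = \<delta>/2. There are m = 8n + 2 \<le> 10n nodes per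
  variable, so \<epsilon> < r/40 puts the increments into the range r/(2m) of the kernel
  formula.\<close>

lemma osc_bound_interior:
  fixes \<Omega> :: "'a::euclidean_space set"
  assumes \<Omega>: "closed \<Omega>" and \<delta>: "\<delta> > 0" and X: "X \<subseteq> \<Omega>" "X \<in> sets borel" "\<And>x. x \<in> X \<Longrightarrow> \<delta> \<le> infdist x (frontier \<Omega>)"
  shows "\<exists>C\<ge>0. \<exists>e0>0. \<forall>n\<ge>1. osc_bound n \<Omega> X C e0"
proof -
  define d where "d = real DIM('a)"
  have d: "d \<ge> 1" by (simp add: d_def DIM_positive Suc_leI)
  define r where "r = \<delta> / (2 * d)"
  have r: "r > 0" using \<delta> d by (simp add: r_def)
  define C0 where "C0 = 600 ^ DIM('a) * (20 * d / r)"
  have C0: "0 \<le> C0" using r d by (simp add: C0_def)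
  define e0 where "e0 = r / 40"
  have "osc_bound n \<Omega> X (2 * C0) e0" if n: "n \<ge> 1" for n
  proof -
    define m where "m = 4 * (2 * n) + 2"
    have m: "real m \<le> 10 * real n" "0 < real m" using n by (simp_all add: m_def)
    obtain K :: "('a \<Rightarrow> nat) set" and \<alpha> :: "('a \<Rightarrow> nat) \<Rightarrow> real" and \<nu> where
      K: "finite K" "\<And>k. k \<in> K \<Longrightarrow> 0 \<le> \<alpha> k" "(\<Sum>k\<in>K. \<alpha> k) = 1"
      and \<nu>: "\<And>k i. k \<in> K \<Longrightarrow> i \<in> Basis \<Longrightarrow> r / real m \<le> \<bar>\<nu> k i\<bar> \<and> \<bar>\<nu> k i\<bar> \<le> r"
      and ker: "\<And>P c c'. slice_poly (2 * n) Basis P \<Longrightarrow> (\<And>i::'a. i \<in> Basis \<Longrightarrow> \<bar>c i\<bar> \<le> r / (2 * real m)) \<Longrightarrow> (\<And>i. i \<in> Basis \<Longrightarrow> \<bar>c' i\<bar> \<le> r / (2 * real m))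
       \<Longrightarrow> (\<And>i. i \<notin> Basis \<Longrightarrow> c i = 0) \<Longrightarrow> (\<And>i. i \<notin> Basis \<Longrightarrow> c' i = 0)
       \<Longrightarrow> \<bar>P c - P c'\<bar> \<le> 600 ^ DIM('a) * (real m / r) * (\<Sum>i\<in>Basis. \<bar>c i - c' i\<bar>) * (\<Sum>k\<in>K. \<alpha> k * \<bar>P (\<nu> k)\<bar>)"
      by (rule tensor_kernel[where I = "Basis :: 'a set" and m = m and N = "2 * n" and r = r])
        (use r m_def n in auto)
    define v where "v k = (\<Sum>b\<in>Basis. \<nu> k b *\<^sub>R b)" for k
    have v: "norm (v k) < \<delta>" if "k \<in> K" for k
    proof -
      have "norm (v k) \<le> (\<Sum>b\<in>Basis. \<bar>\<nu> k b\<bar>)" unfolding v_def by (rule order.trans[OF norm_sum]) simp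
      also have "\<dots> \<le> d * r" unfolding d_def using \<nu>[OF that] by (intro sum_bounded_above) auto
      also have "\<dots> < \<delta>" using \<delta> d by (simp add: r_def)
      finally show ?thesis .
    qed
    show ?thesis
    proof (rule osc_bound_lift[where M = lborel and \<pi> = "\<lambda>x. x" and \<Phi> = "\<lambda>k x. x + v k" and c = 1 and K = K and \<alpha> = \<alpha>])
      show "\<Omega> \<in> sets borel" using \<Omega> by simp
      show "(\<integral>\<^sup>+z. G (z + v k) \<partial>lborel) \<le> 1 * (\<integral>\<^sup>+x. G x \<partial>lborel)" if "G \<in> borel_measurable borel" for k and G :: "'a \<Rightarrow> ennreal"
        using that by (simp add: nn_integral_lborel_translate)
      show "z + v k \<in> \<Omega>" if "k \<in> K" "z \<in> X" for k z
      proof -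
        have "z + v k \<in> ball z (infdist z (frontier \<Omega>))" using X(3)[OF that(2)] v[OF that(1)] by (simp add: dist_norm)
        then show ?thesis using ball_infdist_frontier[of z \<Omega>] X(1) that by blast
      qed
    next
      fix \<epsilon> :: real and f :: "'a \<Rightarrow> real" and z \<eta> :: 'a
      assume e: "0 < \<epsilon>" "\<epsilon> < e0" and f: "quad_slice_poly n f" and z: "z \<in> X" and \<eta>: "rho \<Omega> z \<eta> \<le> 2 * \<epsilon> / real n"
      define h where "h = \<eta> - z"
      have h: "norm h \<le> 2 * \<epsilon> / real n" using \<eta> by (simp add: rho_def h_def norm_minus_commute)
      define P where "P c = f (z + (\<Sum>b\<in>Basis. c b *\<^sub>R b))" for c
      have sl: "slice_poly (2 * n) Basis P" unfolding slice_poly_def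
      proof (intro allI ballI)
        fix c and i :: 'a assume i: "i \<in> Basis"
        have "P (c(i := t)) = f ((z + (\<Sum>b\<in>Basis - {i}. c b *\<^sub>R b)) + t *\<^sub>R i)" for t
        proof -
          have "(\<Sum>b\<in>Basis. (c(i := t)) b *\<^sub>R b) = t *\<^sub>R i + (\<Sum>b\<in>Basis - {i}. (c(i := t)) b *\<^sub>R b)"
            using i by (subst sum.remove[of _ i]) auto
          also have "(\<Sum>b\<in>Basis - {i}. (c(i := t)) b *\<^sub>R b) = (\<Sum>b\<in>Basis - {i}. c b *\<^sub>R b)"
            by (intro sum.cong) auto
          finally show ?thesis by (simp add: P_def ac_simps)
        qed
        then show "\<exists>q. degree q \<le> 2 * n \<and> (\<forall>t. P (c(i := t)) = poly q t)"
          using quad_slice_poly_linear[OF f] by simp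
      qed
      define c where "c b = (if b \<in> Basis then h \<bullet> b else 0)" for b
      have hb: "\<bar>h \<bullet> b\<bar> \<le> 2 * \<epsilon> / real n" if "b \<in> Basis" for b
        using h Basis_le_norm[OF that, of h] by linarith
      have small: "2 * \<epsilon> / real n \<le> r / (2 * real m)"
      proof -
        have "2 * \<epsilon> / real n \<le> (r / 20) / real n" using e n by (intro divide_right_mono) (auto simp: e0_def)
        also have "\<dots> = r / (2 * (10 * real n))" by simp
        also have "\<dots> \<le> r / (2 * real m)" using m r by (intro divide_left_mono) auto
        finally show ?thesis .
      qed
      have "\<bar>P (\<lambda>_. 0) - P c\<bar> \<le> 600 ^ DIM('a) * (real m / r) * (\<Sum>i\<in>Basis. \<bar>0 - c i\<bar>) * (\<Sum>k\<in>K. \<alpha> k * \<bar>P (\<nu> k)\<bar>)"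
        using r small by (intro ker sl) (auto simp: c_def intro: order.trans[OF hb])
      also have "\<dots> \<le> 600 ^ DIM('a) * (10 * real n / r) * (d * (2 * \<epsilon> / real n)) * (\<Sum>k\<in>K. \<alpha> k * \<bar>P (\<nu> k)\<bar>)"
      proof (intro mult_right_mono mult_mono mult_left_mono divide_right_mono m)
        have "(\<Sum>i\<in>(Basis::'a set). \<bar>0 - c i\<bar>) \<le> (\<Sum>i\<in>(Basis::'a set). 2 * \<epsilon> / real n)"
          using hb by (intro sum_mono) (auto simp: c_def)
        then show "(\<Sum>i\<in>(Basis::'a set). \<bar>0 - c i\<bar>) \<le> d * (2 * \<epsilon> / real n)" by (simp add: d_def)
      qed (use r K in \<open>auto intro!: sum_nonneg\<close>)
      also have "600 ^ DIM('a) * (10 * real n / r) * (d * (2 * \<epsilon> / real n)) = C0 * \<epsilon>"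
        using n by (simp add: C0_def)
      finally have "\<bar>P (\<lambda>_. 0) - P c\<bar> \<le> C0 * \<epsilon> * (\<Sum>k\<in>K. \<alpha> k * \<bar>P (\<nu> k)\<bar>)" .
      moreover have "P c = f \<eta>"
        unfolding P_def c_def by (simp add: euclidean_representation h_def cong: sum.cong)
      moreover have "P (\<nu> k) = f (z + v k)" for k by (simp add: P_def v_def)
      ultimately show "\<bar>f z - f \<eta>\<bar> \<le> C0 * \<epsilon> * (\<Sum>k\<in>K. \<alpha> k * \<bar>f (z + v k)\<bar>)" by (simp add: P_def)
    qed (use K X C0 in auto)
  qed
  moreover have "e0 > 0" using r by (simp add: e0_def)
  ultimately show ?thesis using C0 by (intro exI[of _ "2 * C0"] conjI exI[of _ e0]) auto
qed

section \<open>Transport by isometries\<close>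

lemma dist_affine_orthogonal:
  assumes "orthogonal_transformation A"
  shows "dist (A (x - a)) (A (y - a)) = dist x y"
proof -
  have "A (x - a) - A (y - a) = A (x - y)"
    using orthogonal_transformation_linear[OF assms] by (simp add: linear_diff[symmetric])
  then show ?thesis using assms by (simp add: dist_norm orthogonal_transformation_norm)
qed

lemma frontier_affine_orthogonal:
  fixes A :: "'a::euclidean_space \<Rightarrow> 'a"
  assumes A: "orthogonal_transformation A"
  shows "frontier ((\<lambda>x. A (x - a)) ` S) = (\<lambda>x. A (x - a)) ` frontier S"
proof -
  note linA = orthogonal_transformation_linear[OF A] and injA = orthogonal_transformation_inj[OF A]
  have "(\<lambda>x. A (x - a)) ` Y = A ` ((+) (- a) ` Y)" for Y by (simp add: image_image)
  moreover have "frontier (A ` Y) = A ` frontier Y" for Y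
    unfolding frontier_def
    using closure_injective_linear_image[OF linA injA, of Y] interior_injective_linear_image[OF linA injA, of Y] injA
    by (simp add: image_set_diff)
  moreover have "frontier ((+) (- a) ` S) = (+) (- a) ` frontier S" by (rule frontier_translation)
  ultimately show ?thesis by (simp only:)
qed

lemma infdist_frontier_affine_orthogonal:
  fixes A :: "'a::euclidean_space \<Rightarrow> 'a"
  assumes A: "orthogonal_transformation A"
  shows "infdist (A (x - a)) (frontier ((\<lambda>x. A (x - a)) ` S)) = infdist x (frontier S)"
  unfolding frontier_affine_orthogonal[OF A] infdist_def by (simp add: image_image dist_affine_orthogonal[OF A])

text \<open>Charts come with rotated coordinates. The metric \<rho>, Lebesgue measure and the class
  of functions are all preserved by isometries, so an estimate proved in the coordinates of a chart
  can be pulled back.\<close>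

lemma osc_bound_isometry:
  fixes A :: "'a::euclidean_space \<Rightarrow> 'a" and a :: 'a
  assumes A: "orthogonal_transformation A"
    and \<Omega>: "\<Omega> \<in> sets borel" and ob: "osc_bound n ((\<lambda>x. A (x - a)) ` \<Omega>) ((\<lambda>x. A (x - a)) ` X) C e0"
  shows "osc_bound n \<Omega> X C e0"
proof -
  define T where "T x = A (x - a)" for x
  define B where "B = inv A"
  have B: "orthogonal_transformation B" unfolding B_def by (rule orthogonal_transformation_inv[OF A])
  have AB: "A (B z) = z" for z unfolding B_def using orthogonal_transformation_surj[OF A] by (simp add: surj_f_inv_f)
  have BA: "B (A z) = z" for z unfolding B_def using orthogonal_transformation_inj[OF A] by (simp add: inv_f_f)
  define S where "S z = B z + a" for z
  have ST: "S (T x) = x" and TS: "T (S x) = x" for x by (simp_all add: S_def T_def AB BA)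
  have linB: "linear B" using B by (rule orthogonal_transformation_linear)
  have dT: "dist (T x) (T y) = dist x y" for x y
    unfolding T_def by (rule dist_affine_orthogonal[OF A])
  have inf: "infdist (T x) (frontier (T ` \<Omega>)) = infdist x (frontier \<Omega>)" for x
    unfolding T_def[abs_def] by (rule infdist_frontier_affine_orthogonal[OF A])
  have rho: "rho (T ` \<Omega>) (T x) (T y) = rho \<Omega> x y" for x y
    using dT[of x y] by (simp add: rho_def inf dist_norm)
  have [measurable]: "S \<in> borel_measurable borel"
    unfolding S_def using linB by (intro borel_measurable_continuous_onI continuous_intros linear_continuous_on) (simp add: linear_linear)
  have int: "(\<integral>\<^sup>+z. G (S z) \<partial>lborel) = (\<integral>\<^sup>+x. G x \<partial>lborel)" if [measurable]: "G \<in> borel_measurable borel" for G :: "'a \<Rightarrow> ennreal"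
  proof -
    have "(\<integral>\<^sup>+z. G (S z) \<partial>lborel) = (\<integral>\<^sup>+z. G (z + a) \<partial>lborel)"
      unfolding S_def by (rule nn_integral_lborel_orthogonal[OF B, of "\<lambda>z. G (z + a)"]) measurable
    then show ?thesis by (simp add: nn_integral_lborel_translate)
  qed
  have TX: "T z \<in> T ` Y \<longleftrightarrow> z \<in> Y" for z Y using ST by (metis image_iff)
  have ob': "osc_bound n (T ` \<Omega>) (T ` X) C e0" using ob unfolding T_def[abs_def] .
  have F: "quad_slice_poly n (\<lambda>z. f (S z))" if "quad_slice_poly n f" for f
    unfolding quad_slice_poly_def
  proof (intro allI)
    fix x y z
    have "S (x + t *\<^sub>R y + t\<^sup>2 *\<^sub>R z) = (B x + a) + t *\<^sub>R B y + t\<^sup>2 *\<^sub>R B z" for t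
      using linB by (simp add: S_def linear_add linear_scale)
    then show "\<exists>q. degree q \<le> 2 * n \<and> (\<forall>t. f (S (x + t *\<^sub>R y + t\<^sup>2 *\<^sub>R z)) = poly q t)"
      using that unfolding quad_slice_poly_def by simp
  qed
  have Fm: "(\<lambda>z. f (S z)) \<in> borel_measurable borel" if [measurable]: "f \<in> borel_measurable borel" for f :: "'a \<Rightarrow> real"
    by measurable
  show ?thesis unfolding osc_bound_def
  proof (intro allI impI conjI ballI)
    fix \<epsilon> :: real and f :: "'a \<Rightarrow> real" and b x \<eta>
    assume e: "0 < \<epsilon>" "\<epsilon> < e0" and f: "quad_slice_poly n f" "f \<in> borel_measurable borel"
      and b: "\<forall>x\<in>\<Omega>. \<bar>f x\<bar> \<le> b" and x: "x \<in> X" "\<eta> \<in> \<Omega>" "rho \<Omega> x \<eta> \<le> 2 * \<epsilon> / real n"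
    have "\<bar>f (S (T x)) - f (S (T \<eta>))\<bar> \<le> C * \<epsilon> * b"
      by (rule osc_bound_sup[OF ob' e F[OF f(1)] Fm[OF f(2)]]) (use b x in \<open>auto simp: ST rho\<close>)
    then show "\<bar>f x - f \<eta>\<bar> \<le> C * \<epsilon> * b" by (simp add: ST)
  next
    fix \<epsilon> p :: real and f w :: "'a \<Rightarrow> real"
    assume e: "0 < \<epsilon>" "\<epsilon> < e0" and f: "quad_slice_poly n f" and [measurable]: "f \<in> borel_measurable borel" "w \<in> borel_measurable borel"
      and p: "1 \<le> p" and w0: "\<forall>x. 0 \<le> w x" "\<forall>x. x \<notin> X \<longrightarrow> w x = 0" and w: "\<forall>x\<in>X. osc_ge n \<Omega> \<epsilon> f x (w x)"
    have "(\<integral>\<^sup>+z. ennreal (w (S z) powr p) \<partial>lborel)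
        \<le> ennreal ((C * \<epsilon>) powr p) * power_mass (T ` \<Omega>) p (\<lambda>z. f (S z))"
    proof (rule osc_bound_powr[OF ob' e F[OF f] Fm p])
      show "f \<in> borel_measurable borel" "(\<lambda>z. w (S z)) \<in> borel_measurable borel" by measurable
      show "0 \<le> w (S z)" for z using w0 by simp
      show "w (S z) = 0" if "z \<notin> T ` X" for z using w0 that TX[of "S z" X] by (simp add: TS)
      fix z assume "z \<in> T ` X"
      then obtain x where x: "x \<in> X" "z = T x" by blast
      with w obtain \<eta> \<eta>' where "\<eta> \<in> \<Omega>" "\<eta>' \<in> \<Omega>" "rho \<Omega> x \<eta> \<le> 2 * \<epsilon> / real n" "rho \<Omega> x \<eta>' \<le> 2 * \<epsilon> / real n" "w x \<le> \<bar>f \<eta> - f \<eta>'\<bar>" by blast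
      then show "osc_ge n (T ` \<Omega>) \<epsilon> (\<lambda>z. f (S z)) z (w (S z))"
        by (intro bexI[of _ "T \<eta>"] bexI[of _ "T \<eta>'"]) (auto simp: x rho ST)
    qed
    also have "(\<integral>\<^sup>+z. ennreal (w (S z) powr p) \<partial>lborel) = (\<integral>\<^sup>+x. ennreal (w x powr p) \<partial>lborel)"
      by (rule int[of "\<lambda>x. ennreal (w x powr p)"]) measurable
    also have "power_mass (T ` \<Omega>) p (\<lambda>z. f (S z)) = (\<integral>\<^sup>+z. ennreal (\<bar>f (S z)\<bar> powr p) * indicator \<Omega> (S z) \<partial>lborel)"
      using TX[of "S _" \<Omega>] by (intro nn_integral_cong) (simp add: indicator_def TS)
    also have "\<dots> = power_mass \<Omega> p f"
      by (rule int[of "\<lambda>x. ennreal (\<bar>f x\<bar> powr p) * indicator \<Omega> x"]) (use \<Omega> in measurable)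
    finally show "(\<integral>\<^sup>+x. ennreal (w x powr p) \<partial>lborel) \<le> ennreal ((C * \<epsilon>) powr p) * power_mass \<Omega> p f" .
  qed
qed

section \<open>Depth below a graph and distance to the boundary\<close>

text \<open>A point z that is not interior lies on the frontier or outside S, and in the second case
  a segment crosses the frontier. This lets any point on or above the graph serve as an upper bound
  for the distance to the boundary.\<close>

lemma infdist_frontier_le:
  fixes q z :: "'a::euclidean_space"
  assumes "q \<in> S" "z \<notin> interior S" shows "infdist q (frontier S) \<le> dist q z"
proof (cases "z \<in> S")
  case True
  then have "z \<in> frontier S" using assms(2) closure_subset by (auto simp: frontier_def)
  then show ?thesis by (rule infdist_le)
next
  case False
  then show ?thesis using ball_infdist_frontier[OF assms(1)] by (metis linorder_not_le mem_ball subsetD)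
qed

lemma rho_triangle: "rho \<Omega> x z \<le> rho \<Omega> x y + rho \<Omega> y z"
proof -
  have "norm (x - z) \<le> norm (x - y) + norm (y - z)" using norm_triangle_ineq[of "x - y" "y - z"] by simp
  then show ?thesis unfolding rho_def by linarith
qed

lemma rho_commute: "rho \<Omega> x y = rho \<Omega> y x"
  by (simp add: rho_def norm_minus_commute abs_minus_commute)

text \<open>A domain in coordinates in which, within U, it is the part below the graph of g. The
  number R confines the points considered, because g has a Lipschitz constant only on bounded
  sets.\<close>

locale graph_chart = C2_bounded g M for g :: "real ^ 'd \<Rightarrow> real" and M :: real +
  fixes D U :: "((real ^ 'd) \<times> real) set" and \<delta> R :: real
  assumes D: "closed D" "frontier D \<noteq> {}" and U: "open U"
    and chart: "D \<inter> U = {z \<in> U. snd z \<le> g (fst z)}" and \<delta>: "\<delta> > 0" and R: "R \<ge> 0"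
begin

definition "G = lip_const (R + \<delta>)"
text \<open>A scale at which excursions by a few multiples of (1 + G) \<sigma> stay inside the ball
  of radius \<delta>, where the chart is valid.\<close>

definition "\<sigma> = \<delta> / (16 * (1 + G))"
definition "depth z = g (fst z) - snd z"
abbreviation "bd z \<equiv> infdist z (frontier D)"

text \<open>The estimate is made at \<open>base\<close> points, and \<open>near\<close> points are
  compared with them. The ball in \<open>base\<close> permits excursions to the frontier and to the
  nodes without leaving the chart.\<close>

definition "near z0 p \<longleftrightarrow> p \<in> D \<and> dist z0 p \<le> \<sigma>"
definition "base z0 \<longleftrightarrow> z0 \<in> D \<and> ball z0 \<delta> \<subseteq> U \<and> norm z0 \<le> R \<and> bd z0 \<le> \<sigma>"

lemma G_nonneg: "0 \<le> G"
  unfolding G_def using R \<delta> by (intro lip_const_nonneg) simp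

lemma \<sigma>_pos: "0 < \<sigma>" and \<sigma>_le: "16 * \<sigma> \<le> \<delta>" and \<sigma>_G: "16 * ((1 + G) * \<sigma>) = \<delta>"
proof -
  show "0 < \<sigma>" using G_nonneg \<delta> by (simp add: \<sigma>_def)
  show eq: "16 * ((1 + G) * \<sigma>) = \<delta>" using G_nonneg by (simp add: \<sigma>_def field_simps add_nonneg_eq_0_iff)
  have "1 * \<sigma> \<le> (1 + G) * \<sigma>" using G_nonneg \<open>0 < \<sigma>\<close> by (intro mult_right_mono) auto
  then show "16 * \<sigma> \<le> \<delta>" using eq by linarith
qed

lemma lipschitz:
  fixes x y :: "(real ^ 'd) \<times> real"
  assumes "base z0" "fst x \<in> fst ` ball z0 \<delta>" "fst y \<in> fst ` ball z0 \<delta>"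
  shows "\<bar>g (fst x) - g (fst y)\<bar> \<le> G * norm (fst x - fst y)"
proof -
  have *: "norm (fst x) \<le> R + \<delta>" if "fst x \<in> fst ` ball z0 \<delta>" for x :: "(real ^ 'd) \<times> real"
  proof -
    from that obtain z where z: "dist z0 z < \<delta>" "fst x = fst z" by auto
    have "norm (fst z) \<le> norm z" by (metis norm_fst_le prod.collapse)
    also have "\<dots> \<le> norm z0 + dist z0 z" by (metis dist_commute dist_norm norm_triangle_sub)
    finally show ?thesis using z assms(1) by (simp add: base_def)
  qed
  then show ?thesis unfolding G_def using assms(2,3) by (intro lipschitz_ball *)
qed

text \<open>An arbitrarily small step upwards leaves D.\<close>

lemma notin_interior:
  assumes z: "z \<in> U" "g (fst z) \<le> snd z" shows "z \<notin> interior D"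
proof
  assume "z \<in> interior D"
  then have "z \<in> interior (D \<inter> U)" using z U by (simp add: interior_Int interior_open)
  then obtain e where e: "e > 0" "ball z e \<subseteq> D \<inter> U" unfolding mem_interior by blast
  have "z + (0, e / 2) \<in> ball z e" using e by (simp add: dist_norm norm_Pair)
  then have "z + (0, e / 2) \<in> D \<inter> U" using e(2) by blast
  then show False unfolding chart using z e(1) by simp
qed

lemma frontier_on_graph:
  assumes "y \<in> frontier D" "y \<in> U" shows "y \<in> D" "snd y = g (fst y)"
proof -
  show yD: "y \<in> D" using assms D by (simp add: frontier_def)
  then have le: "snd y \<le> g (fst y)" using chart assms by blast
  have "\<not> snd y < g (fst y)"
  proof
    assume lt: "snd y < g (fst y)"
    define V where "V = U \<inter> {z. snd z < g (fst z)}"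
    have "continuous_on UNIV (\<lambda>z::(real ^ 'd) \<times> real. g (fst z))"
      by (rule continuous_on_compose2[OF continuous_g]) (auto intro: continuous_intros)
    then have "open {z::(real ^ 'd) \<times> real. snd z < g (fst z)}"
      by (intro open_Collect_less continuous_intros)
    then have "open V" unfolding V_def using U by (rule open_Int[rotated])
    moreover have "V \<subseteq> D" using chart unfolding V_def by force
    moreover have "y \<in> V" using lt assms by (simp add: V_def)
    ultimately have "y \<in> interior D" using interior_maximal by blast
    then show False using assms by (simp add: frontier_def)
  qed
  then show "snd y = g (fst y)" using le by simp
qed

text \<open>The point of the graph above p is not interior, so the vertical depth bounds the
  distance to the boundary. Conversely the nearest frontier point lies on the graph, and the
  Lipschitz constant of g bounds the depth by 1 + G times the distance.\<close>

lemma near_facts: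
  assumes b: "base z0" and n: "near z0 p"
  shows "0 \<le> depth p" "bd p \<le> depth p" "depth p \<le> (1 + G) * bd p" "bd p \<le> 2 * \<sigma>" "depth p \<le> \<delta> / 8"
    "\<exists>y\<in>frontier D. dist p y = bd p"
proof -
  have pD: "p \<in> D" and dp: "dist z0 p \<le> \<sigma>" using n by (auto simp: near_def)
  have pU: "p \<in> ball z0 \<delta>" using dp \<sigma>_le \<sigma>_pos by simp
  then have "p \<in> U" using b by (auto simp: base_def)
  then show d0: "0 \<le> depth p" using pD chart unfolding depth_def by auto
  obtain y where y: "y \<in> frontier D" "bd p = dist p y"
    using infdist_attains_inf[of "frontier D" p] D(2) by auto
  then show "\<exists>y\<in>frontier D. dist p y = bd p" by auto
  have "bd p \<le> bd z0 + dist p z0" by (rule infdist_triangle)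
  then show bd2: "bd p \<le> 2 * \<sigma>" using b dp by (simp add: base_def dist_commute)
  have "dist z0 y \<le> dist z0 p + dist p y" by (rule dist_triangle)
  then have yb: "y \<in> ball z0 \<delta>" using dp bd2 y \<sigma>_le \<sigma>_pos by simp
  then have gy: "snd y = g (fst y)" using frontier_on_graph[OF y(1)] b by (auto simp: base_def)
  have n1: "norm (fst p - fst y) \<le> dist p y" "\<bar>snd p - snd y\<bar> \<le> dist p y"
    using dist_fst_le[of p y] dist_snd_le[of p y] by (simp_all add: dist_norm)
  have "depth p = (g (fst p) - g (fst y)) + (snd y - snd p)" by (simp add: depth_def gy)
  also have "\<dots> \<le> G * norm (fst p - fst y) + \<bar>snd p - snd y\<bar>"
    using lipschitz[OF b, of p y] pU yb by auto
  also have "\<dots> \<le> G * dist p y + dist p y" using n1 G_nonneg by (intro add_mono mult_left_mono) auto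
  finally show dle: "depth p \<le> (1 + G) * bd p" by (simp add: y algebra_simps)
  also have "\<dots> \<le> (1 + G) * (2 * \<sigma>)" using bd2 G_nonneg by (intro mult_left_mono) auto
  also have "\<dots> = \<delta> / 8" using \<sigma>_G by simp
  finally show d8: "depth p \<le> \<delta> / 8" .
  define t where "t = (fst p, g (fst p))"
  have tp: "dist p t = depth p" using d0 by (simp add: t_def dist_prod_def depth_def dist_real_def)
  have "dist z0 t \<le> dist z0 p + dist p t" by (rule dist_triangle)
  then have "t \<in> ball z0 \<delta>" using tp d8 dp \<sigma>_le \<sigma>_pos \<delta> by simp
  then have "t \<notin> interior D" using b by (intro notin_interior) (auto simp: base_def t_def)
  then show "bd p \<le> depth p" using infdist_frontier_le[OF pD] tp by metis
qed

definition "Cd = (1 + G) * (2 + M * (real CARD('d))\<^sup>2 * sqrt \<delta>)"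

lemma Cd_nonneg: "0 \<le> Cd"
  unfolding Cd_def using G_nonneg M_nonneg \<delta> by simp

text \<open>With \<theta> the difference of the depths, q has to be closer to the boundary than p by
  \<theta>/(1 + G), up to an error. The segment from p to its nearest frontier point y is carried
  along the graph: y is moved by h along the graph, raised by \<theta>, and pulled back by the
  fraction \<mu> of y - p. The pull-back has length \<theta>/(1 + G) and loses at most \<theta> in
  height above the graph, so the resulting point z is still not interior. The error E is a second
  difference of g and therefore contains the factor \<open>bd p\<close>, on which the estimate for
  square roots depends.\<close>

lemma depth_diff_le:
  assumes b: "base z0" and p: "near z0 p" and q: "near z0 q" and le: "depth q \<le> depth p" and pos: "0 < bd p"
  shows "depth p - depth q \<le> (1 + G) * (bd p - bd q + M * (real CARD('d))\<^sup>2 * norm (fst p - fst q) * bd p)"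
proof -
  note np = near_facts[OF b p] and nq = near_facts[OF b q]
  define \<theta> where "\<theta> = depth p - depth q"
  define \<mu> where "\<mu> = \<theta> / (1 + G) / bd p"
  define h where "h = fst q - fst p"
  have \<theta>: "0 \<le> \<theta>" "\<theta> \<le> depth p" using le nq(1) by (auto simp: \<theta>_def)
  have G1: "1 + G > 0" using G_nonneg by simp
  have \<mu>bd: "\<mu> * bd p = \<theta> / (1 + G)" using pos by (simp add: \<mu>_def)
  have \<mu>0: "0 \<le> \<mu>" unfolding \<mu>_def using \<theta> G1 pos by simp
  have \<mu>1: "\<mu> \<le> 1"
  proof -
    have "\<theta> / (1 + G) \<le> bd p" using \<theta> np(3) G1 by (simp add: pos_divide_le_eq mult.commute)
    then show ?thesis unfolding \<mu>_def using pos by (subst pos_divide_le_eq) auto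
  qed
  obtain y where y: "y \<in> frontier D" "dist p y = bd p" using np(6) by blast
  have dp: "dist z0 p \<le> \<sigma>" "dist z0 q \<le> \<sigma>" using p q by (auto simp: near_def)
  have nh: "norm h \<le> 2 * \<sigma>"
  proof -
    have "norm h \<le> dist q p" using dist_fst_le[of q p] by (simp add: h_def dist_norm)
    also have "\<dots> \<le> dist z0 q + dist z0 p" by (metis dist_commute dist_triangle)
    finally show ?thesis using dp by simp
  qed
  have yz0: "dist z0 y \<le> 3 * \<sigma>" using dist_triangle[of z0 y p] dp y(2) np(4) by linarith
  then have yb: "y \<in> ball z0 \<delta>" using \<sigma>_le \<sigma>_pos by simp
  then have gy: "snd y = g (fst y)" using frontier_on_graph[OF y(1)] b by (auto simp: base_def)
  have n1: "norm (fst y - fst p) \<le> bd p" "\<bar>snd y - snd p\<bar> \<le> bd p"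
    using dist_fst_le[of p y] dist_snd_le[of p y] y(2) by (simp_all add: dist_norm norm_minus_commute)
  define y' where "y' = y + (h, 0)"
  have y'b: "y' \<in> ball z0 \<delta>"
  proof -
    have "dist z0 y' \<le> dist z0 y + dist y y'" by (rule dist_triangle)
    also have "dist y y' = norm h" by (simp add: y'_def dist_norm norm_Pair)
    finally show ?thesis using yz0 nh \<sigma>_le \<sigma>_pos by simp
  qed
  have gh: "\<bar>g (fst y + h) - g (fst y)\<bar> \<le> G * norm h"
  proof -
    have "fst y' \<in> fst ` ball z0 \<delta>" "fst y \<in> fst ` ball z0 \<delta>" using yb y'b by blast+
    from lipschitz[OF b this] show ?thesis by (simp add: y'_def)
  qed
  define z where "z = (fst y + h - \<mu> *\<^sub>R (fst y - fst p), g (fst y + h) + \<theta> - \<mu> * (snd y - snd p))"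
  have zb: "z \<in> ball z0 \<delta>"
  proof -
    have eq: "z - y = (h, 0) + (0, g (fst y + h) - g (fst y)) + (0, \<theta>) - \<mu> *\<^sub>R (y - p)"
      by (simp add: z_def gy prod_eq_iff algebra_simps)
    have "norm (z - y) \<le> norm (h, 0::real) + norm (0::real ^ 'd, g (fst y + h) - g (fst y)) + norm (0::real ^ 'd, \<theta>) + norm (\<mu> *\<^sub>R (y - p))"
      unfolding eq
      using norm_triangle_ineq4[of "(h, 0) + (0, g (fst y + h) - g (fst y)) + (0, \<theta>)" "\<mu> *\<^sub>R (y - p)"]
        norm_triangle_ineq[of "(h, 0) + (0, g (fst y + h) - g (fst y))" "(0, \<theta>)"]
        norm_triangle_ineq[of "(h, 0)" "(0, g (fst y + h) - g (fst y))"] by linarith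
    also have "\<dots> = norm h + \<bar>g (fst y + h) - g (fst y)\<bar> + \<theta> + \<mu> * bd p"
      using \<theta> \<mu>0 y(2) by (simp add: norm_Pair dist_norm norm_minus_commute)
    also have "\<dots> \<le> 2 * \<sigma> + G * (2 * \<sigma>) + \<delta> / 8 + 1 * (2 * \<sigma>)"
    proof (intro add_mono)
      show "\<bar>g (fst y + h) - g (fst y)\<bar> \<le> G * (2 * \<sigma>)" using gh mult_left_mono[OF nh G_nonneg] by linarith
      show "\<theta> \<le> \<delta> / 8" using \<theta> np(5) by linarith
      show "\<mu> * bd p \<le> 1 * (2 * \<sigma>)" using \<mu>0 \<mu>1 np(4) by (intro mult_mono) (auto simp: infdist_nonneg)
    qed (rule nh)
    also have "\<dots> = 2 * ((1 + G) * \<sigma>) + 2 * \<sigma> + \<delta> / 8" by (simp add: algebra_simps)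
    finally have "dist y z \<le> 2 * ((1 + G) * \<sigma>) + 2 * \<sigma> + \<delta> / 8" by (simp add: dist_norm norm_minus_commute)
    then show ?thesis using dist_triangle[of z0 z y] yz0 \<sigma>_G \<sigma>_le \<sigma>_pos \<delta> by simp
  qed
  have "g (fst z) \<le> snd z"
  proof -
    have "\<bar>g (fst z) - g (fst y')\<bar> \<le> G * norm (fst z - fst y')" using zb y'b by (intro lipschitz[OF b]) auto
    also have "fst z - fst y' = - (\<mu> *\<^sub>R (fst y - fst p))" by (simp add: z_def y'_def)
    also have "norm \<dots> = \<mu> * norm (fst y - fst p)" using \<mu>0 by simp
    also have "G * (\<mu> * norm (fst y - fst p)) \<le> G * (\<mu> * bd p)"
      using n1 \<mu>0 G_nonneg by (intro mult_left_mono) auto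
    finally have 1: "g (fst z) \<le> g (fst y + h) + G * (\<mu> * bd p)" by (simp add: y'_def)
    have "\<mu> * (snd y - snd p) \<le> \<mu> * bd p" using n1 \<mu>0 by (intro mult_left_mono) auto
    moreover have "G * (\<mu> * bd p) + \<mu> * bd p = \<theta>"
    proof -
      have "G * (\<mu> * bd p) + \<mu> * bd p = (1 + G) * (\<mu> * bd p)" by (simp add: algebra_simps)
      then show ?thesis unfolding \<mu>bd using G1 by simp
    qed
    ultimately show ?thesis using 1 by (simp add: z_def)
  qed
  then have zi: "z \<notin> interior D" using zb b by (intro notin_interior) (auto simp: base_def)
  define E where "E = (g (fst p + h) - g (fst p)) - (g (fst y + h) - g (fst y))"
  \<comment> \<open>The point q lies over \<open>fst p + h\<close>, at height \<theta> above p
    carried along the graph, so the terms with \<theta> cancel and only the change of shape E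
    remains.\<close>
  have "q - z = (1 - \<mu>) *\<^sub>R (p - y) + (0, E)"
    by (simp add: prod_eq_iff z_def E_def \<theta>_def depth_def h_def gy algebra_simps)
  then have "dist q z \<le> norm ((1 - \<mu>) *\<^sub>R (p - y)) + norm (0::real ^ 'd, E)"
    by (metis dist_norm norm_triangle_ineq)
  also have "\<dots> = (1 - \<mu>) * bd p + \<bar>E\<bar>" using \<mu>1 y(2) by (simp add: norm_Pair dist_norm)
  also have "\<bar>E\<bar> \<le> M * l1norm h * l1norm (fst p - fst y)" unfolding E_def by (rule increment_lipschitz)
  also have "\<dots> \<le> M * (real CARD('d) * norm h) * (real CARD('d) * bd p)"
  proof (intro mult_mono mult_left_mono l1norm_le M_nonneg)
    have "real CARD('d) * norm (fst p - fst y) \<le> real CARD('d) * bd p"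
      using n1 by (intro mult_left_mono) (auto simp: norm_minus_commute)
    then show "l1norm (fst p - fst y) \<le> real CARD('d) * bd p" using l1norm_le order.trans by blast
  qed (auto simp: l1norm_nonneg M_nonneg)
  finally have "bd q \<le> (1 - \<mu>) * bd p + M * (real CARD('d) * norm h) * (real CARD('d) * bd p)"
    using infdist_frontier_le[of q D z] zi q by (simp add: near_def)
  then have "\<theta> / (1 + G) \<le> bd p - bd q + M * (real CARD('d))\<^sup>2 * norm h * bd p"
    using \<mu>bd by (simp add: algebra_simps power2_eq_square)
  then have "\<theta> \<le> (1 + G) * (bd p - bd q + M * (real CARD('d))\<^sup>2 * norm h * bd p)"
    using G1 by (simp add: pos_divide_le_eq mult.commute)
  then show ?thesis by (simp add: \<theta>_def h_def norm_minus_commute)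
qed

text \<open>Let x be the root of the larger depth. The difference of depths is at least (x - y) x,
  and every term of its upper bound has a factor x as well: the difference of distances factors into
  roots that are at most x, and the error contains \<open>bd p\<close>, which is at most x times the
  root of \<delta>. Hence x can be cancelled.\<close>

lemma sqrt_depth_diff_le:
  assumes b: "base z0" and p: "near z0 p" and q: "near z0 q"
  shows "\<bar>sqrt (depth p) - sqrt (depth q)\<bar> \<le> Cd * rho D p q"
proof -
  have *: "sqrt (depth p) - sqrt (depth q) \<le> Cd * rho D p q"
    if p: "near z0 p" and q: "near z0 q" and le: "depth q \<le> depth p" for p q
  proof (cases "depth p = 0")
    case True
    then show ?thesis using le near_facts(1)[OF b q] Cd_nonneg by (simp add: rho_def)
  next
    case False
    note np = near_facts[OF b p] and nq = near_facts[OF b q]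
    have dp: "0 < depth p" using False np(1) by simp
    have bp: "0 < bd p"
      using np(3) dp G_nonneg infdist_nonneg[of p "frontier D"] by (metis antisym_conv3 less_le_trans mult_zero_right not_le order.asym)
    define x where "x = sqrt (depth p)"
    define y where "y = sqrt (depth q)"
    define d2 where "d2 = M * (real CARD('d))\<^sup>2"
    have d2: "0 \<le> d2" using M_nonneg by (simp add: d2_def)
    have x: "0 < x" "x\<^sup>2 = depth p" using dp by (simp_all add: x_def)
    have y: "0 \<le> y" "y\<^sup>2 = depth q" "y \<le> x" using nq(1) le by (simp_all add: x_def y_def)
    have "(x - y) * x \<le> (x - y) * (x + y)" using y by (intro mult_left_mono) auto
    also have "\<dots> = depth p - depth q" using x y by (simp add: algebra_simps power2_eq_square)
    also have "\<dots> \<le> (1 + G) * (bd p - bd q + d2 * norm (fst p - fst q) * bd p)"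
      unfolding d2_def by (rule depth_diff_le[OF b p q le bp])
    also have "\<dots> \<le> (1 + G) * (\<bar>sqrt (bd p) - sqrt (bd q)\<bar> * (2 * x) + d2 * norm (p - q) * (x * sqrt \<delta>))"
    proof (intro mult_left_mono add_mono mult_mono)
      have "bd p - bd q = (sqrt (bd p) - sqrt (bd q)) * (sqrt (bd p) + sqrt (bd q))"
        by (simp add: algebra_simps infdist_nonneg)
      also have "\<dots> \<le> \<bar>sqrt (bd p) - sqrt (bd q)\<bar> * (2 * x)"
      proof (intro mult_mono)
        have "sqrt (bd p) \<le> x" "sqrt (bd q) \<le> x"
          using np(2) nq(2) le by (simp_all add: x_def)
        then show "sqrt (bd p) + sqrt (bd q) \<le> 2 * x" by simp
      qed (auto simp: infdist_nonneg)
      finally show "bd p - bd q \<le> \<bar>sqrt (bd p) - sqrt (bd q)\<bar> * (2 * x)" .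
      show "norm (fst p - fst q) \<le> norm (p - q)" using dist_fst_le[of p q] by (simp add: dist_norm)
      have "x \<le> sqrt \<delta>" unfolding x_def using np(5) \<delta> by (intro real_sqrt_le_mono) simp
      then have "x * x \<le> x * sqrt \<delta>" using x by (intro mult_left_mono) auto
      then show "bd p \<le> x * sqrt \<delta>" using np(2) x(2) by (simp add: power2_eq_square)
    qed (use d2 G_nonneg in \<open>auto simp: infdist_nonneg\<close>)
    also have "\<dots> = ((1 + G) * (2 * \<bar>sqrt (bd p) - sqrt (bd q)\<bar> + d2 * sqrt \<delta> * norm (p - q))) * x"
      by (simp add: algebra_simps)
    finally have "x - y \<le> (1 + G) * (2 * \<bar>sqrt (bd p) - sqrt (bd q)\<bar> + d2 * sqrt \<delta> * norm (p - q))"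
      using x(1) by (rule mult_right_le_imp_le)
    also have "\<dots> \<le> (1 + G) * ((2 + d2 * sqrt \<delta>) * \<bar>sqrt (bd p) - sqrt (bd q)\<bar> + (2 + d2 * sqrt \<delta>) * norm (p - q))"
      using G_nonneg d2 \<delta> by (intro mult_left_mono add_mono mult_right_mono) auto
    also have "\<dots> = Cd * rho D p q" by (simp add: Cd_def d2_def rho_def algebra_simps)
    finally show ?thesis by (simp add: x_def y_def)
  qed
  show ?thesis
  proof (cases "depth q \<le> depth p")
    case True
    then have "sqrt (depth q) \<le> sqrt (depth p)" by simp
    then show ?thesis using *[OF p q True] by simp
  next
    case False
    then have "depth p \<le> depth q" by simp
    then have "sqrt (depth p) \<le> sqrt (depth q)" by simp
    then show ?thesis using *[OF q p] False by (simp add: rho_commute[of D q p])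
  qed
qed

end

section \<open>Oscillation estimate near the boundary\<close>

context graph_chart
begin

text \<open>The index type has d tangential coordinates and two more, the axes of the auxiliary
  plane, which are named by \<open>bool\<close>.\<close>

definition tang :: "('d + bool \<Rightarrow> real) \<Rightarrow> real ^ 'd" where
  "tang c = (\<chi> i. c (Inl i))"

definition vert :: "('d + bool \<Rightarrow> real) \<Rightarrow> real \<times> real" where
  "vert c = (c (Inr False), c (Inr True))"

definition param :: "real \<Rightarrow> real \<Rightarrow> ('d + bool \<Rightarrow> real) \<Rightarrow> (real ^ 'd) \<times> (real \<times> real) \<Rightarrow> (real ^ 'd) \<times> real" where
  "param M1 s c z = (fst z + tang c, g (fst z) + grad (fst z) (tang c) - M1 * (norm (tang c))\<^sup>2 + s - (norm (snd z + vert c))\<^sup>2)"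

definition proj :: "(real ^ 'd) \<times> (real \<times> real) \<Rightarrow> (real ^ 'd) \<times> real" where
  "proj z = (fst z, g (fst z) - (norm (snd z))\<^sup>2)"

text \<open>A tangential variable enters through a linear term and the square of the norm of
  \<open>tang c\<close>, a planar one only through the square of the norm of v + w, so each variable
  traces a parabola.\<close>

lemma slice_poly_param:
  assumes f: "quad_slice_poly n f"
  shows "slice_poly (2 * n) UNIV (\<lambda>c. f (param M1 s c z))"
  unfolding slice_poly_def
proof (intro allI ballI)
  fix c :: "'d + bool \<Rightarrow> real" and i :: "'d + bool"
  define c0 where "c0 = c(i := 0)"
  have "\<exists>Y Z. \<forall>t. param M1 s (c(i := t)) z = param M1 s c0 z + t *\<^sub>R Y + t\<^sup>2 *\<^sub>R Z"
  proof (cases i)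
    case (Inl k)
    have ta: "tang (c(i := t)) = tang c0 + t *\<^sub>R axis k 1" for t
      by (simp add: tang_def c0_def Inl vec_eq_iff axis_def)
    have ve: "vert (c(i := t)) = vert c0" for t by (simp add: vert_def c0_def Inl)
    have "tang c0 \<bullet> axis k 1 = 0" by (simp add: inner_axis tang_def c0_def Inl)
    then have no: "(norm (tang c0 + t *\<^sub>R axis k 1))\<^sup>2 = (norm (tang c0))\<^sup>2 + t\<^sup>2" for t
      by (simp only: power2_norm_eq_inner) (simp add: inner_add_left inner_add_right inner_commute inner_axis_axis power2_eq_square)
    have gr: "grad u (tang c0 + t *\<^sub>R axis k 1) = grad u (tang c0) + t * partial_deriv k g u" for u t
    proof -
      have "grad u (tang c0 + t *\<^sub>R axis k 1) = grad u (tang c0) + (\<Sum>j\<in>UNIV. t * axis k 1 $ j * partial_deriv j g u)"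
        by (simp add: sum.distrib[symmetric] algebra_simps)
      also have "(\<Sum>j\<in>UNIV. t * axis k 1 $ j * partial_deriv j g u) = (\<Sum>j\<in>UNIV. if j = k then t * partial_deriv k g u else 0)"
        by (intro sum.cong) (auto simp: axis_def)
      finally show ?thesis by simp
    qed
    show ?thesis
      by (rule exI[of _ "(axis k 1, partial_deriv k g (fst z))"], rule exI[of _ "(0, - M1)"])
        (simp only: param_def ta ve no gr prod_eq_iff fst_add snd_add fst_conv snd_conv fst_scaleR snd_scaleR, simp add: algebra_simps)
  next
    case (Inr b)
    have ta: "tang (c(i := t)) = tang c0" for t by (simp add: tang_def c0_def Inr)
    define e where "e = (if b then (0, 1) else (1, 0) :: real \<times> real)"
    have ve: "vert (c(i := t)) = vert c0 + t *\<^sub>R e" for t by (simp add: vert_def c0_def Inr e_def)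
    have ee: "e \<bullet> e = 1" by (simp add: e_def)
    have no: "(norm (x + t *\<^sub>R e))\<^sup>2 = (norm x)\<^sup>2 + t * (2 * (x \<bullet> e)) + t\<^sup>2" for t x
      by (simp only: power2_norm_eq_inner) (simp add: inner_add_left inner_add_right inner_commute ee power2_eq_square algebra_simps)
    have ve': "snd z + vert (c(i := t)) = (snd z + vert c0) + t *\<^sub>R e" for t by (simp add: ve)
    show ?thesis
      by (rule exI[of _ "(0, - (2 * ((snd z + vert c0) \<bullet> e)))"], rule exI[of _ "(0, - 1)"])
        (simp only: param_def ta ve' no prod_eq_iff fst_add snd_add fst_conv snd_conv fst_scaleR snd_scaleR, simp add: algebra_simps)
  qed
  then obtain Y Z where "\<And>t. param M1 s (c(i := t)) z = param M1 s c0 z + t *\<^sub>R Y + t\<^sup>2 *\<^sub>R Z" by blast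
  then show "\<exists>q. degree q \<le> 2 * n \<and> (\<forall>t. f (param M1 s (c(i := t)) z) = poly q t)"
    using f[unfolded quad_slice_poly_def, rule_format, of "param M1 s c0 z" Y Z] by simp
qed

section \<open>The nodes stay inside the domain\<close>

lemma norm_tang_le: "(\<And>i. \<bar>c i\<bar> \<le> r) \<Longrightarrow> norm (tang c) \<le> real CARD('d) * r"
proof -
  assume "\<And>i. \<bar>c i\<bar> \<le> r"
  then have "l1norm (tang c) \<le> real CARD('d) * r"
    unfolding l1norm_def tang_def using sum_bounded_above[of UNIV "\<lambda>i. \<bar>c (Inl i)\<bar>" r] by simp
  then show ?thesis using norm_le_l1norm order.trans by blast
qed

lemma norm_vert_le: "(\<And>i. \<bar>c i\<bar> \<le> r) \<Longrightarrow> norm (vert c) \<le> 2 * r"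
  unfolding vert_def using norm_Pair_le[of "c (Inr False)" "c (Inr True)"]
  by (smt (verit) real_norm_def)

lemma taylor_norm: "\<bar>g (u + h) - g u - grad u h\<bar> \<le> M * (real CARD('d))\<^sup>2 * (norm h)\<^sup>2"
proof -
  have "(l1norm h)\<^sup>2 \<le> (real CARD('d) * norm h)\<^sup>2" by (intro power_mono l1norm_le l1norm_nonneg)
  then have "M * (l1norm h)\<^sup>2 \<le> M * (real CARD('d) * norm h)\<^sup>2" using M_nonneg by (rule mult_left_mono)
  then show ?thesis using taylor[of u h] by (simp add: power_mult_distrib)
qed

text \<open>Half of M1 |h|^2 covers the Taylor error, since M1 exceeds twice its constant. The other
  half covers s, because the lower bound on the coordinates gives |h|^2 \<ge> r^2/(100 N^2), which
  is at least 2s. So the point is below the graph, and the last assumption keeps the total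
  displacement under \<delta>, inside the chart.\<close>

lemma param_mem:
  assumes b: "base (proj z)" and r: "0 < r" "r \<le> 1" and N: "0 < N"
    and c: "\<And>i. \<bar>c i\<bar> \<le> r" "\<And>i. r / (10 * N) \<le> \<bar>c i\<bar>"
    and M1: "M1 = 2 * M * (real CARD('d))\<^sup>2 + 1" and s: "0 \<le> s" "s \<le> r\<^sup>2 / (200 * N\<^sup>2)" "s \<le> r"
    and small: "r * (real CARD('d) + G * real CARD('d) + M1 * (real CARD('d))\<^sup>2 + 5 + 4 * sqrt \<delta>) < \<delta>"
  shows "param M1 s c z \<in> D"
proof -
  define u where "u = fst z"
  define v where "v = snd z"
  define h where "h = tang c"
  define w where "w = vert c"
  define d where "d = real CARD('d)"
  have M1': "1 \<le> M1" using M1 M_nonneg by simp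
  have near: "near (proj z) (proj z)" using b \<sigma>_pos by (simp add: near_def base_def)
  have dep: "depth (proj z) = (norm v)\<^sup>2" by (simp add: depth_def proj_def v_def)
  have "(norm v)\<^sup>2 \<le> \<delta>" using near_facts(5)[OF b near] dep \<delta> by simp
  then have nv: "norm v \<le> sqrt \<delta>" by (simp add: real_le_rsqrt)
  have nh: "norm h \<le> d * r" unfolding h_def d_def by (rule norm_tang_le) (rule c)
  have nw: "norm w \<le> 2 * r" unfolding w_def by (rule norm_vert_le) (rule c)
  have hlow: "r\<^sup>2 / (100 * N\<^sup>2) \<le> (norm h)\<^sup>2"
  proof -
    have "r / (10 * N) \<le> norm h"
      using c(2)[of "Inl undefined"] component_le_norm_cart[of h undefined] by (simp add: h_def tang_def)
    then have "(r / (10 * N))\<^sup>2 \<le> (norm h)\<^sup>2" using r N by (intro power_mono) auto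
    then show ?thesis by (simp add: power_divide power_mult_distrib)
  qed
  define Y where "Y = g u + grad u h - M1 * (norm h)\<^sup>2 + s - (norm (v + w))\<^sup>2"
  have P: "param M1 s c z = (u + h, Y)" by (simp add: param_def u_def v_def h_def w_def Y_def)
  have "Y \<le> g (u + h)"
  proof -
    have t: "g u + grad u h \<le> g (u + h) + M * d\<^sup>2 * (norm h)\<^sup>2" using taylor_norm[of u h] unfolding d_def by linarith
    have "s \<le> (norm h)\<^sup>2 / 2" using s(2) hlow by (simp add: field_simps)
    also have "\<dots> \<le> M1 * (norm h)\<^sup>2 / 2" using mult_right_mono[OF M1', of "(norm h)\<^sup>2"] by simp
    finally have "s \<le> M1 * (norm h)\<^sup>2 / 2" .
    moreover have "M * d\<^sup>2 * (norm h)\<^sup>2 \<le> M1 * (norm h)\<^sup>2 / 2"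
    proof -
      have "M * d\<^sup>2 \<le> M1 / 2" unfolding M1 d_def by simp
      then have "M * d\<^sup>2 * (norm h)\<^sup>2 \<le> M1 / 2 * (norm h)\<^sup>2" by (rule mult_right_mono) simp
      then show ?thesis by simp
    qed
    moreover have "0 \<le> (norm (v + w))\<^sup>2" by simp
    ultimately show ?thesis using t unfolding Y_def by linarith
  qed
  moreover have "param M1 s c z \<in> ball (proj z) \<delta>"
  proof -
    have "param M1 s c z - proj z = (h, 0) + (0, grad u h - M1 * (norm h)\<^sup>2 + s + ((norm v)\<^sup>2 - (norm (v + w))\<^sup>2))"
      by (simp add: P proj_def Y_def u_def v_def)
    then have "norm (param M1 s c z - proj z) \<le> norm h + \<bar>grad u h - M1 * (norm h)\<^sup>2 + s + ((norm v)\<^sup>2 - (norm (v + w))\<^sup>2)\<bar>"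
      using norm_triangle_ineq[of "(h, 0::real)" "(0, grad u h - M1 * (norm h)\<^sup>2 + s + ((norm v)\<^sup>2 - (norm (v + w))\<^sup>2))"]
      by (simp add: norm_Pair)
    also have "\<dots> \<le> norm h + (\<bar>grad u h\<bar> + M1 * (norm h)\<^sup>2 + s + \<bar>(norm v)\<^sup>2 - (norm (v + w))\<^sup>2\<bar>)"
    proof -
      have "0 \<le> M1 * (norm h)\<^sup>2" using M1' by simp
      then show ?thesis using s by linarith
    qed
    also have "\<dots> \<le> d * r + (G * (d * r) + M1 * (d\<^sup>2 * r) + r + (4 * sqrt \<delta> * r + 4 * r))"
    proof (intro add_mono nh s)
      have "norm u \<le> norm (proj z)" by (metis norm_fst_le prod.collapse fst_conv proj_def u_def)
      then have "norm u \<le> R + \<delta>" using b \<delta> by (simp add: base_def)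
      then have "\<bar>grad u h\<bar> \<le> G * norm h" unfolding G_def by (rule grad_bound)
      also have "\<dots> \<le> G * (d * r)" by (intro mult_left_mono nh G_nonneg)
      finally show "\<bar>grad u h\<bar> \<le> G * (d * r)" .
      have "(norm h)\<^sup>2 \<le> (d * r)\<^sup>2" using nh by (intro power_mono) auto
      also have "\<dots> = d\<^sup>2 * (r * r)" by (simp add: power2_eq_square)
      also have "\<dots> \<le> d\<^sup>2 * (r * 1)" using r by (intro mult_left_mono) auto
      finally show "M1 * (norm h)\<^sup>2 \<le> M1 * (d\<^sup>2 * r)" using M1' by (intro mult_left_mono) auto
      have "(norm (v + w))\<^sup>2 - (norm v)\<^sup>2 = 2 * (v \<bullet> w) + (norm w)\<^sup>2"
        by (simp add: power2_norm_eq_inner inner_add_left inner_add_right inner_commute)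
      then have "\<bar>(norm v)\<^sup>2 - (norm (v + w))\<^sup>2\<bar> \<le> 2 * (norm v * norm w) + (norm w)\<^sup>2"
        using Cauchy_Schwarz_ineq2[of v w] by (smt (verit) zero_le_power2)
      also have "\<dots> \<le> 2 * (sqrt \<delta> * (2 * r)) + (2 * r)\<^sup>2"
        using nv nw r \<delta> by (intro add_mono mult_left_mono mult_mono power_mono) auto
      also have "(2 * r)\<^sup>2 \<le> 4 * r" using r mult_left_mono[of r 1 r] by (simp add: power2_eq_square)
      finally show "\<bar>(norm v)\<^sup>2 - (norm (v + w))\<^sup>2\<bar> \<le> 4 * sqrt \<delta> * r + 4 * r" by simp
    qed
    also have "\<dots> = r * (d + G * d + M1 * d\<^sup>2 + 5 + 4 * sqrt \<delta>)" by (simp add: algebra_simps)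
    also have "\<dots> < \<delta>" using small unfolding d_def .
    finally show ?thesis by (simp add: dist_norm norm_minus_commute)
  qed
  ultimately have "param M1 s c z \<in> {z \<in> U. snd z \<le> g (fst z)}" using b P by (auto simp: base_def)
  then show ?thesis using chart by blast
qed

section \<open>Nearby points as parameter values\<close>

lemma direction_exists: "\<exists>e::real \<times> real. norm e = 1 \<and> v = norm v *\<^sub>R e"
proof (cases "v = 0")
  case True
  then show ?thesis by (intro exI[of _ "(1, 0)"]) (simp add: norm_Pair zero_prod_def)
next
  case False
  then show ?thesis by (intro exI[of _ "v /\<^sub>R norm v"]) simp
qed

text \<open>The square root is flatter further to the right.\<close>

lemma sqrt_shift_diff_le:
  fixes x y a :: real
  assumes "0 \<le> x" "0 \<le> y" "0 \<le> a"
  shows "\<bar>sqrt (x + a) - sqrt (y + a)\<bar> \<le> \<bar>sqrt x - sqrt y\<bar>"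
proof -
  have *: "sqrt (x + a) - sqrt (y + a) \<le> sqrt x - sqrt y" if "0 \<le> y" "y \<le> x" for x y
  proof -
    have "sqrt (x + a) + sqrt y \<le> sqrt x + sqrt (y + a)"
    proof (rule power2_le_imp_le)
      have "sqrt ((x + a) * y) \<le> sqrt (x * (y + a))"
        using that assms by (intro real_sqrt_le_mono) (simp add: algebra_simps mult_left_mono)
      then show "(sqrt (x + a) + sqrt y)\<^sup>2 \<le> (sqrt x + sqrt (y + a))\<^sup>2"
        using that assms by (simp add: power2_sum real_sqrt_mult)
    qed (use that assms in simp)
    then show ?thesis by simp
  qed
  show ?thesis
    using *[of x y] *[of y x] assms real_sqrt_le_mono[of x y] real_sqrt_le_mono[of y x]
      real_sqrt_le_mono[of "x + a" "y + a"] real_sqrt_le_mono[of "y + a" "x + a"]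
    by (cases "x \<le> y") auto
qed

text \<open>Without the shift \<open>s\<close>, points \<open>q\<close> above the paraboloid that touches the boundary would
  require a negative \<open>|v + w|\<^sup>2\<close>.\<close>

lemma target_exists:
  assumes b: "base (proj z)" and q: "q \<in> D" and rho: "rho D (proj z) q \<le> 2 * \<epsilon> / N"
    and e: "0 < \<epsilon>" "2 * \<epsilon> \<le> \<sigma>" "120 * M1 * \<epsilon> \<le> r" and N: "1 \<le> N" and r: "0 < r"
    and M1: "M1 = 2 * M * (real CARD('d))\<^sup>2 + 1" and s: "s = (r / (40 * N))\<^sup>2"
    and ed: "norm ed = 1" "snd z = norm (snd z) *\<^sub>R ed"
  shows "\<exists>\<tau>. param M1 s (case_sum (\<lambda>i. (fst q - fst z) $ i) (\<lambda>b. if b then snd (\<tau> *\<^sub>R ed) else fst (\<tau> *\<^sub>R ed))) z = q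
     \<and> \<bar>\<tau> - (sqrt ((norm (snd z))\<^sup>2 + s) - norm (snd z))\<bar> \<le> (3 + 2 * Cd) * \<epsilon> / N"
proof -
  define u where "u = fst z"
  define h where "h = fst q - u"
  define v where "v = snd z"
  have M1': "1 \<le> M1" using M1 M_nonneg by simp
  have near: "near (proj z) (proj z)" using b \<sigma>_pos by (simp add: near_def base_def)
  have dz: "depth (proj z) = (norm v)\<^sup>2" by (simp add: depth_def proj_def v_def)
  have dq: "dist (proj z) q \<le> 2 * \<epsilon> / N" using rho by (simp add: rho_def dist_norm)
  also have "\<dots> \<le> 2 * \<epsilon>" using N e by (simp add: divide_le_eq mult_le_cancel_left1)
  finally have nq: "near (proj z) q" using q e by (simp add: near_def)
  have nh: "norm h \<le> 2 * \<epsilon> / N"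
    using dq dist_fst_le[of q "proj z"] by (simp add: h_def u_def proj_def dist_norm dist_commute norm_minus_commute)
  have q0: "0 \<le> depth q" by (rule near_facts(1)[OF b nq])
  \<comment> \<open>E is the signed height of the paraboloid above the graph at u + h, and s1 is the
    value that |v + w|^2 must take for the parametrisation to hit q.\<close>
  define E where "E = - (g (u + h) - g u - grad u h) - M1 * (norm h)\<^sup>2"
  define s1 where "s1 = depth q + E + s"
  have E: "\<bar>E\<bar> \<le> 8 * M1 * (\<epsilon> / N)\<^sup>2"
  proof -
    have "\<bar>E\<bar> \<le> M * (real CARD('d))\<^sup>2 * (norm h)\<^sup>2 + M1 * (norm h)\<^sup>2"
    proof -
      have "0 \<le> M1 * (norm h)\<^sup>2" using M1' by simp
      then show ?thesis unfolding E_def using taylor_norm[of u h] by linarith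
    qed
    also have "\<dots> \<le> 2 * M1 * (norm h)\<^sup>2"
    proof -
      have "M * (real CARD('d))\<^sup>2 \<le> M1" unfolding M1 using M_nonneg by simp
      then have "M * (real CARD('d))\<^sup>2 * (norm h)\<^sup>2 \<le> M1 * (norm h)\<^sup>2" by (rule mult_right_mono) simp
      then show ?thesis by simp
    qed
    also have "\<dots> \<le> 2 * M1 * (2 * \<epsilon> / N)\<^sup>2" using nh M1' by (intro mult_left_mono power_mono) auto
    finally show ?thesis by (simp add: power_divide power_mult_distrib)
  qed
  have M1e: "M1 * \<epsilon> \<le> r / 120" using e(3) by simp
  have E2: "8 * M1 * (\<epsilon> / N)\<^sup>2 \<le> r / (15 * N) * (\<epsilon> / N)"
  proof -
    have "8 * M1 * (\<epsilon> / N)\<^sup>2 = 8 * (M1 * \<epsilon>) / N * (\<epsilon> / N)" by (simp add: power2_eq_square)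
    also have "\<dots> \<le> 8 * (r / 120) / N * (\<epsilon> / N)" using M1e N e by (intro mult_right_mono divide_right_mono) auto
    finally show ?thesis by simp
  qed
  have e120: "\<epsilon> \<le> r / 120"
  proof -
    have "1 * \<epsilon> \<le> M1 * \<epsilon>" using M1' e by (intro mult_right_mono) auto
    then show ?thesis using M1e by linarith
  qed
  \<comment> \<open>Here the factors 120 and 40 meet: E is at most r^2/(15 * 120 N^2), and s is
    r^2/(1600 N^2).\<close>
  have Es: "\<bar>E\<bar> \<le> s"
  proof -
    have "r / (15 * N) * (\<epsilon> / N) \<le> r / (15 * N) * ((r / 120) / N)"
      using e120 r N by (intro mult_left_mono divide_right_mono) auto
    also have "\<dots> \<le> s" using r N by (simp add: s power2_eq_square field_simps)
    finally show ?thesis using E E2 by linarith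
  qed
  have s1: "0 \<le> s1" using Es q0 by (simp add: s1_def)
  have s0: "0 \<le> s" using s by simp
  \<comment> \<open>The planar increment is taken in the direction of v, so that only lengths have
    to be compared.\<close>
  define \<tau> where "\<tau> = sqrt s1 - norm v"
  let ?c = "case_sum (\<lambda>i. (fst q - fst z) $ i) (\<lambda>b. if b then snd (\<tau> *\<^sub>R ed) else fst (\<tau> *\<^sub>R ed))"
  have ta: "tang ?c = h" by (simp add: tang_def h_def u_def vec_eq_iff)
  have ve: "vert ?c = \<tau> *\<^sub>R ed" by (simp add: vert_def prod_eq_iff)
  have "v + \<tau> *\<^sub>R ed = sqrt s1 *\<^sub>R ed"
    using ed(2) unfolding v_def[symmetric] \<tau>_def by (metis add.commute diff_add_cancel scaleR_left.add)
  then have nv: "(norm (v + \<tau> *\<^sub>R ed))\<^sup>2 = s1" using ed(1) s1 by (simp add: abs_of_nonneg)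
  have "param M1 s ?c z = q"
    unfolding param_def ta ve unfolding u_def[symmetric] v_def[symmetric] nv
    by (simp add: prod_eq_iff s1_def E_def depth_def h_def)
  moreover have "\<bar>\<tau> - (sqrt ((norm (snd z))\<^sup>2 + s) - norm (snd z))\<bar> \<le> (3 + 2 * Cd) * \<epsilon> / N"
  proof -
    \<comment> \<open>Here s acts as a lower bound: the sum of the two roots is at least r/(40 N),
      which turns E, of order \<epsilon>/N^2, into a difference of roots of order
      \<epsilon>/N.\<close>
    have 1: "\<bar>sqrt s1 - sqrt (depth q + s)\<bar> \<le> 3 * \<epsilon> / N"
    proof -
      define a where "a = r / (40 * N)"
      have a: "0 < a" "s = a\<^sup>2" using r N by (simp_all add: a_def s)
      have "a \<le> sqrt (depth q + s)" using a q0 by (intro real_le_rsqrt) simp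
      then have "\<bar>sqrt s1 - sqrt (depth q + s)\<bar> * a \<le> \<bar>sqrt s1 - sqrt (depth q + s)\<bar> * (sqrt s1 + sqrt (depth q + s))"
        using s1 by (intro mult_left_mono add_increasing) auto
      also have "\<dots> = \<bar>(sqrt s1 - sqrt (depth q + s)) * (sqrt s1 + sqrt (depth q + s))\<bar>"
        using s1 q0 s0 by (simp add: abs_mult)
      also have "\<dots> = \<bar>E\<bar>" using s1 q0 s0 by (simp add: algebra_simps s1_def)
      also have "\<dots> \<le> r / (15 * N) * (\<epsilon> / N)" using E E2 by linarith
      also have "\<dots> \<le> (3 * \<epsilon> / N) * a" using r N e by (simp add: a_def field_simps)
      finally show ?thesis using a(1) by (rule mult_right_le_imp_le)
    qed
    have 2: "\<bar>sqrt (depth q + s) - sqrt ((norm v)\<^sup>2 + s)\<bar> \<le> 2 * Cd * \<epsilon> / N"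
    proof -
      have "\<bar>sqrt (depth q + s) - sqrt ((norm v)\<^sup>2 + s)\<bar> \<le> \<bar>sqrt (depth q) - sqrt (depth (proj z))\<bar>"
        using q0 s0 sqrt_shift_diff_le[of "depth q" "(norm v)\<^sup>2" s] by (simp add: dz)
      also have "\<dots> \<le> Cd * rho D (proj z) q"
        using sqrt_depth_diff_le[OF b near nq] by (simp add: abs_minus_commute)
      also have "\<dots> \<le> Cd * (2 * \<epsilon> / N)" using rho Cd_nonneg by (rule mult_left_mono)
      finally show ?thesis by (simp add: mult_ac)
    qed
    have "(3 + 2 * Cd) * \<epsilon> / N = 3 * \<epsilon> / N + 2 * Cd * \<epsilon> / N" by (simp add: algebra_simps add_divide_distrib)
    then show ?thesis using 1 2 unfolding v_def \<tau>_def by linarith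
  qed
  ultimately show ?thesis by blast
qed

text \<open>The number r keeps the nodes within the chart. The three entries of e0 make the points q
  \<open>near\<close>, keep the height E below s, and keep \<tau> within r/(40 n) of its reference
  value t0. All constants are independent of n and X.\<close>

lemma osc_bound_chart:
  "\<exists>C\<ge>0. \<exists>e0>0. \<forall>n\<ge>1. \<forall>X\<in>sets borel. (\<forall>x\<in>X. base x) \<longrightarrow> osc_bound n D X C e0"
proof -
  define d where "d = real CARD('d)"
  define M1 where "M1 = 2 * M * (real CARD('d))\<^sup>2 + 1"
  define L where "L = real CARD('d) + G * real CARD('d) + M1 * (real CARD('d))\<^sup>2 + 5 + 4 * sqrt \<delta>"
  define r where "r = min 1 (\<delta> / (2 * L))"
  have d: "0 \<le> d" by (simp add: d_def)
  have M1: "1 \<le> M1" using M_nonneg by (simp add: M1_def)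
  have L: "0 < L" unfolding L_def using G_nonneg M1 \<delta> by (intro add_nonneg_pos add_pos_nonneg) auto
  have r: "0 < r" "r \<le> 1" using L \<delta> by (auto simp: r_def)
  have rL: "r * L < \<delta>"
  proof -
    have "r * L \<le> \<delta> / (2 * L) * L" using L by (intro mult_right_mono) (auto simp: r_def)
    also have "\<dots> < \<delta>" using L \<delta> by simp
    finally show ?thesis .
  qed
  define e0 where "e0 = min (\<sigma> / 2) (min (r / (120 * M1)) (r / (40 * (3 + 2 * Cd))))"
  have e0: "0 < e0" using \<sigma>_pos r M1 Cd_nonneg by (simp add: e0_def)
  define C0 where "C0 = 600 ^ CARD('d + bool) * (10 / r) * (2 * d + 4 * (3 + 2 * Cd))"
  have C0: "0 \<le> C0" unfolding C0_def using r d Cd_nonneg by (intro mult_nonneg_nonneg) auto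
  have "osc_bound n D X (2 * C0) e0" if n: "n \<ge> 1" and X: "X \<in> sets borel" "\<forall>x\<in>X. base x" for n X
  proof -
    define m where "m = 4 * (2 * n) + 2"
    have m: "real m \<le> 10 * real n" "0 < real m" "1 \<le> real n" "0 < real n" using n by (simp_all add: m_def)
    define s where "s = (r / (40 * real n))\<^sup>2"
    obtain K :: "('d + bool \<Rightarrow> nat) set" and \<alpha> :: "('d + bool \<Rightarrow> nat) \<Rightarrow> real" and \<nu> where
      K: "finite K" "\<And>k. k \<in> K \<Longrightarrow> 0 \<le> \<alpha> k" "(\<Sum>k\<in>K. \<alpha> k) = 1"
      and \<nu>: "\<And>k i. k \<in> K \<Longrightarrow> i \<in> UNIV \<Longrightarrow> r / real m \<le> \<bar>\<nu> k i\<bar> \<and> \<bar>\<nu> k i\<bar> \<le> r"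
      and ker: "\<And>P c c'. slice_poly (2 * n) UNIV P \<Longrightarrow> (\<And>i::'d + bool. i \<in> UNIV \<Longrightarrow> \<bar>c i\<bar> \<le> r / (2 * real m)) \<Longrightarrow> (\<And>i. i \<in> UNIV \<Longrightarrow> \<bar>c' i\<bar> \<le> r / (2 * real m))
       \<Longrightarrow> (\<And>i. i \<notin> UNIV \<Longrightarrow> c i = 0) \<Longrightarrow> (\<And>i. i \<notin> UNIV \<Longrightarrow> c' i = 0)
       \<Longrightarrow> \<bar>P c - P c'\<bar> \<le> 600 ^ CARD('d + bool) * (real m / r) * (\<Sum>i\<in>UNIV. \<bar>c i - c' i\<bar>) * (\<Sum>k\<in>K. \<alpha> k * \<bar>P (\<nu> k)\<bar>)"
      by (rule tensor_kernel[where I = "UNIV :: ('d + bool) set" and m = m and N = "2 * n" and r = r])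
        (use r m_def n in auto)
    have mr: "r / (10 * real n) \<le> r / real m" "r / (20 * real n) \<le> r / (2 * real m)"
      using m r by (auto intro!: divide_left_mono)
    have s: "0 \<le> s" "s \<le> r\<^sup>2 / (200 * (real n)\<^sup>2)" "s \<le> r"
    proof -
      show "0 \<le> s" by (simp add: s_def)
      have eq: "s = r\<^sup>2 / (1600 * (real n)\<^sup>2)" by (simp add: s_def power_divide power_mult_distrib)
      show "s \<le> r\<^sup>2 / (200 * (real n)\<^sup>2)" unfolding eq using m by (intro divide_left_mono) auto
      have "(1::real) \<le> (real n)\<^sup>2" using m by simp
      then have "s \<le> r\<^sup>2 / 1" unfolding eq by (intro divide_left_mono) (use m in \<open>linarith | simp\<close>)+
      also have "\<dots> \<le> r" using r by (simp add: power2_eq_square mult_le_cancel_left1)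
      finally show "s \<le> r" .
    qed
    have gm [measurable]: "g \<in> borel_measurable borel" by (intro borel_measurable_continuous_onI continuous_g)
    have [measurable]: "partial_deriv i g \<in> borel_measurable borel" for i by (intro borel_measurable_continuous_onI continuous_partial)
    have pm [measurable]: "proj \<in> borel_measurable borel"
      unfolding proj_def
      by (intro borel_measurable_continuous_onI continuous_intros continuous_on_compose2[OF continuous_g]) auto
    have parm [measurable]: "param M1 s c \<in> borel_measurable borel" for c
      unfolding param_def
      by (intro borel_measurable_continuous_onI continuous_intros continuous_on_compose2[OF continuous_g]
          continuous_on_compose2[OF continuous_partial]) auto
    have XD: "X \<subseteq> D" "X \<subseteq> U" using X(2) \<delta> by (force simp: base_def)+
    show ?thesis
    proof (rule osc_bound_lift[where M = "lborel :: ((real ^ 'd) \<times> (real \<times> real)) measure" and \<pi> = proj and \<Phi> = "\<lambda>k. param M1 s (\<nu> k)" and c = "ennreal pi" and K = K and \<alpha> = \<alpha>])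
      show "param M1 s (\<nu> k) \<in> lborel \<rightarrow>\<^sub>M borel" for k
        using parm by simp
      show "D \<in> sets borel" using D by simp
      show "(\<integral>\<^sup>+z. G (proj z) \<partial>lborel) = ennreal pi * (\<integral>\<^sup>+x. G x \<partial>lborel)"
        if [measurable]: "G \<in> borel_measurable borel" and G: "\<And>x. x \<notin> X \<Longrightarrow> G x = 0" for G :: "(real ^ 'd) \<times> real \<Rightarrow> ennreal"
      proof -
        have "(\<integral>\<^sup>+z. G (proj z) \<partial>lborel) = ennreal pi * (\<integral>\<^sup>+z. G (fst z + 0, snd z) * indicator {z. snd z \<le> g (fst z)} z \<partial>lborel)"
          using nn_integral_subgraph_lift[OF that(1) gm, of 0 0] by (simp add: proj_def)
        also have "(\<integral>\<^sup>+z. G (fst z + 0, snd z) * indicator {z. snd z \<le> g (fst z)} z \<partial>lborel) = (\<integral>\<^sup>+x. G x \<partial>lborel)"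
          using G XD chart by (intro nn_integral_cong) (force simp: indicator_def)
        finally show ?thesis .
      qed
      show "(\<integral>\<^sup>+z. G (param M1 s (\<nu> k) z) \<partial>lborel) \<le> ennreal pi * (\<integral>\<^sup>+x. G x \<partial>lborel)"
        if [measurable]: "G \<in> borel_measurable borel" for k and G :: "(real ^ 'd) \<times> real \<Rightarrow> ennreal"
        unfolding param_def
        by (rule nn_integral_subgraph_lift_le[where b = "\<lambda>u. g u + grad u (tang (\<nu> k)) - M1 * (norm (tang (\<nu> k)))\<^sup>2 + s"]) measurable
      show "param M1 s (\<nu> k) z \<in> D" if "k \<in> K" "proj z \<in> X" for k z
      proof (rule param_mem[OF _ r m(4) _ _ M1_def s])
        show "base (proj z)" using X that by blast
        show "\<bar>\<nu> k i\<bar> \<le> r" "r / (10 * real n) \<le> \<bar>\<nu> k i\<bar>" for i using \<nu>[OF that(1), of i] mr by auto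
        show "r * (real CARD('d) + G * real CARD('d) + M1 * (real CARD('d))\<^sup>2 + 5 + 4 * sqrt \<delta>) < \<delta>"
          using rL by (simp add: L_def)
      qed
      show "\<exists>z\<in>space lborel. proj z = x" if "x \<in> X" for x
      proof -
        have "0 \<le> g (fst x) - snd x" using that XD chart by auto
        then show ?thesis by (intro bexI[of _ "(fst x, (sqrt (g (fst x) - snd x), 0))"]) (auto simp: proj_def norm_Pair)
      qed
    next
      fix \<epsilon> :: real and f :: "(real ^ 'd) \<times> real \<Rightarrow> real" and z :: "(real ^ 'd) \<times> (real \<times> real)" and q
      assume e: "0 < \<epsilon>" "\<epsilon> < e0" and f: "quad_slice_poly n f" and z: "proj z \<in> X" and q: "q \<in> D" and rho: "rho D (proj z) q \<le> 2 * \<epsilon> / real n"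
      define N where "N = real n"
      have N: "1 \<le> N" using m by (simp add: N_def)
      have b: "base (proj z)" using X z by blast
      have e': "2 * \<epsilon> \<le> \<sigma>" "120 * M1 * \<epsilon> \<le> r" "40 * (3 + 2 * Cd) * \<epsilon> \<le> r"
      proof -
        show "2 * \<epsilon> \<le> \<sigma>" using e by (simp add: e0_def)
        have "\<epsilon> \<le> r / (120 * M1)" using e by (simp add: e0_def)
        then show "120 * M1 * \<epsilon> \<le> r" using M1 by (simp add: field_simps)
        have "\<epsilon> \<le> r / (40 * (3 + 2 * Cd))" using e by (simp add: e0_def)
        then have "\<epsilon> * (40 * (3 + 2 * Cd)) \<le> r" using Cd_nonneg by (subst (asm) pos_le_divide_eq) auto
        then show "40 * (3 + 2 * Cd) * \<epsilon> \<le> r" by (simp add: mult.commute)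
      qed
      obtain ed where ed: "norm ed = 1" "snd z = norm (snd z) *\<^sub>R ed" using direction_exists by blast
      have rho': "rho D (proj z) q \<le> 2 * \<epsilon> / N" using rho by (simp add: N_def)
      have sN: "s = (r / (40 * N))\<^sup>2" by (simp add: s_def N_def)
      have pzD: "proj z \<in> D" using XD z by blast
      have rho0: "rho D (proj z) (proj z) \<le> 2 * \<epsilon> / N" using e N by (simp add: rho_def)
      define cc where "cc x \<tau> = case_sum (\<lambda>i. (fst x - fst z) $ i) (\<lambda>b. if b then snd (\<tau> *\<^sub>R ed) else fst (\<tau> *\<^sub>R ed))" for x :: "(real ^ 'd) \<times> real" and \<tau> :: real
      \<comment> \<open>Because of the shift, the parameter 0 yields the point at height s above
        \<open>proj z\<close>; the planar increment t0 in the direction of v compensates for it.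
        Thus \<open>proj z\<close> and q are both values of one parametrisation, and the kernel
        estimate compares them directly.\<close>
      define t0 where "t0 = sqrt ((norm (snd z))\<^sup>2 + s) - norm (snd z)"
      obtain \<tau> where \<tau>: "param M1 s (cc q \<tau>) z = q" "\<bar>\<tau> - t0\<bar> \<le> (3 + 2 * Cd) * \<epsilon> / N"
        using target_exists[OF b q rho' e(1) e'(1,2) N r(1) M1_def sN ed] unfolding cc_def t0_def by blast
      have p0: "param M1 s (cc (proj z) t0) z = proj z"
      proof -
        have "tang (cc (proj z) t0) = 0" by (simp add: tang_def cc_def proj_def vec_eq_iff)
        moreover have "snd z + vert (cc (proj z) t0) = sqrt ((norm (snd z))\<^sup>2 + s) *\<^sub>R ed"
        proof -
          have "vert (cc (proj z) t0) = t0 *\<^sub>R ed" by (simp add: vert_def cc_def prod_eq_iff)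
          then show ?thesis using ed(2) unfolding t0_def by (metis add.commute diff_add_cancel scaleR_left.add)
        qed
        ultimately show ?thesis using ed(1) s(1) by (simp add: param_def proj_def)
      qed
      have ee: "\<epsilon> \<le> r / 120"
      proof -
        have "1 * \<epsilon> \<le> M1 * \<epsilon>" using M1 e by (intro mult_right_mono) auto
        then show ?thesis using e'(2) by linarith
      qed
      have t0: "\<bar>t0\<bar> \<le> r / (40 * N)"
      proof -
        have "0 \<le> t0" unfolding t0_def using s(1) by (simp add: real_le_rsqrt)
        moreover have "sqrt ((norm (snd z))\<^sup>2 + s) \<le> norm (snd z) + r / (40 * N)"
          using sqrt_add_le_add_sqrt[of "(norm (snd z))\<^sup>2" s] s(1) r N by (simp add: sN)
        ultimately show ?thesis by (simp add: t0_def)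
      qed
      have \<tau>1: "\<bar>\<tau>\<bar> \<le> r / (20 * N)"
      proof -
        have "40 * ((3 + 2 * Cd) * \<epsilon>) \<le> r" using e'(3) by (simp only: mult.assoc)
        then have "(3 + 2 * Cd) * \<epsilon> \<le> r / 40" by linarith
        then have "(3 + 2 * Cd) * \<epsilon> / N \<le> (r / 40) / N" using N by (intro divide_right_mono) auto
        then have "\<bar>\<tau>\<bar> \<le> r / (40 * N) + r / (40 * N)" using \<tau>(2) t0 by simp
        then show ?thesis by simp
      qed
      have ed1: "\<bar>fst ed\<bar> \<le> 1" "\<bar>snd ed\<bar> \<le> 1"
        using ed(1) norm_fst_le[of "fst ed" "snd ed"] norm_snd_le[of "snd ed" "fst ed"] by simp_all
      have edt: "\<bar>fst (t *\<^sub>R ed)\<bar> \<le> \<bar>t\<bar>" "\<bar>snd (t *\<^sub>R ed)\<bar> \<le> \<bar>t\<bar>" for t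
        using ed1 by (simp_all add: abs_mult mult_left_le)
      have hq: "norm (fst q - fst z) \<le> 2 * \<epsilon> / N"
      proof -
        have "norm (fst q - fst z) \<le> dist q (proj z)" using dist_fst_le[of q "proj z"] by (simp add: proj_def dist_norm)
        also have "\<dots> \<le> 2 * \<epsilon> / N" using rho' by (simp add: rho_def dist_norm norm_minus_commute)
        finally show ?thesis .
      qed
      have small: "\<bar>cc q \<tau> i\<bar> \<le> r / (2 * real m)" "\<bar>cc (proj z) t0 i\<bar> \<le> r / (2 * real m)" for i
      proof -
        have h: "2 * \<epsilon> / N \<le> r / (20 * N)"
        proof -
          have "2 * \<epsilon> / N \<le> (r / 20) / N" using ee r N by (intro divide_right_mono) auto
          then show ?thesis by simp
        qed
        have h2: "\<bar>(fst q - fst z) $ k\<bar> \<le> r / (20 * N)" for k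
          using component_le_norm_cart[of "fst q - fst z" k] hq h by linarith
        have h3: "r / (40 * N) \<le> r / (20 * N)" using r N by (intro divide_left_mono) auto
        have 1: "\<bar>cc q \<tau> i\<bar> \<le> r / (20 * N)"
          using h2 \<tau>1 edt[of \<tau>] by (auto simp: cc_def split: sum.split simp del: vector_minus_component intro: order.trans)
        have 2: "\<bar>cc (proj z) t0 i\<bar> \<le> r / (20 * N)"
          using t0 h3 r N edt[of t0] by (auto simp: cc_def proj_def split: sum.split intro: order.trans)
        show "\<bar>cc q \<tau> i\<bar> \<le> r / (2 * real m)" "\<bar>cc (proj z) t0 i\<bar> \<le> r / (2 * real m)"
          using 1 2 mr(2) by (auto simp: N_def)
      qed
      have dsum: "(\<Sum>i\<in>UNIV. \<bar>cc (proj z) t0 i - cc q \<tau> i\<bar>) \<le> (2 * d + 2 * (3 + 2 * Cd)) * \<epsilon> / N"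
      proof -
        have "(\<Sum>i\<in>UNIV. \<bar>cc (proj z) t0 i - cc q \<tau> i\<bar>)
           = (\<Sum>k\<in>UNIV. \<bar>cc (proj z) t0 (Inl k) - cc q \<tau> (Inl k)\<bar>) + (\<Sum>b\<in>UNIV. \<bar>cc (proj z) t0 (Inr b) - cc q \<tau> (Inr b)\<bar>)"
          by (simp add: UNIV_Plus_UNIV[symmetric] sum.Plus del: UNIV_Plus_UNIV)
        also have "(\<Sum>k\<in>UNIV. \<bar>cc (proj z) t0 (Inl k) - cc q \<tau> (Inl k)\<bar>) = l1norm (fst q - fst z)"
          by (simp add: cc_def proj_def l1norm_def abs_minus_commute)
        also have "l1norm (fst q - fst z) \<le> d * (2 * \<epsilon> / N)"
          unfolding d_def by (rule order.trans[OF l1norm_le]) (intro mult_left_mono hq, simp)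
        also have "(\<Sum>b\<in>UNIV. \<bar>cc (proj z) t0 (Inr b) - cc q \<tau> (Inr b)\<bar>) \<le> 2 * ((3 + 2 * Cd) * \<epsilon> / N)"
        proof -
          have B: "\<bar>cc (proj z) t0 (Inr b) - cc q \<tau> (Inr b)\<bar> \<le> (3 + 2 * Cd) * \<epsilon> / N" for b
          proof -
            have "\<bar>cc (proj z) t0 (Inr b) - cc q \<tau> (Inr b)\<bar> = \<bar>if b then snd ((t0 - \<tau>) *\<^sub>R ed) else fst ((t0 - \<tau>) *\<^sub>R ed)\<bar>"
              by (simp add: cc_def left_diff_distrib)
            also have "\<dots> \<le> \<bar>t0 - \<tau>\<bar>" using edt[of "t0 - \<tau>"] by (auto simp del: fst_scaleR snd_scaleR)
            finally show ?thesis using \<tau>(2) by simp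
          qed
          have "(\<Sum>b\<in>UNIV. \<bar>cc (proj z) t0 (Inr b) - cc q \<tau> (Inr b)\<bar>)
             = \<bar>cc (proj z) t0 (Inr False) - cc q \<tau> (Inr False)\<bar> + \<bar>cc (proj z) t0 (Inr True) - cc q \<tau> (Inr True)\<bar>"
            by (simp add: UNIV_bool)
          then show ?thesis using B[of False] B[of True] by linarith
        qed
        finally show ?thesis by (simp add: algebra_simps add_divide_distrib)
      qed
      let ?P = "\<lambda>c. f (param M1 s c z)"
      let ?S = "\<Sum>k\<in>K. \<alpha> k * \<bar>f (param M1 s (\<nu> k) z)\<bar>"
      have S0: "0 \<le> ?S" using K by (intro sum_nonneg) auto
      have "\<bar>?P (cc (proj z) t0) - ?P (cc q \<tau>)\<bar> \<le> 600 ^ CARD('d + bool) * (real m / r) * (\<Sum>i\<in>UNIV. \<bar>cc (proj z) t0 i - cc q \<tau> i\<bar>) * ?S"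
        by (rule ker[OF slice_poly_param[OF f]]) (auto intro: small)
      also have "\<dots> \<le> 600 ^ CARD('d + bool) * (10 * N / r) * ((2 * d + 2 * (3 + 2 * Cd)) * \<epsilon> / N) * ?S"
        using m r S0 dsum by (intro mult_right_mono mult_mono mult_left_mono divide_right_mono) (auto simp: N_def intro!: sum_nonneg)
      also have "600 ^ CARD('d + bool) * (10 * N / r) * ((2 * d + 2 * (3 + 2 * Cd)) * \<epsilon> / N)
         = 600 ^ CARD('d + bool) * (10 / r) * (2 * d + 2 * (3 + 2 * Cd)) * \<epsilon>"
        using N by simp
      also have "\<dots> \<le> C0 * \<epsilon>" unfolding C0_def using r d e Cd_nonneg by (intro mult_right_mono mult_left_mono) auto
      finally show "\<bar>f (proj z) - f q\<bar> \<le> C0 * \<epsilon> * ?S" using S0 unfolding \<tau>(1) p0 by (simp add: mult_right_mono)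
    qed (use K X C0 in auto)
  qed
  then show ?thesis using C0 e0 by (intro exI[of _ "2 * C0"] conjI exI[of _ e0]) auto
qed

end

section \<open>Oscillation estimate on a C2-domain\<close>

lemma osc_bound_mono:
  assumes ob: "osc_bound n \<Omega> X C e0" and C: "0 \<le> C" "C \<le> C'" and e: "e0' \<le> e0"
  shows "osc_bound n \<Omega> X C' e0'"
  unfolding osc_bound_def
proof (intro allI impI conjI ballI)
  fix \<epsilon> :: real and f S x \<eta>
  assume "0 < \<epsilon>" "\<epsilon> < e0'" "quad_slice_poly n f" "f \<in> borel_measurable borel" and S: "\<forall>x\<in>\<Omega>. \<bar>f x\<bar> \<le> S"
    and "x \<in> X" "\<eta> \<in> \<Omega>" "rho \<Omega> x \<eta> \<le> 2 * \<epsilon> / real n"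
  then have "\<bar>f x - f \<eta>\<bar> \<le> C * \<epsilon> * S" using e by (intro osc_bound_sup[OF ob]) auto
  also have "0 \<le> S" using S \<open>\<eta> \<in> \<Omega>\<close> abs_ge_zero order.trans by blast
  then have "C * \<epsilon> * S \<le> C' * \<epsilon> * S" using C \<open>0 < \<epsilon>\<close> by (intro mult_right_mono) auto
  finally show "\<bar>f x - f \<eta>\<bar> \<le> C' * \<epsilon> * S" .
next
  fix \<epsilon> p :: real and f w :: "'a \<Rightarrow> real"
  assume a: "0 < \<epsilon>" "\<epsilon> < e0'" "quad_slice_poly n f" "f \<in> borel_measurable borel" "1 \<le> p" "w \<in> borel_measurable borel"
    "\<forall>x. 0 \<le> w x" "\<forall>x. x \<notin> X \<longrightarrow> w x = 0"
    "\<forall>x\<in>X. osc_ge n \<Omega> \<epsilon> f x (w x)"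
  let ?I = "power_mass \<Omega> p f"
  have e': "\<epsilon> < e0" using a e by simp
  have "(\<integral>\<^sup>+x. ennreal (w x powr p) \<partial>lborel) \<le> ennreal ((C * \<epsilon>) powr p) * ?I"
    using a by (intro osc_bound_powr[OF ob a(1) e' a(3-6)]) blast+
  also have "\<dots> \<le> ennreal ((C' * \<epsilon>) powr p) * ?I"
    using a C by (intro mult_right_mono ennreal_leI powr_mono2) auto
  finally show "(\<integral>\<^sup>+x. ennreal (w x powr p) \<partial>lborel) \<le> ennreal ((C' * \<epsilon>) powr p) * ?I" .
qed

text \<open>The domain is split into the points far from the boundary and, for each chart, the
  points of a boundary layer that lie deep in that chart. There are finitely many pieces, so the
  extreme constants serve all of them; the pieces may overlap.\<close>

lemma C2_domain_osc_bound:
  fixes \<Omega> :: "((real ^ 'd) \<times> real) set"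
  assumes \<Omega>: "closed \<Omega>" "\<Omega> \<noteq> {}" and C2: "C2_domain \<Omega>"
  shows "\<exists>C\<ge>0. \<exists>e0>0. \<exists>\<X>. finite \<X> \<and> \<Union>\<X> = \<Omega> \<and> \<X> \<subseteq> sets borel \<and> (\<forall>n\<ge>1. \<forall>X\<in>\<X>. osc_bound n \<Omega> X C e0)"
proof -
  from C2 have bdd: "bounded \<Omega>" by (simp add: C2_domain_def)
  obtain \<delta> M and J :: nat and U where \<delta>: "0 < \<delta>" and M: "0 < M" and U: "\<forall>j<J. open (U j) \<and> connected (U j)"
    and cov: "\<forall>x\<in>\<Omega>. infdist x (frontier \<Omega>) < \<delta> \<longrightarrow> (\<exists>j<J. x \<in> U j \<and> infdist x (frontier (U j)) > \<delta>)"
    and ch: "\<forall>j<J. \<exists>a (A :: (real ^ 'd) \<times> real \<Rightarrow> (real ^ 'd) \<times> real) f.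
           orthogonal_transformation A \<and> C2_fun f \<and>
           (\<forall>i k x. \<bar>partial_deriv i (partial_deriv k f) x\<bar> \<le> M) \<and>
           \<Omega> \<inter> U j = {x \<in> U j. snd (A (x - a)) \<le> f (fst (A (x - a)))}"
    using C2 unfolding C2_domain_def by blast
  have "\<Omega> \<noteq> UNIV" using bdd by auto
  then have fr: "frontier \<Omega> \<noteq> {}" using \<Omega> by (simp add: frontier_eq_empty)
  define P where "P j C e \<sigma> \<longleftrightarrow> (\<forall>n\<ge>1. \<forall>X\<in>sets borel.
     (\<forall>x\<in>X. x \<in> \<Omega> \<and> ball x \<delta> \<subseteq> U j \<and> infdist x (frontier \<Omega>) \<le> \<sigma>) \<longrightarrow> osc_bound n \<Omega> X C e)" for j C e \<sigma>
  have "\<exists>C e \<sigma>. 0 \<le> C \<and> 0 < e \<and> 0 < \<sigma> \<and> P j C e \<sigma>" if j: "j < J" for j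
  proof -
    from ch j obtain a and A :: "(real ^ 'd) \<times> real \<Rightarrow> (real ^ 'd) \<times> real" and g where
      A: "orthogonal_transformation A" and g: "C2_fun g" "\<And>i k x. \<bar>partial_deriv i (partial_deriv k g) x\<bar> \<le> M"
      and gr: "\<Omega> \<inter> U j = {x \<in> U j. snd (A (x - a)) \<le> g (fst (A (x - a)))}" by blast
    define T where "T x = A (x - a)" for x
    have linA: "linear A" and injA: "inj A" using A by (auto intro: orthogonal_transformation_linear orthogonal_transformation_inj)
    have Tim: "T ` Y = A ` ((+) (- a) ` Y)" for Y by (simp add: T_def image_image)
    have dT: "dist (T x) (T y) = dist x y" for x y
      unfolding T_def by (rule dist_affine_orthogonal[OF A])
    have surjT: "\<exists>x. T x = z" for z
    proof -
      obtain y where "A y = z" using orthogonal_transformation_surj[OF A] by (metis surjD)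
      then show ?thesis by (intro exI[of _ "y + a"]) (simp add: T_def)
    qed
    have injT: "inj T" using dT by (metis dist_eq_0_iff injI)
    have frT: "frontier (T ` \<Omega>) = T ` frontier \<Omega>"
      unfolding T_def[abs_def] by (rule frontier_affine_orthogonal[OF A])
    have infT: "infdist (T x) (frontier (T ` \<Omega>)) = infdist x (frontier \<Omega>)" for x
      unfolding T_def[abs_def] by (rule infdist_frontier_affine_orthogonal[OF A])
    have bT: "T ` ball x r = ball (T x) r" for x r
    proof
      show "T ` ball x r \<subseteq> ball (T x) r" by (auto simp: dT)
      show "ball (T x) r \<subseteq> T ` ball x r"
      proof
        fix z assume "z \<in> ball (T x) r"
        moreover obtain y where "T y = z" using surjT by blast
        ultimately show "z \<in> T ` ball x r" using dT[of x y] by auto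
      qed
    qed
    obtain R where R0: "0 < R" "\<And>x. x \<in> \<Omega> \<Longrightarrow> norm (T x) \<le> R"
    proof -
      have "bounded (T ` \<Omega>)" unfolding Tim using bdd linA
        by (intro bounded_linear_image bounded_translation) (simp_all add: linear_linear)
      then show ?thesis using that by (auto simp: bounded_pos)
    qed
    interpret graph_chart g M "T ` \<Omega>" "T ` U j" \<delta> R
    proof
      show "closed (T ` \<Omega>)" unfolding Tim using \<Omega> linA injA by (intro closed_injective_linear_image closed_translation)
      show "frontier (T ` \<Omega>) \<noteq> {}" using fr frT by simp
      show "open (T ` U j)" unfolding Tim using U j linA orthogonal_transformation_surj[OF A]
        by (intro open_surjective_linear_image open_translation) auto
      have "T ` \<Omega> \<inter> T ` U j = T ` (\<Omega> \<inter> U j)" using injT by (simp add: image_Int)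
      also have "\<dots> = {z \<in> T ` U j. snd z \<le> g (fst z)}" unfolding gr T_def by auto
      finally show "T ` \<Omega> \<inter> T ` U j = {z \<in> T ` U j. snd z \<le> g (fst z)}" .
    qed (use g \<delta> R0 in auto)
    obtain C e0 where C: "0 \<le> C" "0 < e0" and ob: "\<forall>n\<ge>1. \<forall>X\<in>sets borel. (\<forall>x\<in>X. base x) \<longrightarrow> osc_bound n (T ` \<Omega>) X C e0"
      using osc_bound_chart by blast
    have "osc_bound n \<Omega> X C e0" if n: "n \<ge> 1" and X: "X \<in> sets borel" "\<forall>x\<in>X. x \<in> \<Omega> \<and> ball x \<delta> \<subseteq> U j \<and> infdist x (frontier \<Omega>) \<le> \<sigma>" for n X
    proof -
      \<comment> \<open>The image is the preimage under the inverse isometry S, which is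
        continuous.\<close>
      have "T ` X \<in> sets borel"
      proof -
        define S where "S = inv T"
        have ST: "S (T x) = x" for x unfolding S_def using injT by simp
        have TS: "T (S x) = x" for x unfolding S_def using surjT by (metis f_inv_into_f rangeI)
        have "dist (S x) (S y) = dist x y" for x y using dT[of "S x" "S y"] by (simp add: TS)
        then have "continuous_on UNIV S" by (intro continuous_onI) auto
        then have [measurable]: "S \<in> borel_measurable borel" by (rule borel_measurable_continuous_onI)
        have "T ` X = S -` X \<inter> space borel" using ST TS by (auto simp: image_iff) metis
        then show ?thesis using measurable_sets[of S borel borel X] X(1) by simp
      qed
      moreover have "\<forall>z\<in>T ` X. base z"
        using X(2) R0(2) bT infT by (fastforce simp: base_def)
      ultimately have "osc_bound n (T ` \<Omega>) (T ` X) C e0" using ob n by blast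
      then have "osc_bound n ((\<lambda>x. A (x - a)) ` \<Omega>) ((\<lambda>x. A (x - a)) ` X) C e0" by (simp only: T_def[abs_def])
      then show ?thesis by (rule osc_bound_isometry[OF A borel_closed[OF \<Omega>(1)]])
    qed
    then have "P j C e0 \<sigma>" by (simp add: P_def)
    then show ?thesis using C \<sigma>_pos by blast
  qed
  then obtain Cf ef sf where Q: "\<And>j. j < J \<Longrightarrow> 0 \<le> Cf j" "\<And>j. j < J \<Longrightarrow> 0 < ef j" "\<And>j. j < J \<Longrightarrow> 0 < sf j"
    and Qo: "\<And>j. j < J \<Longrightarrow> P j (Cf j) (ef j) (sf j)"
    by metis
  \<comment> \<open>The width of the boundary layer: at most \<delta>, so that the charts cover it,
    and at most the scale on which the estimate of each chart is valid.\<close>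
  define \<delta>1 where "\<delta>1 = Min (insert \<delta> ((\<lambda>j. sf j) ` {..<J}))"
  have \<delta>1: "0 < \<delta>1" "\<delta>1 \<le> \<delta>" "\<And>j. j < J \<Longrightarrow> \<delta>1 \<le> sf j"
    unfolding \<delta>1_def using \<delta> Q by auto
  define X0 where "X0 = {x \<in> \<Omega>. \<delta>1 \<le> infdist x (frontier \<Omega>)}"
  define Xj where "Xj j = {x \<in> \<Omega>. x \<in> U j \<and> \<delta> < infdist x (frontier (U j)) \<and> infdist x (frontier \<Omega>) < \<delta>1}" for j
  have [measurable]: "\<Omega> \<in> sets borel" "\<And>j. j < J \<Longrightarrow> U j \<in> sets borel" using \<Omega> U by auto
  have [measurable]: "(\<lambda>x. infdist x S) \<in> borel_measurable borel" for S :: "((real ^ 'd) \<times> real) set"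
    by (intro borel_measurable_continuous_onI continuous_intros)
  have Xjb: "Xj j \<in> sets borel" if "j < J" for j
  proof -
    have "Xj j = \<Omega> \<inter> U j \<inter> {x \<in> space borel. \<delta> < infdist x (frontier (U j)) \<and> infdist x (frontier \<Omega>) < \<delta>1}" by (auto simp: Xj_def)
    also have "\<dots> \<in> sets borel" using that by measurable
    finally show ?thesis .
  qed
  have X0b: "X0 \<in> sets borel"
  proof -
    have "X0 = \<Omega> \<inter> {x \<in> space borel. \<delta>1 \<le> infdist x (frontier \<Omega>)}" by (auto simp: X0_def)
    also have "\<dots> \<in> sets borel" by measurable
    finally show ?thesis .
  qed
  obtain C0 e0 where C0: "0 \<le> C0" "0 < e0" and ob0: "\<And>n. n \<ge> 1 \<Longrightarrow> osc_bound n \<Omega> X0 C0 e0"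
    using osc_bound_interior[OF \<Omega>(1) \<delta>1(1) _ X0b] by (force simp: X0_def)
  have obj: "osc_bound n \<Omega> (Xj j) (Cf j) (ef j)" if "j < J" "n \<ge> 1" for n j
  proof (rule Qo[OF that(1), unfolded P_def, rule_format, OF that(2) Xjb[OF that(1)]])
    fix x assume x: "x \<in> Xj j"
    then have "ball x \<delta> \<subseteq> ball x (infdist x (frontier (U j)))" by (auto simp: Xj_def)
    also have "\<dots> \<subseteq> U j" using x by (intro ball_infdist_frontier) (auto simp: Xj_def)
    finally show "x \<in> \<Omega> \<and> ball x \<delta> \<subseteq> U j \<and> infdist x (frontier \<Omega>) \<le> sf j"
      using x \<delta>1(3)[OF that(1)] by (auto simp: Xj_def)
  qed
  define C where "C = Max (insert C0 ((\<lambda>j. Cf j) ` {..<J}))"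
  define e where "e = Min (insert e0 ((\<lambda>j. ef j) ` {..<J}))"
  have C: "C0 \<le> C" "\<And>j. j < J \<Longrightarrow> Cf j \<le> C" unfolding C_def by auto
  have e: "0 < e" "e \<le> e0" "\<And>j. j < J \<Longrightarrow> e \<le> ef j" unfolding e_def using C0 Q by auto
  let ?X = "insert X0 (Xj ` {..<J})"
  have "\<Union>?X = \<Omega>"
  proof
    show "\<Union>?X \<subseteq> \<Omega>" by (auto simp: X0_def Xj_def)
    show "\<Omega> \<subseteq> \<Union>?X"
    proof
      fix x assume x: "x \<in> \<Omega>"
      show "x \<in> \<Union>?X"
      proof (cases "\<delta>1 \<le> infdist x (frontier \<Omega>)")
        case True
        then show ?thesis using x by (simp add: X0_def)
      next
        case False
        then obtain j where "j < J" "x \<in> U j" "infdist x (frontier (U j)) > \<delta>" using cov x \<delta>1(2) by force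
        then have "x \<in> Xj j" "j < J" using x False by (auto simp: Xj_def)
        then show ?thesis by blast
      qed
    qed
  qed
  moreover have "\<forall>n\<ge>1. \<forall>X\<in>?X. osc_bound n \<Omega> X C e"
  proof (intro allI impI ballI)
    fix n :: nat and X assume n: "1 \<le> n" and "X \<in> ?X"
    then consider "X = X0" | j where "j < J" "X = Xj j" by blast
    then show "osc_bound n \<Omega> X C e"
    proof cases
      case 1
      then show ?thesis using osc_bound_mono[OF ob0[OF n] C0(1) C(1) e(2)] by simp
    next
      case 2
      then show ?thesis using osc_bound_mono[OF obj[OF 2(1) n] Q(1) C(2) e(3)] by simp
    qed
  qed
  moreover have "?X \<subseteq> sets borel" using X0b Xjb by auto
  moreover have "0 \<le> C" using C C0 by simp
  moreover have "finite ?X" by simp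
  ultimately show ?thesis using e(1) by (intro exI[of _ C] conjI exI[of _ e] exI[of _ ?X]) auto
qed

text \<open>The map \<phi> embeds the domain into a Euclidean space with one more dimension, where
  \<rho> is at most twice the distance. Points in one ball of radius t/4 are therefore at
  \<rho>-distance less than t, so a separated set has at most one point in each ball.\<close>

lemma separated_covered_card:
  fixes F :: "('a::euclidean_space \<times> real) set"
  defines "\<phi> \<Omega> x \<equiv> (x, sqrt (infdist x (frontier \<Omega>)))"
  assumes sep: "eps_separated (rho \<Omega>) t S" and t: "0 < t" and F: "finite F" "\<phi> \<Omega> ` S \<subseteq> (\<Union>c\<in>F. ball c (t / 4))"
  shows "finite S \<and> card S \<le> card F"
proof -
  have "\<forall>x\<in>S. \<exists>c\<in>F. \<phi> \<Omega> x \<in> ball c (t / 4)" using F(2) by blast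
  then obtain c where c: "\<And>x. x \<in> S \<Longrightarrow> c x \<in> F" "\<And>x. x \<in> S \<Longrightarrow> \<phi> \<Omega> x \<in> ball (c x) (t / 4)" by metis
  have "inj_on c S"
  proof (rule inj_onI, rule ccontr)
    fix x y assume xy: "x \<in> S" "y \<in> S" "c x = c y" "x \<noteq> y"
    have "dist (\<phi> \<Omega> x) (\<phi> \<Omega> y) < t / 2"
      using c(2)[OF xy(1)] c(2)[OF xy(2)] xy(3) dist_triangle[of "\<phi> \<Omega> x" "\<phi> \<Omega> y" "c x"]
      by (simp add: dist_commute)
    moreover have "norm (x - y) \<le> dist (\<phi> \<Omega> x) (\<phi> \<Omega> y)"
      using dist_fst_le[of "\<phi> \<Omega> x" "\<phi> \<Omega> y"] by (simp add: \<phi>_def dist_norm)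
    moreover have "\<bar>sqrt (infdist x (frontier \<Omega>)) - sqrt (infdist y (frontier \<Omega>))\<bar> \<le> dist (\<phi> \<Omega> x) (\<phi> \<Omega> y)"
      using dist_snd_le[of "\<phi> \<Omega> x" "\<phi> \<Omega> y"] by (simp add: \<phi>_def dist_real_def)
    ultimately have "rho \<Omega> x y < t" by (simp add: rho_def)
    then show False using sep xy by (force simp: eps_separated_def)
  qed
  moreover have "c ` S \<subseteq> F" using c by blast
  ultimately show ?thesis using F(1) by (meson card_inj_on_le finite_imageD finite_subset)
qed

lemma separated_finite:
  assumes "compact \<Omega>" "\<Lambda> \<subseteq> \<Omega>" "eps_separated (rho \<Omega>) t \<Lambda>" "0 < t"
  shows "finite (\<Lambda> :: 'a::euclidean_space set)"
proof -
  have "continuous_on \<Omega> (\<lambda>x. (x, sqrt (infdist x (frontier \<Omega>))))" by (intro continuous_intros)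
  then have "compact ((\<lambda>x. (x, sqrt (infdist x (frontier \<Omega>)))) ` \<Omega>)" using assms(1) by (rule compact_continuous_image)
  then obtain F where "finite F" "(\<lambda>x. (x, sqrt (infdist x (frontier \<Omega>)))) ` \<Omega> \<subseteq> (\<Union>c\<in>F. ball c (t / 4))"
    using assms(4) unfolding compact_eq_totally_bounded by (metis divide_pos_pos zero_less_numeral)
  then show ?thesis using separated_covered_card[OF assms(3,4), of F] assms(2) by blast
qed

text \<open>One cover of the unit ball by balls of radius 1/4 is scaled by t and moved to \<phi> x.
  Hence B depends on the dimension alone, neither on the domain nor on t.\<close>

lemma separated_overlap:
  "\<exists>B::nat. \<forall>(\<Omega>::'a::euclidean_space set) \<Lambda> t x. 0 < t \<longrightarrow> eps_separated (rho \<Omega>) t \<Lambda> \<longrightarrow> card {\<xi>\<in>\<Lambda>. rho \<Omega> \<xi> x \<le> t} \<le> B"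
proof -
  have "compact (cball (0::'a \<times> real) 1)" by simp
  then obtain F where F: "finite F" "cball (0::'a \<times> real) 1 \<subseteq> (\<Union>c\<in>F. ball c (1 / 4))"
    unfolding compact_eq_totally_bounded by (metis zero_less_divide_1_iff zero_less_numeral)
  show ?thesis
  proof (intro exI[of _ "card F"] allI impI)
    fix \<Omega> \<Lambda> :: "'a set" and t :: real and x
    assume t: "0 < t" and sep: "eps_separated (rho \<Omega>) t \<Lambda>"
    define \<phi> where "\<phi> x = (x, sqrt (infdist x (frontier \<Omega>)))" for x
    let ?S = "{\<xi>\<in>\<Lambda>. rho \<Omega> \<xi> x \<le> t}"
    have "\<phi> ` ?S \<subseteq> (\<Union>c\<in>(\<lambda>c. \<phi> x + t *\<^sub>R c) ` F. ball c (t / 4))"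
    proof
      fix z assume "z \<in> \<phi> ` ?S"
      then obtain \<xi> where \<xi>: "rho \<Omega> \<xi> x \<le> t" "z = \<phi> \<xi>" by blast
      define y where "y = (1 / t) *\<^sub>R (z - \<phi> x)"
      have "norm (z - \<phi> x) \<le> rho \<Omega> \<xi> x"
        unfolding \<xi>(2) \<phi>_def rho_def
        using norm_Pair_le[of "\<xi> - x" "sqrt (infdist \<xi> (frontier \<Omega>)) - sqrt (infdist x (frontier \<Omega>))"] by simp
      then have "y \<in> cball 0 1" using \<xi> t by (simp add: y_def)
      then obtain c where c: "c \<in> F" "norm (c - y) < 1 / 4" using F by (auto simp: dist_norm)
      have "\<phi> x + t *\<^sub>R c - z = t *\<^sub>R (c - y)" using t by (simp add: y_def algebra_simps)
      then have "norm (\<phi> x + t *\<^sub>R c - z) < t / 4" using c t by simp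
      then show "z \<in> (\<Union>c\<in>(\<lambda>c. \<phi> x + t *\<^sub>R c) ` F. ball c (t / 4))" using c(1) by (auto simp: dist_norm)
    qed
    moreover have "eps_separated (rho \<Omega>) t ?S" using sep by (auto simp: eps_separated_def)
    ultimately have "card ?S \<le> card ((\<lambda>c. \<phi> x + t *\<^sub>R c) ` F)"
      using separated_covered_card[of \<Omega> t ?S "(\<lambda>c. \<phi> x + t *\<^sub>R c) ` F"] t F(1) unfolding \<phi>_def by blast
    also have "\<dots> \<le> card F" using F(1) by (rule card_image_le)
    finally show "card ?S \<le> card F" .
  qed
qed

section \<open>Norms and sums over the cells\<close>

lemma poly_degree_le_continuous:
  assumes "poly_degree_le n f" shows "continuous_on UNIV f"
proof -
  from assms obtain c where c: "\<And>x. f x = (\<Sum>\<alpha> | \<alpha> \<in> Basis \<rightarrow>\<^sub>E UNIV \<and> (\<Sum>b\<in>Basis. \<alpha> b) \<le> n. c \<alpha> * (\<Prod>b\<in>Basis. (x \<bullet> b) ^ \<alpha> b))"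
    unfolding poly_degree_le_def by blast
  have "continuous_on UNIV (\<lambda>x. \<Sum>\<alpha> | \<alpha> \<in> Basis \<rightarrow>\<^sub>E UNIV \<and> (\<Sum>b\<in>Basis. \<alpha> b) \<le> n. c \<alpha> * (\<Prod>b\<in>Basis. (x \<bullet> b) ^ \<alpha> b))"
    by (intro continuous_intros)
  then show ?thesis using c by presburger
qed

lemma closed_rho_ball:
  assumes "closed \<Omega>" shows "closed (rho_ball \<Omega> \<xi> t)"
proof -
  have "continuous_on UNIV (\<lambda>\<eta>. rho \<Omega> \<xi> \<eta>)" unfolding rho_def by (intro continuous_intros)
  then have "closed {\<eta>. rho \<Omega> \<xi> \<eta> \<le> t}" by (intro closed_Collect_le continuous_intros)
  moreover have "rho_ball \<Omega> \<xi> t = \<Omega> \<inter> {\<eta>. rho \<Omega> \<xi> \<eta> \<le> t}" by (auto simp: rho_ball_def)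
  ultimately show ?thesis using assms by (simp add: closed_Int)
qed

lemma powr_add_le:
  fixes x y r :: real
  assumes "0 \<le> x" "0 \<le> y" "1 \<le> r"
  shows "(x + y) powr r \<le> 2 powr r * (x powr r + y powr r)"
proof -
  have "(x + y) powr r \<le> (2 * max x y) powr r" using assms by (intro powr_mono2) auto
  also have "\<dots> = 2 powr r * max x y powr r" by (rule powr_mult)
  also have "max x y powr r \<le> x powr r + y powr r" by (auto simp: max_def)
  finally show ?thesis by simp
qed

text \<open>The maximum is an essential supremum because \<Omega> is the closure of an open set: a
  neighbourhood of the maximum point meets G in a nonempty open set, which is not
  negligible.\<close>

lemma Lp_norm_infinity:
  fixes f :: "'a::euclidean_space \<Rightarrow> real"
  assumes G: "open G" and \<Omega>: "\<Omega> = closure G" and f: "continuous_on UNIV f"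
    and x: "x \<in> \<Omega>" "\<And>y. y \<in> \<Omega> \<Longrightarrow> \<bar>f y\<bar> \<le> \<bar>f x\<bar>"
  shows "Lp_norm \<Omega> \<infinity> f = \<bar>f x\<bar>"
proof -
  have \<Omega>m: "\<Omega> \<in> sets lebesgue" using \<Omega> by simp
  have [measurable]: "f \<in> borel_measurable borel" using f by (rule borel_measurable_continuous_onI)
  have fm: "(\<lambda>x. ereal \<bar>f x\<bar>) \<in> borel_measurable (lebesgue_on \<Omega>)"
    by (intro measurable_restrict_space1 measurable_completion) measurable
  have le: "esssup (lebesgue_on \<Omega>) (\<lambda>x. ereal \<bar>f x\<bar>) \<le> ereal \<bar>f x\<bar>"
    using x by (intro esssup_I fm AE_I2) auto
  have "\<not> esssup (lebesgue_on \<Omega>) (\<lambda>x. ereal \<bar>f x\<bar>) < ereal \<bar>f x\<bar>"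
  proof
    assume "esssup (lebesgue_on \<Omega>) (\<lambda>x. ereal \<bar>f x\<bar>) < ereal \<bar>f x\<bar>"
    then obtain e where e: "esssup (lebesgue_on \<Omega>) (\<lambda>x. ereal \<bar>f x\<bar>) < ereal e" "e < \<bar>f x\<bar>"
      using ereal_dense2[of "esssup (lebesgue_on \<Omega>) (\<lambda>x. ereal \<bar>f x\<bar>)" "ereal \<bar>f x\<bar>"] by auto
    define V where "V = {y. e < \<bar>f y\<bar>}"
    have "open V" unfolding V_def using f by (intro open_Collect_less continuous_intros)
    moreover have "x \<in> V" using e by (simp add: V_def)
    ultimately have ne: "V \<inter> G \<noteq> {}" using x(1) \<Omega> open_Int_closure_eq_empty[of V G] by blast
    have "AE y in lebesgue_on \<Omega>. ereal \<bar>f y\<bar> \<le> esssup (lebesgue_on \<Omega>) (\<lambda>x. ereal \<bar>f x\<bar>)" by (rule esssup_AE)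
    then have "AE y in lebesgue_on \<Omega>. y \<notin> V"
    proof (rule AE_mp, intro AE_I2 impI)
      fix y assume "ereal \<bar>f y\<bar> \<le> esssup (lebesgue_on \<Omega>) (\<lambda>x. ereal \<bar>f x\<bar>)"
      then have "ereal \<bar>f y\<bar> < ereal e" using e(1) by (rule le_less_trans)
      then show "y \<notin> V" by (simp add: V_def)
    qed
    then have "AE y in lebesgue. y \<in> \<Omega> \<longrightarrow> y \<notin> V" using \<Omega>m by (subst (asm) AE_restrict_space_iff) auto
    then obtain N where N: "N \<in> null_sets lebesgue" "{y \<in> space lebesgue. \<not> (y \<in> \<Omega> \<longrightarrow> y \<notin> V)} \<subseteq> N"
      unfolding eventually_ae_filter by blast
    then have "V \<inter> G \<subseteq> N" using \<Omega> closure_subset by fastforce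
    then have "negligible (V \<inter> G)" using N(1) by (meson negligible_iff_null_sets negligible_subset)
    moreover have "open (V \<inter> G)" using \<open>open V\<close> G by (rule open_Int)
    ultimately show False using ne open_not_negligible by blast
  qed
  then have "esssup (lebesgue_on \<Omega>) (\<lambda>x. ereal \<bar>f x\<bar>) = ereal \<bar>f x\<bar>" using le by order
  then show ?thesis by (simp add: Lp_norm_def)
qed

text \<open>A Bochner integral has the value 0 when the function is not integrable. Boundedness of f
  on the compact set excludes this and permits calculation with nonnegative integrals.\<close>

lemma Lp_integral:
  fixes f :: "'a::euclidean_space \<Rightarrow> real"
  assumes \<Omega>: "compact \<Omega>" and f: "continuous_on UNIV f" and r: "1 \<le> r"
  shows "power_mass \<Omega> r f = ennreal (LINT x|lebesgue_on \<Omega>. \<bar>f x\<bar> powr r)"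
proof -
  let ?I = "power_mass \<Omega> r f"
  have \<Omega>m: "\<Omega> \<in> sets lebesgue" "\<Omega> \<in> sets borel" using \<Omega> by (auto simp: compact_imp_closed)
  have [measurable]: "f \<in> borel_measurable borel" using f by (rule borel_measurable_continuous_onI)
  have "(LINT x|lebesgue_on \<Omega>. \<bar>f x\<bar> powr r) = enn2real (\<integral>\<^sup>+x. ennreal (\<bar>f x\<bar> powr r) \<partial>lebesgue_on \<Omega>)"
    by (intro integral_eq_nn_integral measurable_restrict_space1 measurable_completion) (auto, measurable)
  also have "(\<integral>\<^sup>+x. ennreal (\<bar>f x\<bar> powr r) \<partial>lebesgue_on \<Omega>) = ?I"
    using \<Omega>m by (simp add: nn_integral_restrict_space nn_integral_completion)
  finally have eq: "(LINT x|lebesgue_on \<Omega>. \<bar>f x\<bar> powr r) = enn2real ?I" .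
  have "bounded (f ` \<Omega>)"
    using \<Omega> f by (intro compact_imp_bounded compact_continuous_image) (auto intro: continuous_on_subset)
  then obtain b where b: "\<And>x. x \<in> \<Omega> \<Longrightarrow> \<bar>f x\<bar> \<le> b" by (auto simp: bounded_iff)
  have "?I \<le> (\<integral>\<^sup>+x. ennreal (b powr r) * indicator \<Omega> x \<partial>lborel)"
    using b r by (intro nn_integral_mono) (auto simp: indicator_def intro!: ennreal_leI powr_mono2)
  also have "\<dots> = ennreal (b powr r) * emeasure lborel \<Omega>" using \<Omega>m by (simp add: nn_integral_cmult_indicator)
  also have "\<dots> < \<infinity>" using emeasure_compact_finite[OF \<Omega>] by (simp add: ennreal_mult_less_top)
  finally show ?thesis unfolding eq by simp
qed

text \<open>Overlaps are absorbed by applying the oscillation estimate to the largest oscillation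
  among the cells that contain the point.\<close>

lemma sum_osc_le:
  fixes f :: "'a::euclidean_space \<Rightarrow> real" and \<Lambda> :: "'a set"
  assumes ob: "osc_bound n \<Omega> X C e0" and X: "X \<subseteq> \<Omega>" "X \<in> sets borel"
    and \<epsilon>: "0 < \<epsilon>" "\<epsilon> < e0" and f: "quad_slice_poly n f" "f \<in> borel_measurable borel" and p: "1 \<le> p"
    and \<Lambda>: "finite \<Lambda>" "\<Lambda> \<noteq> {}" and U: "\<And>\<xi>. \<xi> \<in> \<Lambda> \<Longrightarrow> rho_ball \<Omega> \<xi> (\<epsilon> / real n) \<in> sets borel"
    and ab: "\<And>\<xi>. \<xi> \<in> \<Lambda> \<Longrightarrow> a \<xi> \<in> rho_ball \<Omega> \<xi> (\<epsilon> / real n)" "\<And>\<xi>. \<xi> \<in> \<Lambda> \<Longrightarrow> b \<xi> \<in> rho_ball \<Omega> \<xi> (\<epsilon> / real n)"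
    and B: "\<And>x. card {\<xi>\<in>\<Lambda>. rho \<Omega> \<xi> x \<le> \<epsilon> / real n} \<le> B"
  shows "(\<Sum>\<xi>\<in>\<Lambda>. emeasure lborel (rho_ball \<Omega> \<xi> (\<epsilon> / real n) \<inter> X) * ennreal (\<bar>f (a \<xi>) - f (b \<xi>)\<bar> powr p))
    \<le> of_nat B * (ennreal ((C * \<epsilon>) powr p) * power_mass \<Omega> p f)"
proof -
  define t where "t = \<epsilon> / real n"
  define osc where "osc \<xi> = \<bar>f (a \<xi>) - f (b \<xi>)\<bar>" for \<xi>
  define v where "v \<xi> x = indicator (rho_ball \<Omega> \<xi> t \<inter> X) x * osc \<xi>" for \<xi> x
  define w where "w x = Max ((\<lambda>\<xi>. v \<xi> x) ` \<Lambda>)" for x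
  have Um: "rho_ball \<Omega> \<xi> t \<inter> X \<in> sets borel" if "\<xi> \<in> \<Lambda>" for \<xi> using U[OF that] X(2) by (simp add: t_def)
  have v0: "0 \<le> v \<xi> x" for \<xi> x by (simp add: v_def osc_def)
  have vw: "v \<xi> x \<le> w x" if "\<xi> \<in> \<Lambda>" for \<xi> x unfolding w_def using \<Lambda> that by (intro Max_ge) auto
  have w0: "0 \<le> w x" for x using \<Lambda>(2) vw v0 order.trans by (metis ex_in_conv)
  have w_in: "\<exists>\<xi>\<in>\<Lambda>. w x = v \<xi> x" for x
  proof -
    have "w x \<in> (\<lambda>\<xi>. v \<xi> x) ` \<Lambda>" unfolding w_def using \<Lambda> by (intro Max_in) auto
    then show ?thesis by blast
  qed
  have wm [measurable]: "w \<in> borel_measurable borel"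
  proof -
    have "v \<xi> \<in> borel_measurable borel" if "\<xi> \<in> \<Lambda>" for \<xi>
      unfolding v_def using Um[OF that] by (intro borel_measurable_times borel_measurable_indicator) auto
    then show ?thesis unfolding w_def[abs_def] by (intro borel_measurable_Max \<Lambda>)
  qed
  have main: "(\<integral>\<^sup>+x. ennreal (w x powr p) \<partial>lborel)
     \<le> ennreal ((C * \<epsilon>) powr p) * power_mass \<Omega> p f"
  proof (rule osc_bound_powr[OF ob \<epsilon> f p wm])
    show "0 \<le> w x" for x by (rule w0)
    show "w x = 0" if "x \<notin> X" for x using w_in that by (metis IntD2 indicator_simps(2) mult_zero_left v_def)
    fix x assume x: "x \<in> X"
      obtain \<xi> where \<xi>: "\<xi> \<in> \<Lambda>" "w x = v \<xi> x" using w_in by blast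
      show "osc_ge n \<Omega> \<epsilon> f x (w x)"
      proof (cases "x \<in> rho_ball \<Omega> \<xi> t")
        case True
        have "rho \<Omega> x \<eta> \<le> 2 * \<epsilon> / real n" if "\<eta> \<in> rho_ball \<Omega> \<xi> t" for \<eta>
        proof -
          have "rho \<Omega> x \<eta> \<le> rho \<Omega> \<xi> x + rho \<Omega> \<xi> \<eta>" using rho_triangle[of \<Omega> x \<eta> \<xi>] by (simp add: rho_commute[of \<Omega> x \<xi>])
          also have "\<dots> \<le> t + t" using True that by (intro add_mono) (auto simp: rho_ball_def)
          finally show ?thesis by (simp add: t_def)
        qed
        then show ?thesis using ab[OF \<xi>(1)] True x
          by (intro bexI[of _ "a \<xi>"] bexI[of _ "b \<xi>"]) (auto simp: \<xi>(2) v_def osc_def t_def rho_ball_def)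
      next
        case False
        then have "w x = 0" by (simp add: \<xi>(2) v_def)
        \<comment> \<open>The value 0 is witnessed by \<eta> = \<eta>' = x.\<close>
        then show ?thesis using x X \<epsilon> by (intro bexI[of _ x]) (auto simp: rho_def)
      qed
  qed
  have "(\<Sum>\<xi>\<in>\<Lambda>. emeasure lborel (rho_ball \<Omega> \<xi> t \<inter> X) * ennreal (osc \<xi> powr p))
     = (\<Sum>\<xi>\<in>\<Lambda>. \<integral>\<^sup>+x. ennreal (osc \<xi> powr p) * indicator (rho_ball \<Omega> \<xi> t \<inter> X) x \<partial>lborel)"
    using Um by (intro sum.cong) (auto simp: nn_integral_cmult_indicator mult.commute)
  also have "\<dots> = (\<integral>\<^sup>+x. (\<Sum>\<xi>\<in>\<Lambda>. ennreal (osc \<xi> powr p) * indicator (rho_ball \<Omega> \<xi> t \<inter> X) x) \<partial>lborel)"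
    using Um by (intro nn_integral_sum[symmetric]) auto
  also have "\<dots> \<le> (\<integral>\<^sup>+x. of_nat B * ennreal (w x powr p) \<partial>lborel)"
  proof (rule nn_integral_mono)
    fix x
    have "(\<Sum>\<xi>\<in>\<Lambda>. ennreal (osc \<xi> powr p) * indicator (rho_ball \<Omega> \<xi> t \<inter> X) x)
       = (\<Sum>\<xi>\<in>\<Lambda>. if x \<in> rho_ball \<Omega> \<xi> t \<inter> X then ennreal (osc \<xi> powr p) else 0)"
      by (intro sum.cong) (auto simp: indicator_def)
    also have "\<dots> = (\<Sum>\<xi>\<in>{\<xi>\<in>\<Lambda>. x \<in> rho_ball \<Omega> \<xi> t \<inter> X}. ennreal (osc \<xi> powr p))"
      by (rule sum.inter_filter[OF \<Lambda>(1), symmetric])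
    \<comment> \<open>Since w x is the largest oscillation among the cells around x, the overlap
      enters only through the number of these cells.\<close>
    also have "\<dots> \<le> (\<Sum>\<xi>\<in>{\<xi>\<in>\<Lambda>. x \<in> rho_ball \<Omega> \<xi> t \<inter> X}. ennreal (w x powr p))"
    proof (intro sum_mono ennreal_leI powr_mono2)
      fix \<xi> assume "\<xi> \<in> {\<xi>\<in>\<Lambda>. x \<in> rho_ball \<Omega> \<xi> t \<inter> X}"
      then show "osc \<xi> \<le> w x" using vw[of \<xi> x] by (simp add: v_def)
    qed (use p in \<open>auto simp: osc_def\<close>)
    also have "\<dots> = of_nat (card {\<xi>\<in>\<Lambda>. x \<in> rho_ball \<Omega> \<xi> t \<inter> X}) * ennreal (w x powr p)" by simp
    also have "\<dots> \<le> of_nat B * ennreal (w x powr p)"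
    proof (intro mult_right_mono)
      have "card {\<xi>\<in>\<Lambda>. x \<in> rho_ball \<Omega> \<xi> t \<inter> X} \<le> card {\<xi>\<in>\<Lambda>. rho \<Omega> \<xi> x \<le> \<epsilon> / real n}"
        using \<Lambda>(1) by (intro card_mono) (auto simp: rho_ball_def t_def)
      then show "of_nat (card {\<xi>\<in>\<Lambda>. x \<in> rho_ball \<Omega> \<xi> t \<inter> X}) \<le> (of_nat B :: ennreal)"
        using B[of x] by (simp del: of_nat_le_iff add: of_nat_mono)
    qed simp
    finally show "(\<Sum>\<xi>\<in>\<Lambda>. ennreal (osc \<xi> powr p) * indicator (rho_ball \<Omega> \<xi> t \<inter> X) x) \<le> of_nat B * ennreal (w x powr p)" .
  qed
  also have "\<dots> = of_nat B * (\<integral>\<^sup>+x. ennreal (w x powr p) \<partial>lborel)" by (rule nn_integral_cmult) measurable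
  also have "\<dots> \<le> of_nat B * (ennreal ((C * \<epsilon>) powr p) * power_mass \<Omega> p f)"
    by (intro mult_left_mono main) simp
  finally show ?thesis by (simp add: t_def osc_def)
qed

section \<open>From oscillation to the comparison of norms\<close>

lemma rho_refl: "rho \<Omega> x x = 0"
  by (simp add: rho_def)

lemma compact_rho_ball:
  assumes "compact \<Omega>" shows "compact (rho_ball \<Omega> \<xi> t)"
proof -
  have "compact (\<Omega> \<inter> rho_ball \<Omega> \<xi> t)"
    using assms by (intro compact_Int_closed closed_rho_ball compact_imp_closed)
  moreover have "\<Omega> \<inter> rho_ball \<Omega> \<xi> t = rho_ball \<Omega> \<xi> t" by (auto simp: rho_ball_def)
  ultimately show ?thesis by simp
qed

lemma maximal_covers:
  assumes "maximal_eps_separated \<Omega> (rho \<Omega>) t \<Lambda>" "x \<in> \<Omega>"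
  shows "\<exists>\<xi>\<in>\<Lambda>. x \<in> rho_ball \<Omega> \<xi> t"
proof -
  from assms have "(INF \<omega>\<in>\<Lambda>. ereal (rho \<Omega> x \<omega>)) < ereal t" by (simp add: maximal_eps_separated_def)
  then obtain \<xi> where "\<xi> \<in> \<Lambda>" "ereal (rho \<Omega> x \<xi>) < ereal t" unfolding INF_less_iff by blast
  then show ?thesis using assms(2) by (intro bexI[of _ \<xi>]) (auto simp: rho_ball_def rho_commute[of \<Omega> \<xi> x])
qed

lemma rho_ball_extrema:
  fixes f :: "'a::euclidean_space \<Rightarrow> real"
  assumes "compact \<Omega>" "continuous_on UNIV f" "\<xi> \<in> \<Omega>" "0 < t"
  shows "\<exists>a\<in>rho_ball \<Omega> \<xi> t. \<exists>b\<in>rho_ball \<Omega> \<xi> t. \<forall>\<eta>\<in>rho_ball \<Omega> \<xi> t. \<bar>f b\<bar> \<le> \<bar>f \<eta>\<bar> \<and> \<bar>f \<eta>\<bar> \<le> \<bar>f a\<bar>"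
proof -
  have ne: "rho_ball \<Omega> \<xi> t \<noteq> {}" using assms by (auto simp: rho_ball_def rho_refl intro!: exI[of _ \<xi>])
  have c: "continuous_on (rho_ball \<Omega> \<xi> t) (\<lambda>x. \<bar>f x\<bar>)"
    using assms(2) by (intro continuous_intros) (auto intro: continuous_on_subset)
  show ?thesis
    using continuous_attains_sup[OF compact_rho_ball[OF assms(1)] ne c]
      continuous_attains_inf[OF compact_rho_ball[OF assms(1)] ne c] by blast
qed

text \<open>Four inequalities suffice: I \<le> Smax, Smin \<le> B I, Smax \<le> 2^r (Smin + Sosc)
  and 2^r Sosc \<le> I/2. The last one absorbs the oscillation. All other factors are enlarged to
  r-th powers of constants, so that the constants after taking roots do not depend on r.\<close>

lemma discretization_finite_exponent:
  fixes f :: "'a::euclidean_space \<Rightarrow> real" and \<Lambda> :: "'a set" and B :: nat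
  assumes \<Omega>: "compact \<Omega>" "\<Omega> \<noteq> {}" and C: "0 \<le> C"
    and \<X>: "finite \<X>" "\<Union>\<X> = \<Omega>" "\<X> \<subseteq> sets borel" "\<And>X. X \<in> \<X> \<Longrightarrow> osc_bound n \<Omega> X C e0"
    and B: "\<And>x. card {\<xi>\<in>\<Lambda>. rho \<Omega> \<xi> x \<le> \<epsilon> / real n} \<le> B"
    and n: "1 \<le> n" and \<epsilon>: "0 < \<epsilon>" "\<epsilon> < e0" and small: "2 * C * \<epsilon> * (2 * (real (card \<X>) * real B + 1)) \<le> 1"
    and \<Lambda>: "maximal_eps_separated \<Omega> (rho \<Omega>) (\<epsilon> / real n) \<Lambda>" and f: "poly_degree_le n f" and r: "1 \<le> r"
  shows "1 / (2 * (real B + 1)) * max_norm \<Omega> \<Lambda> (\<epsilon> / real n) (ereal r) f \<le> Lp_norm \<Omega> (ereal r) f"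
    and "Lp_norm \<Omega> (ereal r) f \<le> 4 * min_norm \<Omega> \<Lambda> (\<epsilon> / real n) (ereal r) f"
proof -
  define t where "t = \<epsilon> / real n"
  have t: "0 < t" using \<epsilon> n by (simp add: t_def)
  note max = \<Lambda>[folded t_def]
  have sub: "\<Lambda> \<subseteq> \<Omega>" and sep: "eps_separated (rho \<Omega>) t \<Lambda>" using max by (auto simp: maximal_eps_separated_def)
  have fin: "finite \<Lambda>" by (rule separated_finite[OF \<Omega>(1) sub sep t])
  have ne: "\<Lambda> \<noteq> {}" using maximal_covers[OF max] \<Omega>(2) by blast
  have cf: "continuous_on UNIV f" by (rule poly_degree_le_continuous[OF f])
  have fm [measurable]: "f \<in> borel_measurable borel" using cf by (rule borel_measurable_continuous_onI)
  define U where "U \<xi> = rho_ball \<Omega> \<xi> t" for \<xi>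
  have cU: "compact (U \<xi>)" for \<xi> unfolding U_def by (rule compact_rho_ball[OF \<Omega>(1)])
  have Um [measurable]: "U \<xi> \<in> sets borel" for \<xi> using compact_imp_closed[OF cU] by simp
  have \<Omega>m [measurable]: "\<Omega> \<in> sets borel" using compact_imp_closed[OF \<Omega>(1)] by simp
  define \<mu> where "\<mu> \<xi> = measure lebesgue (U \<xi>)" for \<xi>
  have \<mu>: "emeasure lborel (U \<xi>) = ennreal (\<mu> \<xi>)" "0 \<le> \<mu> \<xi>" for \<xi>
  proof -
    have "emeasure lborel (U \<xi>) \<noteq> top" using emeasure_compact_finite[OF cU, of \<xi>] by auto
    then show "emeasure lborel (U \<xi>) = ennreal (\<mu> \<xi>)"
      using Um[of \<xi>] by (simp add: \<mu>_def measure_completion emeasure_eq_ennreal_measure)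
  qed (simp add: \<mu>_def)
  have "\<forall>\<xi>\<in>\<Lambda>. \<exists>a b. a \<in> U \<xi> \<and> b \<in> U \<xi> \<and> (\<forall>\<eta>\<in>U \<xi>. \<bar>f b\<bar> \<le> \<bar>f \<eta>\<bar> \<and> \<bar>f \<eta>\<bar> \<le> \<bar>f a\<bar>)"
    using rho_ball_extrema[OF \<Omega>(1) cf _ t] sub unfolding U_def by (meson subsetD)
  then obtain a b where ab: "\<And>\<xi>. \<xi> \<in> \<Lambda> \<Longrightarrow> a \<xi> \<in> U \<xi>" "\<And>\<xi>. \<xi> \<in> \<Lambda> \<Longrightarrow> b \<xi> \<in> U \<xi>"
    and ext: "\<And>\<xi> \<eta>. \<xi> \<in> \<Lambda> \<Longrightarrow> \<eta> \<in> U \<xi> \<Longrightarrow> \<bar>f (b \<xi>)\<bar> \<le> \<bar>f \<eta>\<bar>" "\<And>\<xi> \<eta>. \<xi> \<in> \<Lambda> \<Longrightarrow> \<eta> \<in> U \<xi> \<Longrightarrow> \<bar>f \<eta>\<bar> \<le> \<bar>f (a \<xi>)\<bar>"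
    by metis
  define I where "I = (LINT x|lebesgue_on \<Omega>. \<bar>f x\<bar> powr r)"
  have I0: "0 \<le> I" unfolding I_def by (rule Bochner_Integration.integral_nonneg) simp
  have NN: "power_mass \<Omega> r f = ennreal I"
    unfolding I_def by (rule Lp_integral[OF \<Omega>(1) cf r])
  define Smax where "Smax = (\<Sum>\<xi>\<in>\<Lambda>. \<mu> \<xi> * \<bar>f (a \<xi>)\<bar> powr r)"
  define Smin where "Smin = (\<Sum>\<xi>\<in>\<Lambda>. \<mu> \<xi> * \<bar>f (b \<xi>)\<bar> powr r)"
  define Sosc where "Sosc = (\<Sum>\<xi>\<in>\<Lambda>. \<mu> \<xi> * \<bar>f (a \<xi>) - f (b \<xi>)\<bar> powr r)"
  have S0: "0 \<le> Smax" "0 \<le> Smin" "0 \<le> Sosc" unfolding Smax_def Smin_def Sosc_def using \<mu>(2) by (auto intro!: sum_nonneg)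
  have lp: "Lp_norm \<Omega> (ereal r) f = I powr (1 / r)" by (simp add: Lp_norm_def I_def)
  have mx: "max_norm \<Omega> \<Lambda> t (ereal r) f = Smax powr (1 / r)"
  proof -
    have "(SUP \<eta>\<in>rho_ball \<Omega> \<xi> t. \<bar>f \<eta>\<bar> powr r) = \<bar>f (a \<xi>)\<bar> powr r" if "\<xi> \<in> \<Lambda>" for \<xi>
      using ab(1)[OF that] ext(2)[OF that] r unfolding U_def by (intro cSup_eq_maximum) (auto intro!: powr_mono2)
    then show ?thesis by (simp add: max_norm_def Smax_def \<mu>_def U_def cong: sum.cong)
  qed
  have mn: "min_norm \<Omega> \<Lambda> t (ereal r) f = Smin powr (1 / r)"
  proof -
    have "(INF \<eta>\<in>rho_ball \<Omega> \<xi> t. \<bar>f \<eta>\<bar> powr r) = \<bar>f (b \<xi>)\<bar> powr r" if "\<xi> \<in> \<Lambda>" for \<xi>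
      using ab(2)[OF that] ext(1)[OF that] r unfolding U_def by (intro cInf_eq_minimum) (auto intro!: powr_mono2)
    then show ?thesis by (simp add: min_norm_def Smin_def \<mu>_def U_def cong: sum.cong)
  qed
  have cell_sum: "(\<integral>\<^sup>+x. (\<Sum>\<xi>\<in>\<Lambda>. ennreal (c \<xi>) * indicator (U \<xi>) x) \<partial>lborel) = ennreal (\<Sum>\<xi>\<in>\<Lambda>. \<mu> \<xi> * c \<xi>)"
    if "\<And>\<xi>. 0 \<le> c \<xi>" for c
  proof -
    have "(\<integral>\<^sup>+x. (\<Sum>\<xi>\<in>\<Lambda>. ennreal (c \<xi>) * indicator (U \<xi>) x) \<partial>lborel) = (\<Sum>\<xi>\<in>\<Lambda>. ennreal (c \<xi>) * emeasure lborel (U \<xi>))"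
      by (subst nn_integral_sum) (auto simp: nn_integral_cmult_indicator)
    also have "\<dots> = (\<Sum>\<xi>\<in>\<Lambda>. ennreal (\<mu> \<xi> * c \<xi>))"
      using that by (intro sum.cong) (auto simp: \<mu> ennreal_mult mult.commute)
    also have "\<dots> = ennreal (\<Sum>\<xi>\<in>\<Lambda>. \<mu> \<xi> * c \<xi>)" using that \<mu>(2) by (intro sum_ennreal) auto
    finally show ?thesis .
  qed
  have I_le: "I \<le> Smax"
  proof -
    have "ennreal I \<le> (\<integral>\<^sup>+x. (\<Sum>\<xi>\<in>\<Lambda>. ennreal (\<bar>f (a \<xi>)\<bar> powr r) * indicator (U \<xi>) x) \<partial>lborel)"
      unfolding NN[symmetric]
    proof (rule nn_integral_mono)
      fix x
      show "ennreal (\<bar>f x\<bar> powr r) * indicator \<Omega> x \<le> (\<Sum>\<xi>\<in>\<Lambda>. ennreal (\<bar>f (a \<xi>)\<bar> powr r) * indicator (U \<xi>) x)"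
      proof (cases "x \<in> \<Omega>")
        case True
        then obtain \<xi> where \<xi>: "\<xi> \<in> \<Lambda>" "x \<in> U \<xi>" using maximal_covers[OF max] unfolding U_def by blast
        have "ennreal (\<bar>f x\<bar> powr r) * indicator \<Omega> x \<le> ennreal (\<bar>f (a \<xi>)\<bar> powr r) * indicator (U \<xi>) x"
          using True \<xi> ext(2)[OF \<xi>] r by (auto intro!: ennreal_leI powr_mono2)
        also have "\<dots> \<le> (\<Sum>\<xi>\<in>\<Lambda>. ennreal (\<bar>f (a \<xi>)\<bar> powr r) * indicator (U \<xi>) x)"
          using fin \<xi>(1) by (intro member_le_sum[of \<xi> \<Lambda> "\<lambda>\<xi>. ennreal (\<bar>f (a \<xi>)\<bar> powr r) * indicator (U \<xi>) x"]) auto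
        finally show ?thesis .
      qed simp
    qed
    also have "\<dots> = ennreal Smax" unfolding Smax_def by (rule cell_sum) simp
    finally show ?thesis using S0 by simp
  qed
  have min_le: "Smin \<le> real B * I"
  proof -
    have "ennreal Smin = (\<integral>\<^sup>+x. (\<Sum>\<xi>\<in>\<Lambda>. ennreal (\<bar>f (b \<xi>)\<bar> powr r) * indicator (U \<xi>) x) \<partial>lborel)"
      unfolding Smin_def by (rule cell_sum[symmetric]) simp
    also have "\<dots> \<le> (\<integral>\<^sup>+x. of_nat B * (ennreal (\<bar>f x\<bar> powr r) * indicator \<Omega> x) \<partial>lborel)"
    proof (rule nn_integral_mono)
      fix x
      have "(\<Sum>\<xi>\<in>\<Lambda>. ennreal (\<bar>f (b \<xi>)\<bar> powr r) * indicator (U \<xi>) x)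
         = (\<Sum>\<xi>\<in>\<Lambda>. if x \<in> U \<xi> then ennreal (\<bar>f (b \<xi>)\<bar> powr r) else 0)"
        by (intro sum.cong) (auto simp: indicator_def)
      also have "\<dots> = (\<Sum>\<xi>\<in>{\<xi>\<in>\<Lambda>. x \<in> U \<xi>}. ennreal (\<bar>f (b \<xi>)\<bar> powr r))"
        by (rule sum.inter_filter[OF fin, symmetric])
      also have "\<dots> \<le> (\<Sum>\<xi>\<in>{\<xi>\<in>\<Lambda>. x \<in> U \<xi>}. ennreal (\<bar>f x\<bar> powr r) * indicator \<Omega> x)"
      proof (rule sum_mono)
        fix \<xi> assume \<xi>: "\<xi> \<in> {\<xi>\<in>\<Lambda>. x \<in> U \<xi>}"
        then have "x \<in> \<Omega>" by (simp add: U_def rho_ball_def)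
        then show "ennreal (\<bar>f (b \<xi>)\<bar> powr r) \<le> ennreal (\<bar>f x\<bar> powr r) * indicator \<Omega> x"
          using \<xi> ext(1)[of \<xi> x] r by (auto intro!: ennreal_leI powr_mono2)
      qed
      also have "\<dots> = of_nat (card {\<xi>\<in>\<Lambda>. x \<in> U \<xi>}) * (ennreal (\<bar>f x\<bar> powr r) * indicator \<Omega> x)" by simp
      also have "\<dots> \<le> of_nat B * (ennreal (\<bar>f x\<bar> powr r) * indicator \<Omega> x)"
      proof (rule mult_right_mono)
        have "card {\<xi>\<in>\<Lambda>. x \<in> U \<xi>} \<le> card {\<xi>\<in>\<Lambda>. rho \<Omega> \<xi> x \<le> \<epsilon> / real n}"
          using fin by (intro card_mono) (auto simp: U_def rho_ball_def t_def)
        then show "of_nat (card {\<xi>\<in>\<Lambda>. x \<in> U \<xi>}) \<le> (of_nat B :: ennreal)" using B[of x] by (simp add: of_nat_mono)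
      qed simp
      finally show "(\<Sum>\<xi>\<in>\<Lambda>. ennreal (\<bar>f (b \<xi>)\<bar> powr r) * indicator (U \<xi>) x) \<le> of_nat B * (ennreal (\<bar>f x\<bar> powr r) * indicator \<Omega> x)" .
    qed
    also have "\<dots> = of_nat B * ennreal I" by (subst nn_integral_cmult) (auto simp: NN)
    also have "\<dots> = ennreal (real B * I)" using I0 by (simp add: ennreal_mult ennreal_of_nat_eq_real_of_nat)
    finally show ?thesis using I0 by (subst (asm) ennreal_le_iff) auto
  qed
  define N where "N = card \<X>"
  have osc_le: "Sosc \<le> real N * (real B * ((C * \<epsilon>) powr r * I))"
  proof -
    let ?o = "\<lambda>\<xi>. ennreal (\<bar>f (a \<xi>) - f (b \<xi>)\<bar> powr r)"
    have "ennreal Sosc = (\<Sum>\<xi>\<in>\<Lambda>. ennreal (\<mu> \<xi>) * ?o \<xi>)"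
      unfolding Sosc_def using \<mu>(2) by (simp add: sum_ennreal[symmetric] ennreal_mult del: sum_ennreal)
    \<comment> \<open>The oscillation estimate is available only on the pieces, so each cell is cut
      along them; their number enters the constant because they may overlap.\<close>
    also have "\<dots> \<le> (\<Sum>\<xi>\<in>\<Lambda>. (\<Sum>X\<in>\<X>. emeasure lborel (U \<xi> \<inter> X)) * ?o \<xi>)"
    proof (intro sum_mono mult_right_mono)
      fix \<xi>
      have "U \<xi> = (\<Union>X\<in>\<X>. U \<xi> \<inter> X)" using \<X>(2) by (auto simp: U_def rho_ball_def)
      then have "emeasure lborel (U \<xi>) = emeasure lborel (\<Union>X\<in>\<X>. U \<xi> \<inter> X)" by simp
      also have "\<dots> \<le> (\<Sum>X\<in>\<X>. emeasure lborel (U \<xi> \<inter> X))"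
        using \<X>(1,3) Um[of \<xi>] by (intro emeasure_subadditive_finite) auto
      finally show "ennreal (\<mu> \<xi>) \<le> (\<Sum>X\<in>\<X>. emeasure lborel (U \<xi> \<inter> X))" by (simp add: \<mu>)
    qed simp
    also have "\<dots> = (\<Sum>X\<in>\<X>. \<Sum>\<xi>\<in>\<Lambda>. emeasure lborel (U \<xi> \<inter> X) * ?o \<xi>)"
      unfolding sum_distrib_right by (rule sum.swap)
    also have "\<dots> \<le> (\<Sum>X\<in>\<X>. of_nat B * (ennreal ((C * \<epsilon>) powr r) * ennreal I))"
    proof (rule sum_mono)
      fix X assume X: "X \<in> \<X>"
      have "(\<Sum>\<xi>\<in>\<Lambda>. emeasure lborel (rho_ball \<Omega> \<xi> (\<epsilon> / real n) \<inter> X) * ?o \<xi>)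
         \<le> of_nat B * (ennreal ((C * \<epsilon>) powr r) * power_mass \<Omega> r f)"
        using \<X> X Um ab
        by (intro sum_osc_le[OF \<X>(4)[OF X] _ _ \<epsilon> poly_degree_le_quad_slice[OF f] fm r fin ne _ _ _ B]) (auto simp: U_def t_def)
      then show "(\<Sum>\<xi>\<in>\<Lambda>. emeasure lborel (U \<xi> \<inter> X) * ?o \<xi>) \<le> of_nat B * (ennreal ((C * \<epsilon>) powr r) * ennreal I)"
        by (simp add: NN U_def t_def)
    qed
    also have "\<dots> = ennreal (real N * (real B * ((C * \<epsilon>) powr r * I)))"
      using I0 by (simp add: N_def ennreal_mult ennreal_of_nat_eq_real_of_nat)
    finally show ?thesis using I0 by (subst (asm) ennreal_le_iff) auto
  qed
  have max_le: "Smax \<le> 2 powr r * (Smin + Sosc)"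
  proof -
    have "Smax \<le> (\<Sum>\<xi>\<in>\<Lambda>. \<mu> \<xi> * (2 powr r * (\<bar>f (b \<xi>)\<bar> powr r + \<bar>f (a \<xi>) - f (b \<xi>)\<bar> powr r)))"
      unfolding Smax_def
    proof (intro sum_mono mult_left_mono \<mu>(2))
      fix \<xi>
      have "\<bar>f (a \<xi>)\<bar> powr r \<le> (\<bar>f (b \<xi>)\<bar> + \<bar>f (a \<xi>) - f (b \<xi>)\<bar>) powr r" using r by (intro powr_mono2) auto
      also have "\<dots> \<le> 2 powr r * (\<bar>f (b \<xi>)\<bar> powr r + \<bar>f (a \<xi>) - f (b \<xi>)\<bar> powr r)" using r by (intro powr_add_le) auto
      finally show "\<bar>f (a \<xi>)\<bar> powr r \<le> 2 powr r * (\<bar>f (b \<xi>)\<bar> powr r + \<bar>f (a \<xi>) - f (b \<xi>)\<bar> powr r)" .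
    qed
    also have "\<dots> = 2 powr r * (Smin + Sosc)"
      unfolding Smin_def Sosc_def sum.distrib[symmetric] sum_distrib_left by (intro sum.cong) (auto simp: algebra_simps)
    finally show ?thesis .
  qed
  have osc_half: "2 powr r * Sosc \<le> I / 2"
  proof -
    \<comment> \<open>As q \<le> 1, its r-th power is at most q, so that a condition linear in
      \<epsilon> serves all exponents.\<close>
    define q where "q = 2 * C * \<epsilon>"
    define L where "L = real N * real B"
    have L: "0 \<le> L" by (simp add: L_def)
    have q: "0 \<le> q" "q * (2 * (L + 1)) \<le> 1" using C \<epsilon> small by (simp_all add: q_def L_def N_def)
    have q1: "q \<le> 1" using q L mult_left_mono[of 1 "2 * (L + 1)" q] by simp
    have "q powr r \<le> q"
    proof (cases "q = 0")
      case False
      then show ?thesis using q q1 r powr_mono'[of 1 r q] by simp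
    qed (use r in simp)
    then have "L * q powr r \<le> L * q" using L by (rule mult_left_mono)
    also have "\<dots> \<le> 1 / 2" using q L by (simp add: algebra_simps)
    finally have Lq: "L * q powr r \<le> 1 / 2" .
    have "2 powr r * Sosc \<le> 2 powr r * (real N * (real B * ((C * \<epsilon>) powr r * I)))"
      using osc_le by (intro mult_left_mono) auto
    also have "\<dots> = L * q powr r * I"
      by (simp add: q_def L_def powr_mult mult_ac)
    also have "\<dots> \<le> 1 / 2 * I" using Lq I0 by (rule mult_right_mono)
    finally show ?thesis by simp
  qed
  have powr_le: "x powr (1 / r) \<le> c * y powr (1 / r)" if "0 \<le> x" "0 \<le> y" "0 \<le> c" "x \<le> c powr r * y" for x y c
  proof -
    have "x powr (1 / r) \<le> (c powr r * y) powr (1 / r)" using that r by (intro powr_mono2) auto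
    also have "\<dots> = c * y powr (1 / r)" using that r by (simp add: powr_mult powr_powr)
    finally show ?thesis .
  qed
  show "1 / (2 * (real B + 1)) * max_norm \<Omega> \<Lambda> (\<epsilon> / real n) (ereal r) f \<le> Lp_norm \<Omega> (ereal r) f"
  proof -
    have "2 powr r * Smin \<le> 2 powr r * (real B * I)" using min_le by (intro mult_left_mono) auto
    then have "Smax \<le> 2 powr r * (real B * I) + I / 2"
      using max_le osc_half unfolding distrib_left by linarith
    also have "\<dots> \<le> 2 powr r * (real B * I) + 2 powr r * I"
    proof -
      have "1 / 2 * I \<le> 2 powr r * I" using r ge_one_powr_ge_zero[of 2 r] I0 by (intro mult_right_mono) auto
      then show ?thesis by simp
    qed
    also have "\<dots> = 2 powr r * ((real B + 1) * I)" by (simp add: algebra_simps)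
    \<comment> \<open>A base of at least 1 does not decrease under the power r, and the root will
      undo the power.\<close>
    also have "\<dots> \<le> 2 powr r * ((real B + 1) powr r * I)"
      using powr_mono[of 1 r "real B + 1"] r I0 by (intro mult_left_mono mult_right_mono) auto
    also have "\<dots> = (2 * (real B + 1)) powr r * I" by (simp only: powr_mult mult.assoc)
    finally have "Smax powr (1 / r) \<le> 2 * (real B + 1) * I powr (1 / r)" using S0 I0 by (intro powr_le) auto
    then show ?thesis unfolding t_def[symmetric] mx lp by (simp add: pos_divide_le_eq mult.commute)
  qed
  show "Lp_norm \<Omega> (ereal r) f \<le> 4 * min_norm \<Omega> \<Lambda> (\<epsilon> / real n) (ereal r) f"
  proof -
    have "I \<le> 2 powr r * Smin + I / 2" using I_le max_le osc_half by (simp add: distrib_left)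
    then have "I \<le> 2 * 2 powr r * Smin" by simp
    also have "\<dots> \<le> 2 powr r * 2 powr r * Smin"
      using powr_mono[of 1 r "2::real"] r S0 by (intro mult_right_mono) auto
    also have "2 powr r * 2 powr r = (4::real) powr r" by (simp add: powr_mult[symmetric])
    finally have "I powr (1 / r) \<le> 4 * Smin powr (1 / r)" using S0 I0 by (intro powr_le) auto
    then show ?thesis unfolding t_def[symmetric] mn lp .
  qed
qed

text \<open>Let |f| attain its maximum at x, in the cell of \<xi>. Both f x and the value of least
  modulus in this cell differ from f \<xi> by at most C \<epsilon> |f x|, hence by at most |f x|/4,
  so the smallest modulus is at least half of the maximum.\<close>

lemma discretization_infinite_exponent:
  fixes f :: "'a::euclidean_space \<Rightarrow> real" and \<Lambda> :: "'a set"
  assumes G: "open G" "\<Omega> = closure G" and \<Omega>: "compact \<Omega>" "\<Omega> \<noteq> {}"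
    and \<X>: "\<Union>\<X> = \<Omega>" "\<And>X. X \<in> \<X> \<Longrightarrow> osc_bound n \<Omega> X C e0"
    and n: "1 \<le> n" and \<epsilon>: "0 < \<epsilon>" "\<epsilon> < e0" and small: "4 * C * \<epsilon> \<le> 1"
    and \<Lambda>: "maximal_eps_separated \<Omega> (rho \<Omega>) (\<epsilon> / real n) \<Lambda>" and f: "poly_degree_le n f"
  shows "0 \<le> max_norm \<Omega> \<Lambda> (\<epsilon> / real n) \<infinity> f"
    and "max_norm \<Omega> \<Lambda> (\<epsilon> / real n) \<infinity> f \<le> Lp_norm \<Omega> \<infinity> f"
    and "Lp_norm \<Omega> \<infinity> f \<le> 2 * min_norm \<Omega> \<Lambda> (\<epsilon> / real n) \<infinity> f"
proof -
  define t where "t = \<epsilon> / real n"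
  have t: "0 < t" using \<epsilon> n by (simp add: t_def)
  note max = \<Lambda>[folded t_def]
  have sub: "\<Lambda> \<subseteq> \<Omega>" and sep: "eps_separated (rho \<Omega>) t \<Lambda>" using max by (auto simp: maximal_eps_separated_def)
  have fin: "finite \<Lambda>" by (rule separated_finite[OF \<Omega>(1) sub sep t])
  have ne: "\<Lambda> \<noteq> {}" using maximal_covers[OF max] \<Omega>(2) by blast
  have cf: "continuous_on UNIV f" by (rule poly_degree_le_continuous[OF f])
  have fm: "f \<in> borel_measurable borel" using cf by (rule borel_measurable_continuous_onI)
  have "continuous_on \<Omega> (\<lambda>x. \<bar>f x\<bar>)" using cf by (intro continuous_intros) (auto intro: continuous_on_subset)
  then obtain x where x: "x \<in> \<Omega>" "\<And>y. y \<in> \<Omega> \<Longrightarrow> \<bar>f y\<bar> \<le> \<bar>f x\<bar>"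
    using continuous_attains_sup[OF \<Omega>] by blast
  have lp: "Lp_norm \<Omega> \<infinity> f = \<bar>f x\<bar>" by (rule Lp_norm_infinity[OF G cf x])
  have "\<forall>\<xi>\<in>\<Lambda>. \<exists>a b. a \<in> rho_ball \<Omega> \<xi> t \<and> b \<in> rho_ball \<Omega> \<xi> t \<and> (\<forall>\<eta>\<in>rho_ball \<Omega> \<xi> t. \<bar>f b\<bar> \<le> \<bar>f \<eta>\<bar> \<and> \<bar>f \<eta>\<bar> \<le> \<bar>f a\<bar>)"
    using rho_ball_extrema[OF \<Omega>(1) cf _ t] sub by (meson subsetD)
  then obtain a b where ab: "\<And>\<xi>. \<xi> \<in> \<Lambda> \<Longrightarrow> a \<xi> \<in> rho_ball \<Omega> \<xi> t" "\<And>\<xi>. \<xi> \<in> \<Lambda> \<Longrightarrow> b \<xi> \<in> rho_ball \<Omega> \<xi> t"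
    and ext: "\<And>\<xi> \<eta>. \<xi> \<in> \<Lambda> \<Longrightarrow> \<eta> \<in> rho_ball \<Omega> \<xi> t \<Longrightarrow> \<bar>f (b \<xi>)\<bar> \<le> \<bar>f \<eta>\<bar>" "\<And>\<xi> \<eta>. \<xi> \<in> \<Lambda> \<Longrightarrow> \<eta> \<in> rho_ball \<Omega> \<xi> t \<Longrightarrow> \<bar>f \<eta>\<bar> \<le> \<bar>f (a \<xi>)\<bar>"
    by metis
  have in\<Omega>: "\<eta> \<in> \<Omega>" if "\<eta> \<in> rho_ball \<Omega> \<xi> t" for \<eta> \<xi> using that by (simp add: rho_ball_def)
  have mx: "max_norm \<Omega> \<Lambda> t \<infinity> f = (SUP \<xi>\<in>\<Lambda>. \<bar>f (a \<xi>)\<bar>)"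
  proof -
    have "(SUP \<eta>\<in>rho_ball \<Omega> \<xi> t. \<bar>f \<eta>\<bar>) = \<bar>f (a \<xi>)\<bar>" if "\<xi> \<in> \<Lambda>" for \<xi>
      using ab(1)[OF that] ext(2)[OF that] by (intro cSup_eq_maximum) auto
    then show ?thesis by (simp add: max_norm_def cong: image_cong)
  qed
  have mn: "min_norm \<Omega> \<Lambda> t \<infinity> f = (SUP \<xi>\<in>\<Lambda>. \<bar>f (b \<xi>)\<bar>)"
  proof -
    have "(INF \<eta>\<in>rho_ball \<Omega> \<xi> t. \<bar>f \<eta>\<bar>) = \<bar>f (b \<xi>)\<bar>" if "\<xi> \<in> \<Lambda>" for \<xi>
      using ab(2)[OF that] ext(1)[OF that] by (intro cInf_eq_minimum) auto
    then show ?thesis by (simp add: min_norm_def cong: image_cong)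
  qed
  show "0 \<le> max_norm \<Omega> \<Lambda> (\<epsilon> / real n) \<infinity> f"
  proof -
    obtain \<xi> where \<xi>: "\<xi> \<in> \<Lambda>" using ne by blast
    have "\<bar>f (a \<xi>)\<bar> \<le> (SUP \<xi>\<in>\<Lambda>. \<bar>f (a \<xi>)\<bar>)" using fin \<xi> by (intro cSUP_upper) auto
    then show ?thesis unfolding t_def[symmetric] mx by simp
  qed
  show "max_norm \<Omega> \<Lambda> (\<epsilon> / real n) \<infinity> f \<le> Lp_norm \<Omega> \<infinity> f"
    unfolding t_def[symmetric] mx lp using ne x ab(1) in\<Omega> by (intro cSUP_least) auto
  obtain \<xi> where \<xi>: "\<xi> \<in> \<Lambda>" "x \<in> rho_ball \<Omega> \<xi> t" using maximal_covers[OF max x(1)] by blast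
  obtain X where X: "X \<in> \<X>" "\<xi> \<in> X" using \<xi>(1) sub \<X>(1) by blast
  have near: "\<bar>f \<xi> - f \<eta>\<bar> \<le> C * \<epsilon> * \<bar>f x\<bar>" if "\<eta> \<in> rho_ball \<Omega> \<xi> t" for \<eta>
  proof (rule osc_bound_sup[OF \<X>(2)[OF X(1)] \<epsilon> poly_degree_le_quad_slice[OF f] fm x(2) X(2) in\<Omega>[OF that]])
    have "rho \<Omega> \<xi> \<eta> \<le> t" using that by (simp add: rho_ball_def)
    also have "\<dots> \<le> 2 * \<epsilon> / real n" using t by (simp add: t_def)
    finally show "rho \<Omega> \<xi> \<eta> \<le> 2 * \<epsilon> / real n" .
  qed
  have "4 * C * \<epsilon> * \<bar>f x\<bar> \<le> 1 * \<bar>f x\<bar>" using small by (rule mult_right_mono) simp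
  then have "C * \<epsilon> * \<bar>f x\<bar> \<le> \<bar>f x\<bar> / 4" by simp
  then have "\<bar>f x\<bar> \<le> 2 * \<bar>f (b \<xi>)\<bar>" using near[OF \<xi>(2)] near[OF ab(2)[OF \<xi>(1)]] by linarith
  also have "\<bar>f (b \<xi>)\<bar> \<le> (SUP \<xi>\<in>\<Lambda>. \<bar>f (b \<xi>)\<bar>)" using fin \<xi>(1) by (intro cSUP_upper) auto
  finally show "Lp_norm \<Omega> \<infinity> f \<le> 2 * min_norm \<Omega> \<Lambda> (\<epsilon> / real n) \<infinity> f"
    unfolding t_def[symmetric] mn lp by simp
qed

text \<open>The proof gives constants that serve all p at once: C1 = 1/(2(B + 1)) with the overlap
  number B, determined by the dimension, and C2 = 4. The geometry of the domain enters only through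
  the bound on \<epsilon>.\<close>

theorem theorem2p11:
  fixes G \<Omega> :: "((real ^ 'd) \<times> real) set"
  assumes "open G" and "connected G" and "bounded G" and "G \<noteq> {}"
    and "\<Omega> = closure G" and "C2_domain \<Omega>"
  shows "\<exists>\<epsilon>\<^sub>0::real. 0 < \<epsilon>\<^sub>0 \<and> \<epsilon>\<^sub>0 < 1 \<and>
    (\<forall>p::ereal. 1 \<le> p \<longrightarrow>
      (\<exists>C\<^sub>1 C\<^sub>2 :: real. C\<^sub>1 > 0 \<and> C\<^sub>2 > 0 \<and>
        (\<forall>(n::nat) (\<epsilon>::real) \<Lambda> f.
           1 \<le> n \<longrightarrow> 0 < \<epsilon> \<longrightarrow> \<epsilon> < \<epsilon>\<^sub>0 \<longrightarrow>
           maximal_eps_separated \<Omega> (rho \<Omega>) (\<epsilon> / real n) \<Lambda> \<longrightarrow>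
           poly_degree_le n f \<longrightarrow>
           C\<^sub>1 * max_norm \<Omega> \<Lambda> (\<epsilon> / real n) p f \<le> Lp_norm \<Omega> p f \<and>
           Lp_norm \<Omega> p f \<le> C\<^sub>2 * min_norm \<Omega> \<Lambda> (\<epsilon> / real n) p f)))"
proof -
  have \<Omega>: "compact \<Omega>" "\<Omega> \<noteq> {}" using assms by (auto simp: compact_closure)
  obtain C e0 \<X> where C: "0 \<le> C" "0 < e0" and \<X>: "finite \<X>" "\<Union>\<X> = \<Omega>" "\<X> \<subseteq> sets borel"
    and ob: "\<And>n X. 1 \<le> n \<Longrightarrow> X \<in> \<X> \<Longrightarrow> osc_bound n \<Omega> X C e0"
    using C2_domain_osc_bound[OF compact_imp_closed[OF \<Omega>(1)] \<Omega>(2) assms(6)] by blast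
  obtain B :: nat where B: "\<And>(S :: ((real ^ 'd) \<times> real) set) \<Lambda> t x. 0 < t \<Longrightarrow> eps_separated (rho S) t \<Lambda> \<Longrightarrow> card {\<xi>\<in>\<Lambda>. rho S \<xi> x \<le> t} \<le> B"
    using separated_overlap by blast
  define L where "L = real (card \<X>) * real B + 1"
  \<comment> \<open>The last entry makes the oscillation absorbable; C + 1 in place of C guards
    against division by 0.\<close>
  define \<epsilon>0 where "\<epsilon>0 = min (1 / 2) (min e0 (1 / (4 * (C + 1) * L)))"
  have L: "1 \<le> L" by (simp add: L_def)
  have e0: "0 < \<epsilon>0" "\<epsilon>0 < 1" using C L by (auto simp: \<epsilon>0_def)
  have small: "\<epsilon> < e0" "2 * C * \<epsilon> * (2 * L) \<le> 1" "4 * C * \<epsilon> \<le> 1" if "0 < \<epsilon>" "\<epsilon> < \<epsilon>0" for \<epsilon>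
  proof -
    show "\<epsilon> < e0" using that by (simp add: \<epsilon>0_def)
    have "\<epsilon> \<le> 1 / (4 * (C + 1) * L)" using that by (simp add: \<epsilon>0_def)
    then have "\<epsilon> * (4 * (C + 1) * L) \<le> 1" using C L by (subst (asm) pos_le_divide_eq) auto
    moreover have "0 \<le> \<epsilon> * L" using that L by simp
    ultimately show 1: "2 * C * \<epsilon> * (2 * L) \<le> 1" by (simp add: algebra_simps)
    have "4 * C * \<epsilon> * 1 \<le> 4 * C * \<epsilon> * L" using C L that by (intro mult_left_mono) auto
    then show "4 * C * \<epsilon> \<le> 1" using 1 by simp
  qed
  have main: "1 / (2 * (real B + 1)) * max_norm \<Omega> \<Lambda> (\<epsilon> / real n) p f \<le> Lp_norm \<Omega> p f \<and>
      Lp_norm \<Omega> p f \<le> 4 * min_norm \<Omega> \<Lambda> (\<epsilon> / real n) p f"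
    if p: "1 \<le> p" and n: "1 \<le> n" and \<epsilon>: "0 < \<epsilon>" "\<epsilon> < \<epsilon>0"
      and \<Lambda>: "maximal_eps_separated \<Omega> (rho \<Omega>) (\<epsilon> / real n) \<Lambda>" and f: "poly_degree_le n f" for p n \<epsilon> \<Lambda> f
  proof (cases "p = \<infinity>")
    case False
    then obtain r where r: "p = ereal r" "1 \<le> r" using p by (cases p) (auto simp: one_ereal_def)
    have "card {\<xi>\<in>\<Lambda>. rho \<Omega> \<xi> x \<le> \<epsilon> / real n} \<le> B" for x
      using \<Lambda> \<epsilon> n by (intro B) (auto simp: maximal_eps_separated_def)
    from discretization_finite_exponent[OF \<Omega> C(1) \<X> ob[OF n] this n \<epsilon>(1) small(1)[OF \<epsilon>] _ \<Lambda> f r(2)]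
    show ?thesis using small(2)[OF \<epsilon>] unfolding r(1) L_def by blast
  next
    case True
    note * = discretization_infinite_exponent[OF assms(1,5) \<Omega> \<X>(2) ob[OF n] n \<epsilon>(1) small(1)[OF \<epsilon>] small(3)[OF \<epsilon>] \<Lambda> f]
    have lp0: "0 \<le> min_norm \<Omega> \<Lambda> (\<epsilon> / real n) \<infinity> f" using * by linarith
    have "1 / (2 * (real B + 1)) * max_norm \<Omega> \<Lambda> (\<epsilon> / real n) \<infinity> f \<le> 1 * max_norm \<Omega> \<Lambda> (\<epsilon> / real n) \<infinity> f"
      using *(1) by (intro mult_right_mono) (auto simp: pos_divide_le_eq)
    then show ?thesis using *(2,3) lp0 True by simp
  qed
  have "0 < 1 / (2 * (real B + 1))" by simp
  show ?thesis
  proof (rule exI[of _ \<epsilon>0], intro conjI e0 allI impI)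
    fix p :: ereal assume p: "1 \<le> p"
    show "\<exists>C\<^sub>1 C\<^sub>2 :: real. C\<^sub>1 > 0 \<and> C\<^sub>2 > 0 \<and>
        (\<forall>(n::nat) (\<epsilon>::real) \<Lambda> f.
           1 \<le> n \<longrightarrow> 0 < \<epsilon> \<longrightarrow> \<epsilon> < \<epsilon>0 \<longrightarrow>
           maximal_eps_separated \<Omega> (rho \<Omega>) (\<epsilon> / real n) \<Lambda> \<longrightarrow>
           poly_degree_le n f \<longrightarrow>
           C\<^sub>1 * max_norm \<Omega> \<Lambda> (\<epsilon> / real n) p f \<le> Lp_norm \<Omega> p f \<and>
           Lp_norm \<Omega> p f \<le> C\<^sub>2 * min_norm \<Omega> \<Lambda> (\<epsilon> / real n) p f)"
    proof (rule exI[of _ "1 / (2 * (real B + 1))"], rule exI[of _ 4], intro conjI allI impI)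
      fix n :: nat and \<epsilon> :: real and \<Lambda> and f :: "(real ^ 'd) \<times> real \<Rightarrow> real"
      assume *: "1 \<le> n" "0 < \<epsilon>" "\<epsilon> < \<epsilon>0" "maximal_eps_separated \<Omega> (rho \<Omega>) (\<epsilon> / real n) \<Lambda>" "poly_degree_le n f"
      show "1 / (2 * (real B + 1)) * max_norm \<Omega> \<Lambda> (\<epsilon> / real n) p f \<le> Lp_norm \<Omega> p f"
        and "Lp_norm \<Omega> p f \<le> 4 * min_norm \<Omega> \<Lambda> (\<epsilon> / real n) p f"
        using main[OF p *] by (simp_all only:)
    qed simp_all
  qed
qed

end
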